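(* Let $\beta,\gamma>0$ and let $B^g$ be the general Brownian motion on $\mathbb{R}_+=[0,+\infty)$ with parameters $\beta,\gamma$ (sticky Brownian motion with stickiness $\gamma$, killed when its local time at the origin exceeds an independent exponential random variable of rate $\beta$; defined in the context). Let $A^g$ be the generator of its semigroup on $C_0(\mathbb{R}_+)$. Then the domain $\mathcal{D}(A^g)$ is equal to the space of functions $f\in C_0^2(\mathbb{R}_+)$ such that $$\beta f(0)-f'(0+)+\frac{\gamma}{2}\,f''(0+)=0.$$
   Context: Setting. $(\Omega,\mathcal{A})$ is a measurable space with probability measures $(P_x,\,x\in\mathbb{R})$ and a right continuous filtration $\mathcal{F}=(\mathcal{F}_t,\,t\ge0)$, complete with respect to $(P_x)$; $B=(B_t,\,t\ge0)$ is a standard one-dimensional Brownian motion relative to $\mathcal{F}$ with $P_x(B_0=x)=1$, equipped with shift operators $\theta_t:\Omega\to\Omega$ with $B_s\circ\theta_t=B_{s+t}$. $L=(L_t,\,t\ge0)$ is the local time of $B$ at $0$, normalized so that Tanaka's formula reads $d|B_t|=\operatorname{sign}(B_t)\,dB_t+dL_t$. All paths of $B$ and $L$ are continuous. Sticky Brownian motion. Let $\tau^{-1}(t)=t+\gamma L_t$, $t\ge0$ (a strictly increasing continuous bijection of $\mathbb{R}_+$), with inverse $\tau$; put $B^s_t=|B_{\tau(t)}|$ and $L^s_t=L_{\tau(t)}$, $t\ge0$ ($L^s$ is a local time of $B^s$ at the origin). General Brownian motion. Let $P_\beta$ be the exponential law of rate $\beta$ on $\mathbb{R}_+$, $S(s)=s$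 the identity random variable on $\mathbb{R}_+$, and $\hat\Omega=\Omega\times\mathbb{R}_+$ with product $\sigma$-algebra and measures $\hat P_x=P_x\otimes P_\beta$; random variables are extended trivially to $\hat\Omega$. Put $\zeta_{\beta,\gamma}=\inf\{t\ge0:\,L^s_t>S\}$, and $B^g_t=B^s_t$ if $t<\zeta_{\beta,\gamma}$, $B^g_t=\Delta$ if $t\ge\zeta_{\beta,\gamma}$, where $\Delta$ is a cemetery point. Every function $f$ on $\mathbb{R}_+$ is extended by $f(\Delta)=0$. The semigroup is $U^g_tf(x)=\hat E_x(f(B^g_t))$, $x\in\mathbb{R}_+$, and $A^g$ is its infinitesimal generator on $C_0(\mathbb{R}_+)$. $C_0(\mathbb{R}_+)$ is the space of real continuous functions on $[0,+\infty)$ vanishing at infinity. $C_0^2(\mathbb{R}_+)$ is the subspace of those $f\in C_0(\mathbb{R}_+)$ that are twice continuously differentiable on $(0,+\infty)$ and such that $f''$ extends to a continuous function on $[0,+\infty)$; for such $f$ the finite right limits $f'(0+)$, $f''(0+)$ at $0$ exist.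
   Formalization: In C_0^2 the second derivative f'' is required to extend to a function in C_0 (continuous and vanishing at infinity), not merely to a continuous function on [0,∞); otherwise the claim fails, e.g. for f vanishing near 0 and equal to sin(x²)/x for x ≥ 1. *)

theory Defs
  imports "HOL-Probability.Probability"
begin

text \<open>Time is the real line; only nonnegative times carry meaning, so every hypothesis on a
  process or filtration is guarded by \<open>0 \<le> t\<close>.\<close>

section \<open>Brownian motion with its filtration\<close>

text \<open>In \<open>complete\<close>, the null sets are subsets of \<open>space M\<close> (a priori not in \<open>sets M\<close>) that are
  negligible for every \<open>P x\<close> simultaneously.\<close>

locale brownian_family =
  fixes M :: "'a measure"
    and P :: "real \<Rightarrow> 'a measure"
    and F :: "real \<Rightarrow> 'a measure"
    and B :: "real \<Rightarrow> 'a \<Rightarrow> real"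
    and \<theta> :: "real \<Rightarrow> 'a \<Rightarrow> 'a"
  assumes prob_space_P: "\<And>x. prob_space (P x)"
    and sets_P: "\<And>x. sets (P x) = sets M"
    and subalgebra_F: "\<And>t. 0 \<le> t \<Longrightarrow> subalgebra M (F t)"
    and mono_F: "\<And>s t. 0 \<le> s \<Longrightarrow> s \<le> t \<Longrightarrow> sets (F s) \<subseteq> sets (F t)"
    and right_continuous_F: "\<And>t. 0 \<le> t \<Longrightarrow> sets (F t) = (\<Inter>s\<in>{t<..}. sets (F s))"
    and complete: "(\<Inter>x. null_sets (completion (P x))) \<subseteq> sets (F 0)"
    and adapted_B: "\<And>t. 0 \<le> t \<Longrightarrow> B t \<in> borel_measurable (F t)"
    and continuous_B: "\<And>\<omega>. \<omega> \<in> space M \<Longrightarrow> continuous_on {0..} (\<lambda>t. B t \<omega>)"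
    and start_B: "\<And>x. measure (P x) {\<omega> \<in> space (P x). B 0 \<omega> = x} = 1"
    and increment_distributed: "\<And>x s t. 0 \<le> s \<Longrightarrow> s < t \<Longrightarrow>
      distributed (P x) lborel (\<lambda>\<omega>. B t \<omega> - B s \<omega>) (normal_density 0 (sqrt (t - s)))"
    and increment_indep: "\<And>x s t. 0 \<le> s \<Longrightarrow> s < t \<Longrightarrow>
      prob_space.indep_set (P x) (sets (F s))
        (sets (vimage_algebra (space M) (\<lambda>\<omega>. B t \<omega> - B s \<omega>) borel))"
    and shift_space: "\<And>t. 0 \<le> t \<Longrightarrow> \<theta> t \<in> space M \<rightarrow> space M"
    and shift_B: "\<And>s t \<omega>. 0 \<le> s \<Longrightarrow> 0 \<le> t \<Longrightarrow> \<omega> \<in> space M \<Longrightarrow> B s (\<theta> t \<omega>) = B (s + t) \<omega>"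

section \<open>Ito integral and local time\<close>

text \<open>A simple process is given by partition points \<open>p 0 \<le> \<dots> \<le> p n\<close> and bounded
  \<open>F (p i)\<close>-measurable heights \<open>\<xi> i\<close> on \<open>(p i, p (i + 1)]\<close>.\<close>

definition simple_integrand ::
  "(real \<Rightarrow> 'a measure) \<Rightarrow> nat \<Rightarrow> (nat \<Rightarrow> real) \<Rightarrow> (nat \<Rightarrow> 'a \<Rightarrow> real) \<Rightarrow> bool" where
  "simple_integrand F n p \<xi> \<longleftrightarrow>
     0 \<le> p 0 \<and> (\<forall>i<n. p i \<le> p (Suc i)) \<and>
     (\<forall>i<n. \<xi> i \<in> borel_measurable (F (p i)) \<and> bounded (\<xi> i ` space (F (p i))))"

definition simple_process ::
  "nat \<Rightarrow> (nat \<Rightarrow> real) \<Rightarrow> (nat \<Rightarrow> 'a \<Rightarrow> real) \<Rightarrow> real \<Rightarrow> 'a \<Rightarrow> real" where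
  "simple_process n p \<xi> s \<omega> = (\<Sum>i<n. \<xi> i \<omega> * indicator {p i<..p (Suc i)} s)"

definition simple_ito_integral ::
  "(real \<Rightarrow> 'a \<Rightarrow> real) \<Rightarrow> nat \<Rightarrow> (nat \<Rightarrow> real) \<Rightarrow> (nat \<Rightarrow> 'a \<Rightarrow> real) \<Rightarrow> real \<Rightarrow> 'a \<Rightarrow> real" where
  "simple_ito_integral B n p \<xi> t \<omega> =
     (\<Sum>i<n. \<xi> i \<omega> * (B (min (p (Suc i)) t) \<omega> - B (min (p i) t) \<omega>))"

text \<open>\<open>has_ito_integral Q F B t H I\<close>: under \<open>Q\<close>, the random variable \<open>I\<close> is (a version of) the
  Ito integral of the progressively measurable integrand \<open>H\<close> with respect to the Brownian motion
  \<open>B\<close> over \<open>[0, t]\<close>, i.e. the \<open>L\<^sup>2\<close>-limit of the integrals of simple processes converging to \<open>H\<close>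
  in \<open>L\<^sup>2(Q \<otimes> ds)\<close>.\<close>

definition has_ito_integral ::
  "'a measure \<Rightarrow> (real \<Rightarrow> 'a measure) \<Rightarrow> (real \<Rightarrow> 'a \<Rightarrow> real) \<Rightarrow> real \<Rightarrow>
    (real \<Rightarrow> 'a \<Rightarrow> real) \<Rightarrow> ('a \<Rightarrow> real) \<Rightarrow> bool" where
  "has_ito_integral Q F B t H I \<longleftrightarrow>
     (\<forall>u\<in>{0..t}. (\<lambda>(s, \<omega>). H s \<omega>) \<in> borel_measurable (restrict_space borel {0..u} \<Otimes>\<^sub>M F u)) \<and>
     I \<in> borel_measurable Q \<and>
     (\<exists>n p \<xi>.
        (\<forall>k. simple_integrand F (n k) (p k) (\<xi> k)) \<and>
        (\<lambda>k. \<integral>\<^sup>+\<omega>. (\<integral>\<^sup>+s\<in>{0..t}.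
             ennreal ((simple_process (n k) (p k) (\<xi> k) s \<omega> - H s \<omega>)\<^sup>2) \<partial>lborel) \<partial>Q)
          \<longlonglongrightarrow> 0 \<and>
        (\<lambda>k. \<integral>\<^sup>+\<omega>.
             ennreal ((simple_ito_integral B (n k) (p k) (\<xi> k) t \<omega> - I \<omega>)\<^sup>2) \<partial>Q)
          \<longlonglongrightarrow> 0)"

text \<open>The local time of \<open>B\<close> at 0 is the continuous increasing adapted process starting at 0 that
  satisfies Tanaka's formula \<open>|B\<^sub>t| = |B\<^sub>0| + \<integral>\<^sub>0\<^sup>t sgn(B\<^sub>s) dB\<^sub>s + L\<^sub>t\<close> under every \<open>P x\<close>. The convention
  for the sign at 0 is immaterial since \<open>B\<close> spends zero Lebesgue time there.\<close>

locale brownian_local_time = brownian_family M P F B \<theta>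
  for M :: "'a measure" and P F and B :: "real \<Rightarrow> 'a \<Rightarrow> real" and \<theta> +
  fixes L :: "real \<Rightarrow> 'a \<Rightarrow> real"
  assumes adapted_L: "\<And>t. 0 \<le> t \<Longrightarrow> L t \<in> borel_measurable (F t)"
    and start_L: "\<And>\<omega>. \<omega> \<in> space M \<Longrightarrow> L 0 \<omega> = 0"
    and mono_L: "\<And>\<omega>. \<omega> \<in> space M \<Longrightarrow> mono_on {0..} (\<lambda>t. L t \<omega>)"
    and continuous_L: "\<And>\<omega>. \<omega> \<in> space M \<Longrightarrow> continuous_on {0..} (\<lambda>t. L t \<omega>)"
    and tanaka: "\<And>x t. 0 \<le> t \<Longrightarrow>
      has_ito_integral (P x) F B t (\<lambda>s \<omega>. sgn (B s \<omega>)) (\<lambda>\<omega>. \<bar>B t \<omega>\<bar> - \<bar>B 0 \<omega>\<bar> - L t \<omega>)"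

section \<open>Sticky and general Brownian motion on the half line\<close>

definition sticky_clock :: "(real \<Rightarrow> 'a \<Rightarrow> real) \<Rightarrow> real \<Rightarrow> real \<Rightarrow> 'a \<Rightarrow> real" where
  "sticky_clock L \<gamma> t \<omega> = inv_into {0..} (\<lambda>s. s + \<gamma> * L s \<omega>) t"

definition sticky_bm ::
  "(real \<Rightarrow> 'a \<Rightarrow> real) \<Rightarrow> (real \<Rightarrow> 'a \<Rightarrow> real) \<Rightarrow> real \<Rightarrow> real \<Rightarrow> 'a \<Rightarrow> real" where
  "sticky_bm B L \<gamma> t \<omega> = \<bar>B (sticky_clock L \<gamma> t \<omega>) \<omega>\<bar>"

definition sticky_local_time :: "(real \<Rightarrow> 'a \<Rightarrow> real) \<Rightarrow> real \<Rightarrow> real \<Rightarrow> 'a \<Rightarrow> real" where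
  "sticky_local_time L \<gamma> t \<omega> = L (sticky_clock L \<gamma> t \<omega>) \<omega>"

definition exponential_law :: "real \<Rightarrow> real measure" where
  "exponential_law \<beta> = restrict_space (density lborel (exponential_density \<beta>)) {0..}"

text \<open>A point of the extended sample space is a pair \<open>(\<omega>, s)\<close>, with \<open>S(\<omega>, s) = s\<close>. The lifetime is
  extended-real valued so that the infimum of the empty set is \<open>\<infinity>\<close>.\<close>

definition killing_time :: "(real \<Rightarrow> 'a \<Rightarrow> real) \<Rightarrow> real \<Rightarrow> 'a \<times> real \<Rightarrow> ereal" where
  "killing_time L \<gamma> = (\<lambda>(\<omega>, s). Inf (ereal ` {t. 0 \<le> t \<and> sticky_local_time L \<gamma> t \<omega> > s}))"

text \<open>The cemetery point is \<open>None\<close>.\<close>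

definition general_bm ::
  "(real \<Rightarrow> 'a \<Rightarrow> real) \<Rightarrow> (real \<Rightarrow> 'a \<Rightarrow> real) \<Rightarrow> real \<Rightarrow> real \<Rightarrow> 'a \<times> real \<Rightarrow> real option" where
  "general_bm B L \<gamma> t w =
     (if ereal t < killing_time L \<gamma> w then Some (sticky_bm B L \<gamma> t (fst w)) else None)"

definition cemetery_extend :: "(real \<Rightarrow> real) \<Rightarrow> real option \<Rightarrow> real" where
  "cemetery_extend f z = (case z of None \<Rightarrow> 0 | Some y \<Rightarrow> f y)"

definition general_bm_semigroup ::
  "(real \<Rightarrow> 'a measure) \<Rightarrow> (real \<Rightarrow> 'a \<Rightarrow> real) \<Rightarrow> (real \<Rightarrow> 'a \<Rightarrow> real) \<Rightarrow> real \<Rightarrow> real \<Rightarrow>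
    real \<Rightarrow> (real \<Rightarrow> real) \<Rightarrow> (real \<Rightarrow> real)" where
  "general_bm_semigroup P B L \<beta> \<gamma> t f =
     (\<lambda>x\<in>{0..}. LINT w|(P x \<Otimes>\<^sub>M exponential_law \<beta>). cemetery_extend f (general_bm B L \<gamma> t w))"

section \<open>Function spaces and generators\<close>

text \<open>Functions on \<open>[0, \<infinity>)\<close> are functions on the reals in \<open>extensional {0..}\<close>, so that equality is
  equality on \<open>[0, \<infinity>)\<close>.\<close>

definition C0 :: "(real \<Rightarrow> real) set" where
  "C0 = {f \<in> extensional {0..}. continuous_on {0..} f \<and> (f \<longlongrightarrow> 0) at_top}"

text \<open>The extension of \<open>f''\<close> is required to lie in \<open>C0\<close>, not merely to be continuous: otherwise
  \<open>C02\<close> would contain functions such as \<open>sin (x\<^sup>2) / x\<close> (modified near 0 so as to vanish there),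
  whose second derivative is unbounded, and generators of the form \<open>f \<mapsto> f'' / 2\<close> would not map
  into \<open>C0\<close>.\<close>

definition C02 :: "(real \<Rightarrow> real) set" where
  "C02 = {f \<in> C0. (\<forall>x>0. f differentiable (at x)) \<and> (\<forall>x>0. deriv f differentiable (at x)) \<and>
            (\<exists>g\<in>C0. \<forall>x>0. deriv (deriv f) x = g x)}"

text \<open>The infinitesimal generator on \<open>C0\<close> as a graph: pairs \<open>(f, g)\<close> of elements of \<open>C0\<close> such that
  \<open>(U\<^sub>t f - f) / t\<close> converges to \<open>g\<close> in supremum norm as \<open>t\<close> decreases to 0.\<close>

definition generator ::
  "(real \<Rightarrow> (real \<Rightarrow> real) \<Rightarrow> (real \<Rightarrow> real)) \<Rightarrow> ((real \<Rightarrow> real) \<times> (real \<Rightarrow> real)) set" where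
  "generator U = {(f, g). f \<in> C0 \<and> g \<in> C0 \<and>
     uniform_limit {0..} (\<lambda>t x. (U t f x - f x) / t) g (at_right 0)}"

end

theory Submission
  imports Defs
begin

text \<open>Let \<open>\<tau>\<close> be the sticky clock at time \<open>t\<close>, \<open>l = L\<^sub>\<tau>\<close> and \<open>Y = |B\<^sub>\<tau>|\<close>. Integrating out the exponential
  variable gives \<open>U\<^sub>t f(x) = E\<^sub>x (f(Y) exp(-\<beta> l))\<close>, where \<open>\<tau> + \<gamma> l = t\<close>. The clock is a stopping time bounded
  by \<open>t\<close>, so optional stopping for \<open>B\<close>, \<open>B\<^sup>2 - t\<close> and, by Tanaka's formula, \<open>|B| - L\<close> gives
  \<open>E(Y - x) = E l\<close> and \<open>E(Y - x)\<^sup>2 = t - \<gamma> E l - 2 x E l\<close>, and the fourth moment of \<open>B\<^sub>\<tau> - x\<close> is \<open>O(t\<^sup>2)\<close>.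
  A second-order Taylor expansion of \<open>f\<close> then yields
  \<open>U\<^sub>t f(x) - f(x) = t f''(x)/2 + b(x) E l + o(t)\<close> with
  \<open>b(x) = f'(x) - \<beta> f(x) - \<gamma>/2 f''(x) - x f''(x)\<close>. The boundary condition says \<open>b(0) = 0\<close>; near 0 one has
  \<open>E l \<le> t/\<gamma>\<close>, and away from 0 one has \<open>E l = 2 E(B\<^sub>\<tau>)\<^sup>- = O(t\<^sup>2/x\<^sup>3)\<close>, so the middle term is \<open>o(t)\<close> uniformly.
  Hence \<open>f \<mapsto> f''/2\<close> under the boundary condition is a restriction of the generator. It is the whole
  generator because \<open>f/2 - f''/2 = h\<close> is solvable under the boundary condition for every \<open>h\<close> in \<open>C0\<close>, while
  contractivity of \<open>U\<^sub>t\<close> makes \<open>f/2 - A f\<close> determine \<open>f\<close>.\<close>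

section \<open>Functions on the half line and the resolvent equation\<close>

text \<open>Stickiness is what permits a direct expansion: the pathwise identity for the clock
  bounds the local time by t/\<gamma> for every starting point, so the mean of Y - x has order t,
  whereas for reflected Brownian motion started at 0 it has order sqrt t. The delicate point is
  uniformity in x. The second moment contains -2 x E l, so b(x) may grow linearly although f and f''
  are bounded; E l must then decay faster than 1/x. This is why a fourth moment is carried through
  optional stopping; it also absorbs the Taylor remainder for large displacements. The Ito integral
  is given as an L2 limit at each fixed time, with unrelated approximating sequences at different
  times, so its martingale property has to be recovered by comparing two such sequences. The
  resolvent parameter 1/2 turns the equation into f - f'' = 2 h, with homogeneous solutions exp x
  and exp (-x). Decay at infinity excludes the first and leaves one constant for the one boundary
  condition.\<close>

lemma C0_iff: "f \<in> C0 \<longleftrightarrow> f \<in> extensional {0..} \<and> continuous_on {0..} f \<and> (f \<longlongrightarrow> 0) at_top"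
  by (simp add: C0_def)

lemma C0_bounded:
  assumes "f \<in> C0"
  obtains K where "K > 0" "\<And>x. x \<ge> 0 \<Longrightarrow> \<bar>f x\<bar> \<le> K"
proof -
  have c: "continuous_on {0..} f" and l: "(f \<longlongrightarrow> 0) at_top"
    using assms by (auto simp: C0_def)
  have "\<forall>\<^sub>F x in at_top. \<bar>f x\<bar> < 1"
    using tendstoD[OF l, of 1] by simp
  then obtain N where N: "\<And>x. x \<ge> N \<Longrightarrow> \<bar>f x\<bar> < 1"
    by (auto simp: eventually_at_top_linorder)
  have "compact (f ` {0..max 0 N})"
    by (intro compact_continuous_image continuous_on_subset[OF c]) auto
  then obtain K where K: "\<And>x. x \<in> {0..max 0 N} \<Longrightarrow> \<bar>f x\<bar> \<le> K"
    using compact_imp_bounded[THEN bounded_normE] by (metis imageI real_norm_def)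
  have "\<bar>f x\<bar> \<le> max 1 K" if "x \<ge> 0" for x
    using K[of x] N[of x] that by (cases "x \<le> max 0 N") (auto simp: less_imp_le max_def split: if_splits)
  then show ?thesis
    using that[of "max 1 K"] by auto
qed

lemma C0_uniformly_continuous_on:
  assumes "f \<in> C0"
  shows "uniformly_continuous_on {0..} f"
  unfolding uniformly_continuous_on_def
proof (intro allI impI)
  fix e :: real assume e: "e > 0"
  have c: "continuous_on {0..} f" and l: "(f \<longlongrightarrow> 0) at_top"
    using assms by (auto simp: C0_def)
  have "\<forall>\<^sub>F x in at_top. \<bar>f x\<bar> < e / 2"
    using tendstoD[OF l, of "e/2"] e by simp
  then obtain N where N: "\<And>x. x \<ge> N \<Longrightarrow> \<bar>f x\<bar> < e / 2"
    by (auto simp: eventually_at_top_linorder)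
  \<comment> \<open>The extra unit, together with \<open>min d 1\<close> below, ensures that two
    close points either both lie in the compact interval or both lie beyond \<open>N\<close>, where
    each value is below e/2.\<close>
  have "uniformly_continuous_on {0..\<bar>N\<bar> + 1} f"
    by (intro compact_uniformly_continuous continuous_on_subset[OF c]) auto
  then obtain d where d: "d > 0"
    "\<And>x y. x \<in> {0..\<bar>N\<bar>+1} \<Longrightarrow> y \<in> {0..\<bar>N\<bar>+1} \<Longrightarrow> dist y x < d \<Longrightarrow> dist (f y) (f x) < e"
    unfolding uniformly_continuous_on_def using e by metis
  have "dist (f y) (f x) < e" if "x \<in> {0..}" "y \<in> {0..}" "dist y x < min d 1" for x y
  proof (cases "x \<le> \<bar>N\<bar> + 1 \<and> y \<le> \<bar>N\<bar> + 1")
    case True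
    then show ?thesis using that by (intro d) auto
  next
    case False
    then have "x \<ge> N" "y \<ge> N"
      using that by (auto simp: dist_real_def abs_if split: if_splits)
    then show ?thesis
      using N[of x] N[of y] by (auto simp: dist_real_def)
  qed
  then show "\<exists>d>0. \<forall>x\<in>{0..}. \<forall>y\<in>{0..}. dist y x < d \<longrightarrow> dist (f y) (f x) < e"
    using d(1) by (intro exI[of _ "min d 1"]) auto
qed

lemma C0_modulus:
  assumes "f \<in> C0" "e > 0"
  obtains d where "d > 0" "\<And>x y. x \<ge> 0 \<Longrightarrow> y \<ge> 0 \<Longrightarrow> \<bar>y - x\<bar> < d \<Longrightarrow> \<bar>f y - f x\<bar> < e"
  using C0_uniformly_continuous_on[OF assms(1)] assms(2)
  unfolding uniformly_continuous_on_def dist_real_def by (metis atLeast_iff)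

section \<open>Antiderivatives and boundary values at 0\<close>

lemma continuous_on_extend_constant:
  fixes f :: "real \<Rightarrow> real"
  assumes "continuous_on {0..} f"
  shows "continuous_on UNIV (\<lambda>x. f (max 0 x))"
  by (rule continuous_on_compose2[OF assms]) (auto intro!: continuous_intros)

lemma antiderivative_continuous_UNIV:
  fixes f :: "real \<Rightarrow> real"
  assumes "continuous_on UNIV f"
  obtains F where "\<And>x. (F has_real_derivative f x) (at x)"
proof -
  obtain F where "\<forall>x::real. - \<infinity> < ereal x \<longrightarrow> ereal x < \<infinity> \<longrightarrow> (F has_vector_derivative f x) (at x)"
    using einterval_antiderivative[of "-\<infinity>" \<infinity> f] assms
    by (auto simp: continuous_on_eq_continuous_at)
  then show ?thesis
    using that by (auto simp: has_real_derivative_iff_has_vector_derivative)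
qed

lemma eq_if_deriv_eq_Ioi:
  fixes f F :: "real \<Rightarrow> real"
  assumes "\<And>x. x > 0 \<Longrightarrow> (f has_real_derivative h x) (at x)"
    and "\<And>x. x > 0 \<Longrightarrow> (F has_real_derivative h x) (at x)"
  obtains c where "\<And>x. x > 0 \<Longrightarrow> f x = F x + c"
proof -
  have "((\<lambda>x. f x - F x) has_real_derivative 0) (at x within {0<..})" if "x > 0" for x
    using DERIV_diff[OF assms(1)[OF that] assms(2)[OF that]]
    by (simp add: DERIV_subset[OF _ subset_UNIV])
  then obtain c where "\<And>x. x \<in> {0<..} \<Longrightarrow> f x - F x = c"
    using has_field_derivative_zero_constant[of "{0<..}" "\<lambda>x. f x - F x"] by auto
  then show ?thesis
    using that[of c] by (metis add.commute diff_add_cancel greaterThan_iff)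
qed

lemma at_right_eqI:
  fixes f g :: "real \<Rightarrow> real"
  assumes "continuous_on {0..} f" "continuous_on {0..} g" "\<And>x. x > 0 \<Longrightarrow> f x = g x"
  shows "f 0 = g 0"
proof -
  have "(f \<longlongrightarrow> f 0) (at_right 0)" "(g \<longlongrightarrow> g 0) (at_right 0)"
    using assms(1,2) by (auto simp: continuous_on_def intro: tendsto_within_subset)
  moreover have "\<forall>\<^sub>F x in at_right 0. f x = g x"
    using assms(3) by (auto simp: eventually_at_right_field intro!: exI[of _ 1])
  ultimately have "(g \<longlongrightarrow> f 0) (at_right 0)" "(g \<longlongrightarrow> g 0) (at_right 0)"
    by (auto dest: Lim_transform_eventually)
  then show ?thesis
    using tendsto_unique[OF trivial_limit_at_right_real] by blast
qed

text \<open>Functions in \<open>C02\<close> are handled through extensions \<open>F\<close> to the whole line that are twice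
  differentiable on \<open>[0, \<infinity>)\<close> including the end point, so that all derivatives are two-sided.\<close>

definition C2_extension :: "(real \<Rightarrow> real) \<Rightarrow> (real \<Rightarrow> real) \<Rightarrow> (real \<Rightarrow> real) \<Rightarrow> (real \<Rightarrow> real) \<Rightarrow> bool"
  where "C2_extension f F F1 g \<longleftrightarrow> (\<forall>x\<ge>0. f x = F x) \<and> (\<forall>x. (F has_real_derivative F1 x) (at x)) \<and>
    (\<forall>x\<ge>0. (F1 has_real_derivative g x) (at x))"

lemma C2_extension_deriv:
  assumes "C2_extension f F F1 g" "x > 0"
  shows "(f has_real_derivative F1 x) (at x)" "deriv f x = F1 x"
    "(deriv f has_real_derivative g x) (at x)" "deriv (deriv f) x = g x"
proof -
  have 1: "(f has_real_derivative F1 x) (at x)" if "x > 0" for x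
    by (rule has_field_derivative_transform_within_open[of F _ _ "{0<..}"])
      (use that assms in \<open>auto simp: C2_extension_def\<close>)
  show "(f has_real_derivative F1 x) (at x)" using 1 assms by simp
  have 2: "deriv f x = F1 x" if "x > 0" for x
    using 1[OF that] by (rule DERIV_imp_deriv)
  show "deriv f x = F1 x" using 2 assms by simp
  show 3: "(deriv f has_real_derivative g x) (at x)"
  proof (rule has_field_derivative_transform_within_open[of F1 _ _ "{0<..}"])
    show "(F1 has_real_derivative g x) (at x)"
      using assms unfolding C2_extension_def by simp
  qed (use assms 2 in auto)
  show "deriv (deriv f) x = g x"
    using 3 by (rule DERIV_imp_deriv)
qed

text \<open>Translates the boundary condition of the theorem, phrased with right limits of
  \<open>deriv\<close>, into plain values of the extension at 0.\<close>

lemma C2_extension_Lim: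
  assumes "C2_extension f F F1 g" "continuous_on {0..} g"
  shows "Lim (at_right 0) (deriv f) = F1 0" "Lim (at_right 0) (deriv (deriv f)) = g 0"
proof -
  have "isCont F1 0"
    using assms(1) DERIV_isCont unfolding C2_extension_def by (meson order_refl)
  then have "(F1 \<longlongrightarrow> F1 0) (at_right 0)"
    by (auto simp: isCont_def intro: tendsto_within_subset)
  moreover have "\<forall>\<^sub>F x in at_right 0. F1 x = deriv f x"
    using C2_extension_deriv[OF assms(1)]
    by (auto simp: eventually_at_right_field intro!: exI[of _ 1])
  ultimately show "Lim (at_right 0) (deriv f) = F1 0"
    by (auto intro!: tendsto_Lim dest: Lim_transform_eventually)
  have "(g \<longlongrightarrow> g 0) (at_right 0)"
    using assms(2) by (auto simp: continuous_on_def intro: tendsto_within_subset)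
  moreover have "\<forall>\<^sub>F x in at_right 0. g x = deriv (deriv f) x"
    using C2_extension_deriv[OF assms(1)]
    by (auto simp: eventually_at_right_field intro!: exI[of _ 1])
  ultimately show "Lim (at_right 0) (deriv (deriv f)) = g 0"
    by (auto intro!: tendsto_Lim dest: Lim_transform_eventually)
qed

text \<open>Freezing \<open>g\<close> at \<open>g 0\<close> for negative arguments gives a
  continuous function on the whole line, which can be integrated twice. The constants
  \<open>c\<close> and \<open>k\<close> come from comparison with \<open>deriv f\<close> and
  \<open>f\<close> on the open half line, and continuity of \<open>f\<close> carries the equality to
  0. The existence of the right limits of f' and f'' at 0 is a by-product.\<close>

lemma C02_imp_C2_extension:
  assumes "f \<in> C02"
  obtains F F1 g where "g \<in> C0" "C2_extension f F F1 g"
proof -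
  obtain g where g: "g \<in> C0" "\<And>x. x > 0 \<Longrightarrow> deriv (deriv f) x = g x"
    and d: "\<And>x. x > 0 \<Longrightarrow> f differentiable (at x)" "\<And>x. x > 0 \<Longrightarrow> deriv f differentiable (at x)"
    and f: "f \<in> C0"
    using assms by (auto simp: C02_def)
  have d1: "(f has_real_derivative deriv f x) (at x)" if "x > 0" for x
    using d(1)[OF that] by (simp add: DERIV_deriv_iff_real_differentiable)
  have d2: "(deriv f has_real_derivative g (max 0 x)) (at x)" if "x > 0" for x
    using d(2)[OF that] g(2)[OF that] that
    by (simp add: DERIV_deriv_iff_real_differentiable[symmetric] max_def)
  obtain G1 where G1: "\<And>x. (G1 has_real_derivative g (max 0 x)) (at x)"
    using antiderivative_continuous_UNIV continuous_on_extend_constant g(1) C0_iff by metis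
  obtain c where c: "\<And>x. x > 0 \<Longrightarrow> deriv f x = G1 x + c"
    using eq_if_deriv_eq_Ioi[OF d2 G1] by blast
  define F1 where "F1 = (\<lambda>x. G1 x + c)"
  have F1: "(F1 has_real_derivative g (max 0 x)) (at x)" for x
    unfolding F1_def using G1 by (auto intro!: derivative_eq_intros)
  then have "continuous_on UNIV F1"
    by (meson DERIV_isCont continuous_at_imp_continuous_on)
  then obtain G where G: "\<And>x. (G has_real_derivative F1 x) (at x)"
    using antiderivative_continuous_UNIV[of F1] by metis
  have d1': "(f has_real_derivative F1 x) (at x)" if "x > 0" for x
    using d1[OF that] c[OF that] by (simp add: F1_def)
  obtain k where k: "\<And>x. x > 0 \<Longrightarrow> f x = G x + k"
    using eq_if_deriv_eq_Ioi[OF d1' G] by blast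
  define F where "F = (\<lambda>x. G x + k)"
  have F: "(F has_real_derivative F1 x) (at x)" for x
    unfolding F_def using G by (auto intro!: derivative_eq_intros)
  then have contF: "continuous_on {0..} F"
    by (meson DERIV_isCont continuous_at_imp_continuous_on)
  have contf: "continuous_on {0..} f"
    using f by (simp add: C0_iff)
  have "f 0 = F 0"
    by (rule at_right_eqI[OF contf contF]) (simp add: k F_def)
  then have "f x = F x" if "x \<ge> 0" for x
    using k that by (cases "x = 0") (auto simp: F_def)
  moreover have "(F1 has_real_derivative g x) (at x)" if "x \<ge> 0" for x
    using F1[of x] that by (simp add: max_def)
  ultimately have "C2_extension f F F1 g"
    using F by (simp add: C2_extension_def)
  with g(1) show ?thesis by (rule that)
qed

lemma C2_extension_imp_C02:
  assumes "C2_extension f F F1 g" "f \<in> C0" "g \<in> C0"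
  shows "f \<in> C02"
  unfolding C02_def
proof (intro CollectI conjI allI impI)
  show "f \<in> C0" by fact
  fix x :: real assume x: "x > 0"
  show "f differentiable at x" "deriv f differentiable at x"
    using C2_extension_deriv[OF assms(1) x] by (auto simp: real_differentiable_def)
next
  show "\<exists>g\<in>C0. \<forall>x>0. deriv (deriv f) x = g x"
    using C2_extension_deriv[OF assms(1)] assms(3) by auto
qed

text \<open>The Lagrange remainder is half of \<open>g z - g x\<close> times the squared
  displacement. If z is within \<open>d\<close> of x, the modulus of continuity gives the first
  term. Otherwise the displacement exceeds \<open>d\<close>, and the crude bound \<open>K\<close>
  times its square is turned into a fourth power by the factor (y - x)^2 / d^2 \<ge> 1. Both powers
  have expectations that are controlled later.\<close>

lemma C2_extension_taylor:
  assumes E: "C2_extension f F F1 g" and d: "d > 0"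
    and mod: "\<And>x y. x \<ge> 0 \<Longrightarrow> y \<ge> 0 \<Longrightarrow> \<bar>y - x\<bar> < d \<Longrightarrow> \<bar>g y - g x\<bar> < e"
    and K: "\<And>x. x \<ge> 0 \<Longrightarrow> \<bar>g x\<bar> \<le> K" and xy: "x \<ge> 0" "y \<ge> 0"
  shows "\<bar>f y - f x - F1 x * (y - x) - g x / 2 * (y - x)\<^sup>2\<bar> \<le> e / 2 * (y - x)\<^sup>2 + K / d\<^sup>2 * (y - x)^4"
proof (cases "y = x")
  case True
  then show ?thesis by simp
next
  case False
  define diff where "diff = (\<lambda>m::nat. if m = 0 then F else if m = 1 then F1 else g)"
  have "\<forall>m t. m < 2 \<and> min x y \<le> t \<and> t \<le> max x y \<longrightarrow> DERIV (diff m) t :> diff (Suc m) t"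
    using E xy by (auto simp: diff_def C2_extension_def less_2_cases_iff)
  then obtain z where z: "if y < x then y < z \<and> z < x else x < z \<and> z < y"
    "F y = (\<Sum>m<2. diff m x / fact m * (y - x)^m) + diff 2 z / fact 2 * (y - x)^2"
    using Taylor[of 2 diff F "min x y" "max x y" x y] False by (auto simp: diff_def)
  have z0: "z \<ge> 0" "\<bar>z - x\<bar> < \<bar>y - x\<bar>"
    using z(1) xy by (auto split: if_splits)
  have "F y = F x + F1 x * (y - x) + g z / 2 * (y - x)\<^sup>2"
    using z(2) z0 by (simp add: diff_def numeral_2_eq_2)
  then have eq: "f y - f x - F1 x * (y - x) - g x / 2 * (y - x)\<^sup>2 = (g z - g x) / 2 * (y - x)\<^sup>2"
    using E xy by (simp add: C2_extension_def algebra_simps)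
  have K0: "K \<ge> 0" using K[of 0] by simp
  have e0: "e > 0" using mod[of 0 0] d by simp
  have "\<bar>g z - g x\<bar> / 2 * (y - x)\<^sup>2 \<le> e / 2 * (y - x)\<^sup>2 + K / d\<^sup>2 * (y - x)^4"
  proof (cases "\<bar>z - x\<bar> < d")
    case True
    then have "\<bar>g z - g x\<bar> \<le> e" using mod[of x z] xy z0 by simp
    then have "\<bar>g z - g x\<bar> / 2 * (y - x)\<^sup>2 \<le> e / 2 * (y - x)\<^sup>2"
      by (intro mult_right_mono) auto
    moreover have "K / d\<^sup>2 * (y - x)^4 \<ge> 0" using K0 by simp
    ultimately show ?thesis by linarith
  next
    case False
    have "\<bar>g z - g x\<bar> / 2 \<le> K"
      using K[OF z0(1)] K[OF xy(1)] abs_triangle_ineq4[of "g z" "g x"] by simp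
    also have "K = K / d\<^sup>2 * d\<^sup>2" using d by simp
    also have "\<dots> \<le> K / d\<^sup>2 * (y - x)\<^sup>2"
      using False z0 d K0 by (intro mult_left_mono) (auto simp: abs_le_square_iff[symmetric])
    finally have "\<bar>g z - g x\<bar> / 2 * (y - x)\<^sup>2 \<le> K / d\<^sup>2 * (y - x)\<^sup>2 * (y - x)\<^sup>2"
      by (intro mult_right_mono) auto
    also have "\<dots> = K / d\<^sup>2 * (y - x)^4" by (simp add: power2_eq_square power4_eq_xxxx)
    finally have "\<bar>g z - g x\<bar> / 2 * (y - x)\<^sup>2 \<le> K / d\<^sup>2 * (y - x)^4" .
    moreover have "e / 2 * (y - x)\<^sup>2 \<ge> 0" using e0 by simp
    ultimately show ?thesis by linarith
  qed
  then show ?thesis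
    unfolding eq abs_mult by (simp add: power_abs[symmetric])
qed

section \<open>The equation u'' = u - k on the half line\<close>

lemma tendsto_mult_exp_uminus_at_top: "((\<lambda>x::real. a * exp (-x)) \<longlongrightarrow> 0) at_top"
  by (intro tendsto_mult_right_zero filterlim_compose[OF exp_at_bot filterlim_uminus_at_bot_at_top])

text \<open>Here \<open>l - D x\<close> is the improper integral of \<open>exp (-y) * k y\<close>
  from x to infinity. A bound e on |k| beyond x makes D - e exp(-x) nondecreasing and D + e exp(-x)
  nonincreasing there. With the global bound K this gives convergence, since a monotone bounded
  function has a limit; with a local bound e it gives the tail estimate.\<close>

lemma decaying_antiderivative_limit:
  fixes D k :: "real \<Rightarrow> real"
  assumes D: "\<And>x. (D has_real_derivative exp (-x) * k x) (at x)"
    and K: "\<And>x. \<bar>k x\<bar> \<le> K"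
  obtains l where "(D \<longlongrightarrow> l) at_top"
    "\<And>x e. (\<And>y. y \<ge> x \<Longrightarrow> \<bar>k y\<bar> \<le> e) \<Longrightarrow> \<bar>l - D x\<bar> \<le> e * exp (-x)"
proof -
  have up: "D y - e * exp (-y) \<ge> D x - e * exp (-x)"
    if "x \<le> y" "\<And>z. z \<ge> x \<Longrightarrow> \<bar>k z\<bar> \<le> e" for x y e
  proof (rule DERIV_nonneg_imp_nondecreasing[OF that(1)])
    fix z assume "x \<le> z" "z \<le> y"
    then have "k z + e \<ge> 0" using that(2)[of z] by linarith
    moreover have "((\<lambda>y. D y - e * exp (-y)) has_real_derivative exp (-z) * (k z + e)) (at z)"
      using D by (auto intro!: derivative_eq_intros simp: algebra_simps)
    ultimately show "\<exists>d. ((\<lambda>y. D y - e * exp (-y)) has_real_derivative d) (at z) \<and> 0 \<le> d"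
      by (intro exI[of _ "exp (-z) * (k z + e)"]) auto
  qed
  have down: "D y + e * exp (-y) \<le> D x + e * exp (-x)"
    if "x \<le> y" "\<And>z. z \<ge> x \<Longrightarrow> \<bar>k z\<bar> \<le> e" for x y e
  proof (rule DERIV_nonpos_imp_nonincreasing[OF that(1)])
    fix z assume "x \<le> z" "z \<le> y"
    then have "k z - e \<le> 0" using that(2)[of z] by linarith
    moreover have "((\<lambda>y. D y + e * exp (-y)) has_real_derivative exp (-z) * (k z - e)) (at z)"
      using D by (auto intro!: derivative_eq_intros simp: algebra_simps)
    ultimately show "\<exists>d. ((\<lambda>y. D y + e * exp (-y)) has_real_derivative d) (at z) \<and> d \<le> 0"
      by (intro exI[of _ "exp (-z) * (k z - e)"]) (auto simp: mult_nonneg_nonpos)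
  qed
  have e0: "((\<lambda>x::real. K * exp (-x)) \<longlongrightarrow> 0) at_top"
    by (rule tendsto_mult_exp_uminus_at_top)
  have K0: "K \<ge> 0" using K[of 0] by linarith
  define m where "m = (\<lambda>x. D x - K * exp (-x))"
  have mono: "m x \<le> m y" if "x \<le> y" for x y
    unfolding m_def using up[OF that] K by blast
  have bd: "bdd_above (m ` {0..})"
  proof (rule bdd_aboveI2)
    fix y :: real assume "y \<in> {0..}"
    then have "D y + K * exp (-y) \<le> D 0 + K"
      using down[of 0 y K] K by simp
    moreover have "K * exp (-y) \<ge> 0" using K0 by simp
    ultimately show "m y \<le> D 0 + K" unfolding m_def by linarith
  qed
  define l where "l = (SUP x\<in>{0..}. m x)"
  have "(m \<longlongrightarrow> l) at_top"
  proof (rule increasing_tendsto)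
    show "\<forall>\<^sub>F x in at_top. m x \<le> l"
      unfolding l_def using eventually_ge_at_top[of 0]
      by eventually_elim (auto intro!: cSUP_upper bd)
    fix z assume "z < l"
    then obtain x where "x \<in> {0..}" "z < m x"
      unfolding l_def using less_cSUP_iff[OF _ bd] by auto
    then show "\<forall>\<^sub>F x in at_top. z < m x"
      using mono by (auto simp: eventually_at_top_linorder intro: less_le_trans)
  qed
  from tendsto_add[OF this e0] have lim: "(D \<longlongrightarrow> l) at_top" by (simp add: m_def)
  have "\<bar>l - D x\<bar> \<le> e * exp (-x)" if k: "\<And>y. y \<ge> x \<Longrightarrow> \<bar>k y\<bar> \<le> e" for x e
  proof -
    have e0: "((\<lambda>x::real. e * exp (-x)) \<longlongrightarrow> 0) at_top"
      by (rule tendsto_mult_exp_uminus_at_top)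
    have "l - 0 \<ge> D x - e * exp (-x)"
      by (rule tendsto_lowerbound[OF tendsto_diff[OF lim e0]])
        (use up k in \<open>auto simp: eventually_at_top_linorder intro!: exI[of _ x]\<close>)
    moreover have "l + 0 \<le> D x + e * exp (-x)"
      by (rule tendsto_upperbound[OF tendsto_add[OF lim e0]])
        (use down k in \<open>auto simp: eventually_at_top_linorder intro!: exI[of _ x]\<close>)
    ultimately show ?thesis by linarith
  qed
  with lim that show ?thesis by blast
qed

lemma extended_C0_tendsto:
  assumes "k \<in> C0"
  shows "((\<lambda>x. k (max 0 x)) \<longlongrightarrow> 0) at_top"
proof (rule Lim_transform_eventually)
  show "(k \<longlongrightarrow> 0) at_top" using assms by (simp add: C0_iff)
  show "\<forall>\<^sub>F x in at_top. k x = k (max 0 x)"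
    using eventually_ge_at_top[of 0] by eventually_elim simp
qed

text \<open>Variation of constants: \<open>u\<close> is half the convolution of k with exp(-|x -
  y|), up to a multiple of exp(-x) that depends on the choice of the antiderivative
  \<open>A\<close>. Taking \<open>l - D x\<close>, the tail integral, as coefficient of exp x
  removes the growing mode.\<close>

lemma resolvent_particular_solution:
  assumes k: "k \<in> C0"
  obtains u u1 where "\<And>x. (u has_real_derivative u1 x) (at x)"
    "\<And>x. (u1 has_real_derivative u x - k (max 0 x)) (at x)" "(u \<longlongrightarrow> 0) at_top"
proof -
  define k' where "k' = (\<lambda>x. k (max 0 x))"
  have cont: "continuous_on UNIV k'"
    unfolding k'_def using k by (intro continuous_on_extend_constant) (simp add: C0_iff)
  have lim: "(k' \<longlongrightarrow> 0) at_top"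
    unfolding k'_def using k by (rule extended_C0_tendsto)
  obtain K where K: "\<And>x. \<bar>k' x\<bar> \<le> K"
    using C0_bounded[OF k] unfolding k'_def by (metis max.cobounded1)
  obtain A where A: "\<And>x. (A has_real_derivative exp x * k' x) (at x)"
    using antiderivative_continuous_UNIV[OF continuous_on_mult[OF continuous_on_exp[OF continuous_on_id] cont]] by blast
  obtain D where D: "\<And>x. (D has_real_derivative exp (-x) * k' x) (at x)"
    using antiderivative_continuous_UNIV[OF continuous_on_mult[OF continuous_on_exp[OF continuous_on_minus[OF continuous_on_id]] cont]] by blast
  obtain l where l: "\<And>x e. (\<And>y. y \<ge> x \<Longrightarrow> \<bar>k' y\<bar> \<le> e) \<Longrightarrow> \<bar>l - D x\<bar> \<le> e * exp (-x)"
    using decaying_antiderivative_limit[OF D K] by metis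
  define u where "u = (\<lambda>x. (exp (-x) * A x + exp x * (l - D x)) / 2)"
  define u1 where "u1 = (\<lambda>x. (- exp (-x) * A x + exp x * (l - D x)) / 2)"
  have ee: "exp x * exp (-x) = 1" for x :: real
    by (simp add: exp_minus_inverse)
  have ee': "exp (-x) * (exp x * z) = z" "exp x * (exp (-x) * z) = z" for x z :: real
    by (simp_all add: mult.assoc[symmetric] ee mult.commute[of "exp (-x)"])
  have "(u has_real_derivative u1 x) (at x)" for x
  proof -
    have "(u has_real_derivative ((- exp (-x)) * A x + exp (-x) * (exp x * k' x)
        + (exp x * (l - D x) + exp x * (0 - exp (-x) * k' x))) / 2) (at x)"
      unfolding u_def by (rule derivative_eq_intros A D refl)+ (simp_all add: field_simps)
    then show ?thesis by (simp add: ee' right_diff_distrib u1_def)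
  qed
  moreover have "(u1 has_real_derivative u x - k' x) (at x)" for x
  proof -
    have "(u1 has_real_derivative (exp (-x) * A x + (- exp (-x)) * (exp x * k' x)
        + (exp x * (l - D x) + exp x * (0 - exp (-x) * k' x))) / 2) (at x)"
      unfolding u1_def by (rule derivative_eq_intros A D refl)+ (simp_all add: field_simps)
    then show ?thesis by (simp add: ee' right_diff_distrib u_def add_divide_distrib diff_divide_distrib)
  qed
  moreover have "(u \<longlongrightarrow> 0) at_top"
  proof -
    \<comment> \<open>By l'Hospital's rule: the quotient of the derivatives is \<open>k'\<close>,
      which tends to 0, and the denominator tends to infinity, whatever the behaviour of
      \<open>A\<close>.\<close>
    have "((\<lambda>x. A x / exp x) \<longlongrightarrow> 0) at_top"
    proof (rule lhospital_at_top_at_top)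
      show "LIM x at_top. exp x :> (at_top :: real filter)" by (rule exp_at_top)
      show "((\<lambda>x. exp x * k' x / exp x) \<longlongrightarrow> 0) at_top" using lim by simp
    qed (use A in \<open>auto intro: DERIV_exp\<close>)
    then have 1: "((\<lambda>x. exp (-x) * A x) \<longlongrightarrow> 0) at_top"
      by (simp add: exp_minus field_simps)
    have 2: "((\<lambda>x. exp x * (l - D x)) \<longlongrightarrow> 0) at_top"
    proof (rule tendstoI)
      fix e :: real assume e: "e > 0"
      have "\<forall>\<^sub>F x in at_top. \<bar>k' x\<bar> < e / 2"
        using tendstoD[OF lim, of "e / 2"] e by simp
      then obtain N where N: "\<And>x. x \<ge> N \<Longrightarrow> \<bar>k' x\<bar> < e / 2"
        by (auto simp: eventually_at_top_linorder)
      have "dist (exp x * (l - D x)) 0 < e" if "x \<ge> N" for x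
      proof -
        have "\<bar>l - D x\<bar> \<le> e / 2 * exp (-x)"
          using N that by (intro l) (meson less_imp_le order_trans)
        then have "exp x * \<bar>l - D x\<bar> \<le> exp x * (e / 2 * exp (-x))"
          by (intro mult_left_mono) auto
        also have "\<dots> = e / 2" using ee[of x] by (simp add: mult.left_commute)
        finally show ?thesis using e by (simp add: dist_real_def abs_mult)
      qed
      then show "\<forall>\<^sub>F x in at_top. dist (exp x * (l - D x)) 0 < e"
        by (auto simp: eventually_at_top_linorder)
    qed
    from tendsto_divide[OF tendsto_add[OF 1 2] tendsto_const[of 2]]
    show ?thesis by (simp add: u_def)
  qed
  ultimately show ?thesis using that by (auto simp: k'_def)
qed

text \<open>All decaying solutions have the form u + a exp(-x); the boundary condition is a linear
  equation for a.\<close>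

lemma resolvent_equation_solvable:
  assumes "\<beta> > 0" "\<gamma> > 0" and h: "h \<in> C0"
  obtains f F F1 g where "f \<in> C0" "g \<in> C0" "C2_extension f F F1 g"
    "\<And>x. x \<ge> 0 \<Longrightarrow> f x / 2 - g x / 2 = h x"
    "\<beta> * f 0 - F1 0 + \<gamma> / 2 * g 0 = 0"
proof -
  define k where "k = (\<lambda>x\<in>{0..}. 2 * h x)"
  have k: "k \<in> C0"
  proof -
    have "((\<lambda>x. 2 * h x) \<longlongrightarrow> 0) at_top"
      using h by (intro tendsto_mult_right_zero) (simp add: C0_iff)
    moreover have "\<forall>\<^sub>F x in at_top. 2 * h x = k x"
      using eventually_ge_at_top[of 0] by eventually_elim (simp add: k_def)
    ultimately have "(k \<longlongrightarrow> 0) at_top" by (rule Lim_transform_eventually)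
    moreover have "continuous_on {0..} (\<lambda>x. 2 * h x)"
      using h by (auto simp: C0_iff intro!: continuous_intros)
    then have "continuous_on {0..} k"
      by (rule continuous_on_eq) (simp add: k_def)
    ultimately show ?thesis by (auto simp: C0_iff k_def)
  qed
  obtain u u1 where u: "\<And>x. (u has_real_derivative u1 x) (at x)"
    "\<And>x. (u1 has_real_derivative u x - k (max 0 x)) (at x)" "(u \<longlongrightarrow> 0) at_top"
    using resolvent_particular_solution[OF k] by blast
  \<comment> \<open>Inserting F 0 = u 0 + a, F1 0 = u1 0 - a and F''(0) = u 0 + a - k 0 into the
    boundary condition gives this quotient. The coefficient of a is positive, so the equation can
    always be solved.\<close>
  define a where "a = (u1 0 - \<beta> * u 0 - \<gamma> / 2 * (u 0 - k 0)) / (\<beta> + 1 + \<gamma> / 2)"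
  have a: "a * (\<beta> + 1 + \<gamma> / 2) = u1 0 - \<beta> * u 0 - \<gamma> / 2 * (u 0 - k 0)"
    using assms by (simp add: a_def)
  define F where "F = (\<lambda>x. u x + a * exp (-x))"
  define F1 where "F1 = (\<lambda>x. u1 x - a * exp (-x))"
  define G where "G = (\<lambda>x. F x - k (max 0 x))"
  have F: "(F has_real_derivative F1 x) (at x)" for x
    unfolding F_def F1_def by (auto intro!: derivative_eq_intros u(1))
  have F1: "(F1 has_real_derivative G x) (at x)" for x
    unfolding G_def F_def F1_def by (auto intro!: derivative_eq_intros u(2))
  have limF: "(F \<longlongrightarrow> 0) at_top"
  proof -
    have "((\<lambda>x::real. a * exp (-x)) \<longlongrightarrow> 0) at_top"
      by (rule tendsto_mult_exp_uminus_at_top)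
    from tendsto_add[OF u(3) this] show ?thesis by (simp add: F_def)
  qed
  have limG: "(G \<longlongrightarrow> 0) at_top"
    using tendsto_diff[OF limF extended_C0_tendsto[OF k]] by (simp add: G_def)
  have contF: "continuous_on UNIV F"
    using F by (meson DERIV_isCont continuous_at_imp_continuous_on)
  have contG: "continuous_on UNIV G"
    unfolding G_def using k contF
    by (intro continuous_intros continuous_on_extend_constant) (auto simp: C0_iff)
  have restr: "restrict H {0..} \<in> C0" if "continuous_on UNIV H" "(H \<longlongrightarrow> 0) at_top"
    for H :: "real \<Rightarrow> real"
  proof -
    have "\<forall>\<^sub>F x in at_top. H x = restrict H {0..} x"
      using eventually_ge_at_top[of 0] by eventually_elim simp
    with that(2) have "(restrict H {0..} \<longlongrightarrow> 0) at_top"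
      by (rule Lim_transform_eventually)
    moreover have "continuous_on {0..} (restrict H {0..})"
      using continuous_on_subset[OF that(1) subset_UNIV] by (rule continuous_on_eq) auto
    ultimately show ?thesis by (simp add: C0_iff)
  qed
  show ?thesis
  proof (rule that[of "restrict F {0..}" "\<lambda>x\<in>{0..}. F x - k x" F F1])
    show "restrict F {0..} \<in> C0" using contF limF by (rule restr)
    have "(\<lambda>x\<in>{0..}. F x - k x) = restrict G {0..}"
      by (simp add: G_def restrict_def fun_eq_iff max_def)
    then show "(\<lambda>x\<in>{0..}. F x - k x) \<in> C0" using restr[OF contG limG] by simp
    show "C2_extension (restrict F {0..}) F F1 (\<lambda>x\<in>{0..}. F x - k x)"
      unfolding C2_extension_def
    proof (intro conjI allI impI)
      fix x :: real assume "x \<ge> 0"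
      then show "(F1 has_real_derivative (\<lambda>x\<in>{0..}. F x - k x) x) (at x)"
        using F1[of x] by (simp add: G_def max_def)
    qed (use F in auto)
    show "restrict F {0..} x / 2 - (\<lambda>x\<in>{0..}. F x - k x) x / 2 = h x" if "x \<ge> 0" for x
      using that by (simp add: k_def field_simps)
    show "\<beta> * restrict F {0..} 0 - F1 0 + \<gamma> / 2 * (\<lambda>x\<in>{0..}. F x - k x) 0 = 0"
      using a by (simp add: F_def F1_def field_simps)
  qed
qed

section \<open>Brownian increments and the Ito isometry\<close>

text \<open>Boundedness in \<open>L\<^sup>2\<close> gives the uniform integrability that turns pointwise convergence into
  convergence of expectations.\<close>

lemma (in prob_space) L2_bounded_limit:
  fixes X :: "nat \<Rightarrow> 'a \<Rightarrow> real"
  assumes X: "\<And>n. X n \<in> borel_measurable M"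
    and lim: "\<And>\<omega>. \<omega> \<in> space M \<Longrightarrow> (\<lambda>n. X n \<omega>) \<longlonglongrightarrow> Y \<omega>"
    and int: "\<And>n. integrable M (\<lambda>\<omega>. (X n \<omega>)\<^sup>2)"
    and bound: "\<And>n. expectation (\<lambda>\<omega>. (X n \<omega>)\<^sup>2) \<le> C"
  shows "integrable M (\<lambda>\<omega>. (Y \<omega>)\<^sup>2)" "expectation (\<lambda>\<omega>. (Y \<omega>)\<^sup>2) \<le> C"
    "(\<lambda>n. expectation (X n)) \<longlonglongrightarrow> expectation Y"
proof -
  note X[measurable]
  have Y[measurable]: "Y \<in> borel_measurable M"
    by (rule borel_measurable_LIMSEQ_real[OF lim X])
  have "expectation (\<lambda>\<omega>. (X 0 \<omega>)\<^sup>2) \<ge> 0" by simp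
  with bound[of 0] have C0: "C \<ge> 0" by linarith
  have "(\<integral>\<^sup>+\<omega>. ennreal ((Y \<omega>)\<^sup>2) \<partial>M) = (\<integral>\<^sup>+\<omega>. liminf (\<lambda>n. ennreal ((X n \<omega>)\<^sup>2)) \<partial>M)"
  proof (rule nn_integral_cong)
    fix \<omega> assume "\<omega> \<in> space M"
    show "ennreal ((Y \<omega>)\<^sup>2) = liminf (\<lambda>n. ennreal ((X n \<omega>)\<^sup>2))"
      by (rule lim_imp_Liminf[OF _ tendsto_ennrealI[OF tendsto_power[OF lim[OF \<open>\<omega> \<in> space M\<close>]]], symmetric]) simp
  qed
  also have "\<dots> \<le> liminf (\<lambda>n. \<integral>\<^sup>+\<omega>. ennreal ((X n \<omega>)\<^sup>2) \<partial>M)"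
    by (intro nn_integral_liminf) auto
  also have "\<dots> \<le> liminf (\<lambda>n. ennreal C)"
    by (intro Liminf_mono always_eventually allI)
      (use int bound in \<open>simp add: nn_integral_eq_integral ennreal_leI\<close>)
  finally have nn: "(\<integral>\<^sup>+\<omega>. ennreal ((Y \<omega>)\<^sup>2) \<partial>M) \<le> ennreal C"
    by (simp add: Liminf_const)
  show intY: "integrable M (\<lambda>\<omega>. (Y \<omega>)\<^sup>2)"
    by (intro integrableI_nonneg) (use nn in \<open>auto intro: le_less_trans\<close>)
  show EY: "expectation (\<lambda>\<omega>. (Y \<omega>)\<^sup>2) \<le> C"
    using nn C0 by (simp add: nn_integral_eq_integral[OF intY])
  have intX1: "integrable M (X n)" for n
    by (rule square_integrable_imp_integrable[OF X int])
  have intY1: "integrable M Y"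
    by (rule square_integrable_imp_integrable[OF Y intY])
  show "(\<lambda>n. expectation (X n)) \<longlonglongrightarrow> expectation Y"
  proof (rule LIMSEQ_I)
    fix e :: real assume e: "e > 0"
    \<comment> \<open>Truncation level: where |X n - Y| exceeds K it is at most its square divided
      by K, and that has mean at most 4 C / K. The choice makes this smaller than e/2; the summand 1
      keeps K positive when C = 0.\<close>
    define K where "K = 8 * C / e + 1"
    have K: "K > 0" "4 * C / K < e / 2"
      using e C0 by (auto simp: K_def field_simps add_pos_nonneg)
    define h where "h = (\<lambda>n \<omega>. min \<bar>X n \<omega> - Y \<omega>\<bar> K)"
    have h_int: "integrable M (h n)" for n
      by (rule integrable_const_bound[where B=K]) (use K in \<open>auto simp: h_def\<close>)
    have "(\<lambda>n. expectation (h n)) \<longlonglongrightarrow> expectation (\<lambda>\<omega>. 0)"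
    proof (rule integral_dominated_convergence[where w="\<lambda>_. K"])
      show "AE \<omega> in M. (\<lambda>n. h n \<omega>) \<longlonglongrightarrow> 0"
      proof (rule AE_I2)
        fix \<omega> assume "\<omega> \<in> space M"
        then have "(\<lambda>n. \<bar>X n \<omega> - Y \<omega>\<bar>) \<longlonglongrightarrow> 0"
          using lim by (metis LIM_zero tendsto_rabs_zero)
        from tendsto_min[OF this tendsto_const[of K]] show "(\<lambda>n. h n \<omega>) \<longlonglongrightarrow> 0"
          using K by (simp add: h_def)
      qed
    qed (use K in \<open>auto simp: h_def\<close>)
    then have "(\<lambda>n. expectation (h n)) \<longlonglongrightarrow> 0" by simp
    from LIMSEQ_D[OF this, of "e/2"] e obtain N where
      N: "\<And>n. n \<ge> N \<Longrightarrow> norm (expectation (h n) - 0) < e / 2" by auto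
    have "norm (expectation (X n) - expectation Y) < e" if n: "n \<ge> N" for n
    proof -
      have "norm (expectation (X n) - expectation Y) = \<bar>expectation (\<lambda>\<omega>. X n \<omega> - Y \<omega>)\<bar>"
        using intX1 intY1 by simp
      also have "\<dots> \<le> expectation (\<lambda>\<omega>. \<bar>X n \<omega> - Y \<omega>\<bar>)"
        by (rule integral_abs_bound)
      also have "\<dots> \<le> expectation (\<lambda>\<omega>. h n \<omega> + (2 * (X n \<omega>)\<^sup>2 + 2 * (Y \<omega>)\<^sup>2) / K)"
      proof (rule integral_mono)
        fix \<omega>
        have "\<bar>X n \<omega> - Y \<omega>\<bar> \<le> h n \<omega> + \<bar>X n \<omega> - Y \<omega>\<bar>\<^sup>2 / K"
        proof (cases "\<bar>X n \<omega> - Y \<omega>\<bar> \<le> K")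
          case True
          then show ?thesis using K by (simp add: h_def)
        next
          case False
          then have "\<bar>X n \<omega> - Y \<omega>\<bar> * K \<le> \<bar>X n \<omega> - Y \<omega>\<bar> * \<bar>X n \<omega> - Y \<omega>\<bar>"
            by (intro mult_left_mono) auto
          then have "\<bar>X n \<omega> - Y \<omega>\<bar> \<le> \<bar>X n \<omega> - Y \<omega>\<bar>\<^sup>2 / K"
            using K by (simp add: field_simps power2_eq_square)
          then show ?thesis using False K by (simp add: h_def)
        qed
        also have "\<bar>X n \<omega> - Y \<omega>\<bar>\<^sup>2 \<le> 2 * (X n \<omega>)\<^sup>2 + 2 * (Y \<omega>)\<^sup>2"
          using zero_le_power2[of "X n \<omega> + Y \<omega>"] by (simp add: power2_sum power2_diff)
        then have "\<bar>X n \<omega> - Y \<omega>\<bar>\<^sup>2 / K \<le> (2 * (X n \<omega>)\<^sup>2 + 2 * (Y \<omega>)\<^sup>2) / K"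
          using K by (intro divide_right_mono) auto
        finally show "\<bar>X n \<omega> - Y \<omega>\<bar> \<le> h n \<omega> + (2 * (X n \<omega>)\<^sup>2 + 2 * (Y \<omega>)\<^sup>2) / K" by simp
      qed (use intX1 intY1 int intY h_int in auto)
      also have "\<dots> = expectation (h n) + (2 * expectation (\<lambda>\<omega>. (X n \<omega>)\<^sup>2) + 2 * expectation (\<lambda>\<omega>. (Y \<omega>)\<^sup>2)) / K"
        using int intY h_int by simp
      also have "\<dots> \<le> expectation (h n) + 4 * C / K"
        using bound[of n] EY K by (intro add_left_mono divide_right_mono) auto
      also have "\<dots> < e" using N[OF n] K(2) by simp
      finally show ?thesis .
    qed
    then show "\<exists>N. \<forall>n\<ge>N. norm (expectation (X n) - expectation Y) < e" by blast
  qed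
qed

lemma emeasure_Ioc_finite: "emeasure lborel {l<..u::real} < \<top>"
  by (cases "l \<le> u") auto

lemma overlap_integral:
  fixes a b c d :: real
  shows "integrable lborel (\<lambda>s. indicator {a<..b} s * indicator {c<..d} s :: real)"
    and "(LINT s|lborel. indicator {a<..b} s * indicator {c<..d} s :: real) = max 0 (min b d - max a c)"
proof -
  have "(\<lambda>s. indicator {a<..b} s * indicator {c<..d} s :: real) = indicator {max a c<..min b d}"
    by (auto simp: indicator_def fun_eq_iff)
  then show "integrable lborel (\<lambda>s. indicator {a<..b} s * indicator {c<..d} s :: real)"
    and "(LINT s|lborel. indicator {a<..b} s * indicator {c<..d} s :: real) = max 0 (min b d - max a c)"
    using emeasure_Ioc_finite[of "max a c" "min b d"] by (auto simp: max_def intro!: integrable_real_indicator)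
qed

lemma abs_diff_square_integrable:
  fixes f g :: "'a \<Rightarrow> real"
  assumes "integrable N (\<lambda>\<omega>. (f \<omega> - g \<omega>)\<^sup>2)"
    and [measurable]: "f \<in> borel_measurable N" "g \<in> borel_measurable N"
  shows "integrable N (\<lambda>\<omega>. (\<bar>f \<omega>\<bar> - \<bar>g \<omega>\<bar>)\<^sup>2)"
  by (rule Bochner_Integration.integrable_bound[OF assms(1)])
    (auto intro!: AE_I2 simp: abs_le_square_iff[symmetric])

section \<open>Brownian increments multiplied by variables of the past\<close>

context brownian_family
begin

lemma space_P: "space (P x) = space M"
  using sets_eq_imp_space_eq[OF sets_P] .

lemma space_F: "0 \<le> t \<Longrightarrow> space (F t) = space M"
  using subalgebra_F by (simp add: subalgebra_def)

lemma subalgebra_P: "0 \<le> t \<Longrightarrow> subalgebra (P x) (F t)"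
  using subalgebra_F[of t] by (simp add: subalgebra_def sets_P space_P)

lemma measurable_F_P: "X \<in> borel_measurable (F t) \<Longrightarrow> 0 \<le> t \<Longrightarrow> X \<in> borel_measurable (P x)"
  using measurable_from_subalg[OF subalgebra_P] by blast

lemma AE_start: "AE \<omega> in P x. B 0 \<omega> = x"
proof -
  interpret prob_space "P x" by (rule prob_space_P)
  show ?thesis using AE_prob_1[OF start_B[of x]] by simp
qed

lemma measurable_F_mono:
  "X \<in> borel_measurable (F s) \<Longrightarrow> 0 \<le> s \<Longrightarrow> s \<le> t \<Longrightarrow> X \<in> borel_measurable (F t)"
  by (rule measurable_from_subalg[of _ "F s"]) (auto simp: subalgebra_def space_F mono_F)

lemma measurable_B: "0 \<le> s \<Longrightarrow> s \<le> t \<Longrightarrow> B s \<in> borel_measurable (F t)"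
  by (rule measurable_F_mono[OF adapted_B])

lemma measurable_B_P: "0 \<le> s \<Longrightarrow> B s \<in> borel_measurable (P x)"
  by (rule measurable_F_P[OF adapted_B])

lemma increment_indep_var:
  assumes Z: "Z \<in> borel_measurable (F s)" and st: "0 \<le> s" "s < t"
  shows "prob_space.indep_var (P x) borel Z borel (\<lambda>\<omega>. B t \<omega> - B s \<omega>)"
proof -
  interpret prob_space "P x" by (rule prob_space_P)
  have ind: "indep_set (sets (F s)) (sets (vimage_algebra (space M) (\<lambda>\<omega>. B t \<omega> - B s \<omega>) borel))"
    using increment_indep st by blast
  have "sigma_sets (space (P x)) {Z -` A \<inter> space (P x) |A. A \<in> sets borel} \<subseteq> sets (F s)"
    unfolding space_P space_F[OF st(1), symmetric]
    by (rule sets.sigma_sets_subset) (use measurable_sets[OF Z] in auto)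
  moreover have "sigma_sets (space (P x)) {(\<lambda>\<omega>. B t \<omega> - B s \<omega>) -` A \<inter> space (P x) |A. A \<in> sets borel}
      = sets (vimage_algebra (space M) (\<lambda>\<omega>. B t \<omega> - B s \<omega>) borel)"
    by (simp add: sets_vimage_algebra space_P)
  moreover have "Z \<in> borel_measurable (P x)" "(\<lambda>\<omega>. B t \<omega> - B s \<omega>) \<in> borel_measurable (P x)"
    using measurable_F_P[OF Z] st by (auto intro!: borel_measurable_diff measurable_B_P)
  ultimately show ?thesis
    using ind unfolding indep_var_eq indep_sets2_eq by auto
qed

text \<open>Moments of the centred normal law with variance t - s. The case s = t is split off
  because the law of the increment is given for s < t; later the truncation of partitions produces
  empty intervals.\<close>

lemma increment_moments:
  assumes "0 \<le> s" "s \<le> t"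
  shows "integrable (P x) (\<lambda>\<omega>. (B t \<omega> - B s \<omega>) ^ k)"
    and "(LINT \<omega>|P x. B t \<omega> - B s \<omega>) = 0"
    and "(LINT \<omega>|P x. (B t \<omega> - B s \<omega>)\<^sup>2) = t - s"
    and "(LINT \<omega>|P x. (B t \<omega> - B s \<omega>) ^ 3) = 0"
    and "(LINT \<omega>|P x. (B t \<omega> - B s \<omega>) ^ 4) = 3 * (t - s)\<^sup>2"
proof -
  interpret prob_space "P x" by (rule prob_space_P)
  have "integrable (P x) (\<lambda>\<omega>. (B t \<omega> - B s \<omega>) ^ k) \<and> (LINT \<omega>|P x. B t \<omega> - B s \<omega>) = 0 \<and>
    (LINT \<omega>|P x. (B t \<omega> - B s \<omega>)\<^sup>2) = t - s \<and> (LINT \<omega>|P x. (B t \<omega> - B s \<omega>) ^ 3) = 0 \<and>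
    (LINT \<omega>|P x. (B t \<omega> - B s \<omega>) ^ 4) = 3 * (t - s)\<^sup>2"
  proof (cases "s = t")
    case False
    then have st: "s < t" using assms by simp
    then have sg: "0 < sqrt (t - s)" by simp
    note D = increment_distributed[OF assms(1) st, of x]
    have I: "(LINT \<omega>|P x. (B t \<omega> - B s \<omega>) ^ j) = (LINT y|lborel. normal_density 0 (sqrt (t - s)) y * (y - 0) ^ j)" for j
      by (subst distributed_integral[OF D, symmetric]) auto
    have "integrable (P x) (\<lambda>\<omega>. (B t \<omega> - B s \<omega>) ^ k)"
      using distributed_integrable[OF D, of "\<lambda>y. y ^ k"] integrable_normal_moment[OF sg, of 0 k] by simp
    moreover have "(LINT \<omega>|P x. (B t \<omega> - B s \<omega>) ^ 1) = 0"
      unfolding I using integral_normal_moment_odd[OF sg, of 0 0] by simp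
    moreover have "(LINT \<omega>|P x. (B t \<omega> - B s \<omega>) ^ 2) = t - s"
      unfolding I using integral_normal_moment_even[OF sg, of 0 1] st by simp
    moreover have "(LINT \<omega>|P x. (B t \<omega> - B s \<omega>) ^ 3) = 0"
      unfolding I using integral_normal_moment_odd[OF sg, of 0 1] by (simp add: numeral_3_eq_3)
    moreover have "(LINT \<omega>|P x. (B t \<omega> - B s \<omega>) ^ 4) = 3 * (t - s)\<^sup>2"
      unfolding I using integral_normal_moment_even[OF sg, of 0 2] st
      by (simp add: fact_numeral power_divide)
    ultimately show ?thesis by simp
  qed (auto simp: power_0_left)
  then show "integrable (P x) (\<lambda>\<omega>. (B t \<omega> - B s \<omega>) ^ k)"
    and "(LINT \<omega>|P x. B t \<omega> - B s \<omega>) = 0"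
    and "(LINT \<omega>|P x. (B t \<omega> - B s \<omega>)\<^sup>2) = t - s"
    and "(LINT \<omega>|P x. (B t \<omega> - B s \<omega>) ^ 3) = 0"
    and "(LINT \<omega>|P x. (B t \<omega> - B s \<omega>) ^ 4) = 3 * (t - s)\<^sup>2"
    by auto
qed

text \<open>Independence of the increment from \<open>F s\<close> factorises the expectation. This
  is the source of all martingale identities below; the power k is kept general for the moment
  computation in the section on optional stopping.\<close>

lemma past_mult_increment_power:
  assumes Z: "Z \<in> borel_measurable (F s)" "integrable (P x) Z" and st: "0 \<le> s" "s \<le> t"
  shows "integrable (P x) (\<lambda>\<omega>. Z \<omega> * (B t \<omega> - B s \<omega>) ^ k)"
    and "(LINT \<omega>|P x. Z \<omega> * (B t \<omega> - B s \<omega>) ^ k) = (LINT \<omega>|P x. Z \<omega>) * (LINT \<omega>|P x. (B t \<omega> - B s \<omega>) ^ k)"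
proof -
  interpret prob_space "P x" by (rule prob_space_P)
  have "integrable (P x) (\<lambda>\<omega>. Z \<omega> * (B t \<omega> - B s \<omega>) ^ k) \<and>
    (LINT \<omega>|P x. Z \<omega> * (B t \<omega> - B s \<omega>) ^ k) = (LINT \<omega>|P x. Z \<omega>) * (LINT \<omega>|P x. (B t \<omega> - B s \<omega>) ^ k)"
  proof (cases "s = t")
    case True
    then show ?thesis using Z prob_space by (auto simp: power_0_left)
  next
    case False
    then have "indep_var borel Z borel (\<lambda>\<omega>. B t \<omega> - B s \<omega>)"
      using increment_indep_var[OF Z(1) st(1), of t] st(2) by simp
    then have "indep_var borel (id \<circ> Z) borel ((\<lambda>y. y ^ k) \<circ> (\<lambda>\<omega>. B t \<omega> - B s \<omega>))"
      by (rule indep_var_compose) auto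
    then have iv: "indep_var borel Z borel (\<lambda>\<omega>. (B t \<omega> - B s \<omega>) ^ k)"
      by (simp add: comp_def)
    note i = increment_moments(1)[OF st, of x k]
    show ?thesis
      using indep_var_integrable[OF iv Z(2) i] indep_var_lebesgue_integral[OF iv Z(2) i] by simp
  qed
  then show "integrable (P x) (\<lambda>\<omega>. Z \<omega> * (B t \<omega> - B s \<omega>) ^ k)"
    and "(LINT \<omega>|P x. Z \<omega> * (B t \<omega> - B s \<omega>) ^ k) = (LINT \<omega>|P x. Z \<omega>) * (LINT \<omega>|P x. (B t \<omega> - B s \<omega>) ^ k)"
    by auto
qed

lemma past_mult_increment:
  assumes "Z \<in> borel_measurable (F s)" "integrable (P x) Z" "0 \<le> s" "s \<le> t"
  shows "integrable (P x) (\<lambda>\<omega>. Z \<omega> * (B t \<omega> - B s \<omega>))"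
    and "(LINT \<omega>|P x. Z \<omega> * (B t \<omega> - B s \<omega>)) = 0"
  using past_mult_increment_power[OF assms, of 1] increment_moments(2)[OF assms(3,4)] by auto

lemma bounded_integrable:
  fixes Z :: "'a \<Rightarrow> real"
  assumes "Z \<in> borel_measurable (F s)" "0 \<le> s" "\<And>\<omega>. \<omega> \<in> space M \<Longrightarrow> \<bar>Z \<omega>\<bar> \<le> C"
  shows "integrable (P x) Z"
proof -
  interpret prob_space "P x" by (rule prob_space_P)
  show ?thesis
    by (rule integrable_const_bound[where B=C])
      (use assms in \<open>auto simp: space_P measurable_F_P intro!: AE_I2\<close>)
qed

text \<open>The covariance of two weighted increments is E(\<xi> \<eta>) times the length of the
  overlap of the intervals. With a \<le> c both heights are known at time c, so everything before c
  can be grouped with the heights as past, and only the squared increment over the overlap has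
  nonzero mean.\<close>

lemma cross_isometry_ordered:
  fixes \<xi> \<eta> :: "'a \<Rightarrow> real"
  assumes abcd: "0 \<le> a" "a \<le> b" "c \<le> d" "a \<le> c"
    and \<xi>: "\<xi> \<in> borel_measurable (F a)" "\<And>\<omega>. \<omega> \<in> space M \<Longrightarrow> \<bar>\<xi> \<omega>\<bar> \<le> C"
    and \<eta>: "\<eta> \<in> borel_measurable (F c)" "\<And>\<omega>. \<omega> \<in> space M \<Longrightarrow> \<bar>\<eta> \<omega>\<bar> \<le> D"
  shows "integrable (P x) (\<lambda>\<omega>. (\<xi> \<omega> * (B b \<omega> - B a \<omega>)) * (\<eta> \<omega> * (B d \<omega> - B c \<omega>)))" (is ?I)
    and "(LINT \<omega>|P x. (\<xi> \<omega> * (B b \<omega> - B a \<omega>)) * (\<eta> \<omega> * (B d \<omega> - B c \<omega>))) =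
      (LINT \<omega>|P x. \<xi> \<omega> * \<eta> \<omega>) * max 0 (min b d - max a c)" (is ?E)
proof -
  have c0: "0 \<le> c" using abcd by simp
  have \<xi>c: "\<xi> \<in> borel_measurable (F c)" using measurable_F_mono[OF \<xi>(1)] abcd by simp
  have \<xi>\<eta>c: "(\<lambda>\<omega>. \<xi> \<omega> * \<eta> \<omega>) \<in> borel_measurable (F c)" using \<xi>c \<eta>(1) by simp
  have \<xi>\<eta>: "\<bar>\<xi> \<omega> * \<eta> \<omega>\<bar> \<le> C * D" if "\<omega> \<in> space M" for \<omega>
    unfolding abs_mult using \<xi>(2)[OF that] \<eta>(2)[OF that] by (intro mult_mono) auto
  have ii: "integrable (P x) (\<lambda>\<omega>. \<xi> \<omega> * \<eta> \<omega>)"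
    by (rule bounded_integrable[OF \<xi>\<eta>c c0 \<xi>\<eta>])
  \<comment> \<open>The factor known at time c is unbounded here; its integrability comes from
    domination by C D times an increment.\<close>
  have early: "integrable (P x) (\<lambda>\<omega>. \<xi> \<omega> * \<eta> \<omega> * (B u \<omega> - B a \<omega>) * (B d \<omega> - B c \<omega>)) \<and>
      (LINT \<omega>|P x. \<xi> \<omega> * \<eta> \<omega> * (B u \<omega> - B a \<omega>) * (B d \<omega> - B c \<omega>)) = 0"
    if u: "a \<le> u" "u \<le> c" for u
  proof -
    have "(\<lambda>\<omega>. \<xi> \<omega> * \<eta> \<omega> * (B u \<omega> - B a \<omega>)) \<in> borel_measurable (F c)"
      using u abcd by (intro borel_measurable_times[OF \<xi>\<eta>c] borel_measurable_diff measurable_B) auto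
    moreover have "integrable (P x) (\<lambda>\<omega>. \<xi> \<omega> * \<eta> \<omega> * (B u \<omega> - B a \<omega>))"
    proof (rule Bochner_Integration.integrable_bound)
      show "integrable (P x) (\<lambda>\<omega>. C * D * (B u \<omega> - B a \<omega>))"
        using increment_moments(1)[of a u x 1] abcd u by simp
      show "(\<lambda>\<omega>. \<xi> \<omega> * \<eta> \<omega> * (B u \<omega> - B a \<omega>)) \<in> borel_measurable (P x)"
        by (rule measurable_F_P[OF calculation c0])
      show "AE \<omega> in P x. norm (\<xi> \<omega> * \<eta> \<omega> * (B u \<omega> - B a \<omega>)) \<le> norm (C * D * (B u \<omega> - B a \<omega>))"
      proof (rule AE_I2)
        fix \<omega> assume "\<omega> \<in> space (P x)"
        then have "\<bar>\<xi> \<omega> * \<eta> \<omega>\<bar> \<le> \<bar>C * D\<bar>" using \<xi>\<eta>[of \<omega>] by (simp add: space_P)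
        then show "norm (\<xi> \<omega> * \<eta> \<omega> * (B u \<omega> - B a \<omega>)) \<le> norm (C * D * (B u \<omega> - B a \<omega>))"
          unfolding real_norm_def abs_mult[of _ "B u \<omega> - B a \<omega>"] by (intro mult_right_mono) auto
      qed
    qed
    ultimately show ?thesis
      using past_mult_increment[of _ c x d] c0 abcd by blast
  qed
  show ?I ?E
  proof -
    have "?I \<and> ?E"
    proof (cases "b \<le> c")
      case True
      then show ?thesis
        using early[of b] abcd by (simp add: mult.assoc mult.left_commute)
    next
      case False
      \<comment> \<open>The overlap is (c, m]. The product of increments splits at c and m into
        three terms: one with a factor strictly before the increment over (c, d], the square over
        (c, m], and one whose last factor is the increment over (m, n]. The outer two have mean
        zero, and using m and n treats b \<le> d and d \<le> b alike.\<close>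
      define m n where "m = min b d" and "n = max b d"
      have m: "c \<le> m" "m \<le> n" "0 \<le> m" using False abcd by (auto simp: m_def n_def)
      have 1: "integrable (P x) (\<lambda>\<omega>. \<xi> \<omega> * \<eta> \<omega> * (B c \<omega> - B a \<omega>) * (B d \<omega> - B c \<omega>))"
        "(LINT \<omega>|P x. \<xi> \<omega> * \<eta> \<omega> * (B c \<omega> - B a \<omega>) * (B d \<omega> - B c \<omega>)) = 0"
        using early[of c] abcd by auto
      have 2: "integrable (P x) (\<lambda>\<omega>. \<xi> \<omega> * \<eta> \<omega> * (B m \<omega> - B c \<omega>)\<^sup>2)"
        "(LINT \<omega>|P x. \<xi> \<omega> * \<eta> \<omega> * (B m \<omega> - B c \<omega>)\<^sup>2) = (LINT \<omega>|P x. \<xi> \<omega> * \<eta> \<omega>) * (m - c)"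
        using past_mult_increment_power[OF \<xi>\<eta>c ii c0 m(1), of 2] increment_moments(3)[OF c0 m(1), of x] by auto
      have 3: "integrable (P x) (\<lambda>\<omega>. \<xi> \<omega> * \<eta> \<omega> * (B m \<omega> - B c \<omega>) * (B n \<omega> - B m \<omega>))"
        "(LINT \<omega>|P x. \<xi> \<omega> * \<eta> \<omega> * (B m \<omega> - B c \<omega>) * (B n \<omega> - B m \<omega>)) = 0"
      proof -
        have "(\<lambda>\<omega>. \<xi> \<omega> * \<eta> \<omega> * (B m \<omega> - B c \<omega>)) \<in> borel_measurable (F m)"
          using m c0
          by (intro borel_measurable_times[OF measurable_F_mono[OF \<xi>\<eta>c c0 m(1)]] borel_measurable_diff measurable_B) auto
        then show "integrable (P x) (\<lambda>\<omega>. \<xi> \<omega> * \<eta> \<omega> * (B m \<omega> - B c \<omega>) * (B n \<omega> - B m \<omega>))"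
          "(LINT \<omega>|P x. \<xi> \<omega> * \<eta> \<omega> * (B m \<omega> - B c \<omega>) * (B n \<omega> - B m \<omega>)) = 0"
          using past_mult_increment[OF _ past_mult_increment(1)[OF \<xi>\<eta>c ii c0 m(1)] m(3,2)] by auto
      qed
      have eq: "(\<xi> \<omega> * (B b \<omega> - B a \<omega>)) * (\<eta> \<omega> * (B d \<omega> - B c \<omega>)) =
        \<xi> \<omega> * \<eta> \<omega> * (B c \<omega> - B a \<omega>) * (B d \<omega> - B c \<omega>) + \<xi> \<omega> * \<eta> \<omega> * (B m \<omega> - B c \<omega>)\<^sup>2
        + \<xi> \<omega> * \<eta> \<omega> * (B m \<omega> - B c \<omega>) * (B n \<omega> - B m \<omega>)" for \<omega>
        by (cases "b \<le> d") (simp_all add: m_def n_def min_def max_def power2_eq_square algebra_simps)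
      have "max 0 (min b d - max a c) = m - c"
        using m abcd False by (simp add: m_def max_def)
      then show ?thesis
        unfolding eq using 1 2 3 by simp
    qed
    then show ?I ?E by auto
  qed
qed

lemma cross_isometry:
  fixes \<xi> \<eta> :: "'a \<Rightarrow> real"
  assumes "0 \<le> a" "a \<le> b" "0 \<le> c" "c \<le> d"
    and "\<xi> \<in> borel_measurable (F a)" "\<And>\<omega>. \<omega> \<in> space M \<Longrightarrow> \<bar>\<xi> \<omega>\<bar> \<le> C"
    and "\<eta> \<in> borel_measurable (F c)" "\<And>\<omega>. \<omega> \<in> space M \<Longrightarrow> \<bar>\<eta> \<omega>\<bar> \<le> D"
  shows "integrable (P x) (\<lambda>\<omega>. (\<xi> \<omega> * (B b \<omega> - B a \<omega>)) * (\<eta> \<omega> * (B d \<omega> - B c \<omega>)))"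
    and "(LINT \<omega>|P x. (\<xi> \<omega> * (B b \<omega> - B a \<omega>)) * (\<eta> \<omega> * (B d \<omega> - B c \<omega>))) =
      (LINT \<omega>|P x. \<xi> \<omega> * \<eta> \<omega>) * max 0 (min b d - max a c)"
  using cross_isometry_ordered[of a b c d \<xi> C \<eta> D x] cross_isometry_ordered[of c d a b \<eta> D \<xi> C x] assms
  by (cases "a \<le> c"; simp add: mult.commute min.commute max.commute)+

text \<open>The intervals of the family may overlap arbitrarily, so differences of simple integrals over
  different partitions are covered without a common refinement.\<close>

lemma isometry:
  assumes I: "finite I"
    and ab: "\<And>i. i \<in> I \<Longrightarrow> 0 \<le> a i \<and> a i \<le> b i"
    and \<xi>: "\<And>i. i \<in> I \<Longrightarrow> \<xi> i \<in> borel_measurable (F (a i))"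
      "\<And>i. i \<in> I \<Longrightarrow> \<exists>C. \<forall>\<omega>\<in>space M. \<bar>\<xi> i \<omega>\<bar> \<le> C"
  shows "integrable (P x) (\<lambda>\<omega>. (\<Sum>i\<in>I. \<xi> i \<omega> * (B (b i) \<omega> - B (a i) \<omega>))\<^sup>2)" (is ?int)
    and "(\<integral>\<^sup>+\<omega>. ennreal ((\<Sum>i\<in>I. \<xi> i \<omega> * (B (b i) \<omega> - B (a i) \<omega>))\<^sup>2) \<partial>P x) =
      (\<integral>\<^sup>+\<omega>. (\<integral>\<^sup>+s. ennreal ((\<Sum>i\<in>I. \<xi> i \<omega> * indicator {a i<..b i} s)\<^sup>2) \<partial>lborel) \<partial>P x)" (is ?eq)
proof -
  obtain C where C: "\<And>i \<omega>. i \<in> I \<Longrightarrow> \<omega> \<in> space M \<Longrightarrow> \<bar>\<xi> i \<omega>\<bar> \<le> C i"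
    using \<xi>(2) by metis
  have sq: "(\<Sum>i\<in>I. f i)\<^sup>2 = (\<Sum>i\<in>I. \<Sum>j\<in>I. f i * f j)" for f :: "_ \<Rightarrow> real"
    by (simp add: power2_eq_square sum_product)
  have X: "integrable (P x) (\<lambda>\<omega>. (\<xi> i \<omega> * (B (b i) \<omega> - B (a i) \<omega>)) * (\<xi> j \<omega> * (B (b j) \<omega> - B (a j) \<omega>)))"
    "(LINT \<omega>|P x. (\<xi> i \<omega> * (B (b i) \<omega> - B (a i) \<omega>)) * (\<xi> j \<omega> * (B (b j) \<omega> - B (a j) \<omega>))) =
      (LINT \<omega>|P x. \<xi> i \<omega> * \<xi> j \<omega>) * max 0 (min (b i) (b j) - max (a i) (a j))"
    if "i \<in> I" "j \<in> I" for i j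
    using cross_isometry[of "a i" "b i" "a j" "b j" "\<xi> i" "C i" "\<xi> j" "C j" x] that ab \<xi>(1) C by auto
  have \<xi>\<xi>: "integrable (P x) (\<lambda>\<omega>. \<xi> i \<omega> * \<xi> j \<omega>)" if "i \<in> I" "j \<in> I" for i j
  proof (rule bounded_integrable[where s="max (a i) (a j)" and C="C i * C j"])
    show "(\<lambda>\<omega>. \<xi> i \<omega> * \<xi> j \<omega>) \<in> borel_measurable (F (max (a i) (a j)))"
      by (intro borel_measurable_times measurable_F_mono[OF \<xi>(1)[OF that(1)]] measurable_F_mono[OF \<xi>(1)[OF that(2)]])
        (use that ab in auto)
    show "0 \<le> max (a i) (a j)" using ab[OF that(1)] by auto
    show "\<bar>\<xi> i \<omega> * \<xi> j \<omega>\<bar> \<le> C i * C j" if "\<omega> \<in> space M" for \<omega>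
      unfolding abs_mult using C[of i \<omega>] C[of j \<omega>] that \<open>i \<in> I\<close> \<open>j \<in> I\<close> by (intro mult_mono) (auto intro: order_trans[OF abs_ge_zero])
  qed
  show ?int unfolding sq using X(1) by auto
  \<comment> \<open>The overlap length of the i-th and j-th interval. It arises on one side as
    covariance of increments and on the other as integral of a product of indicators, so both sides
    become the same double sum.\<close>
  let ?r = "\<lambda>i j. max 0 (min (b i) (b j) - max (a i) (a j))"
  have e: "(\<xi> i \<omega> * indicator {a i<..b i} s) * (\<xi> j \<omega> * indicator {a j<..b j} s) =
      \<xi> i \<omega> * \<xi> j \<omega> * (indicator {a i<..b i} s * indicator {a j<..b j} s)" for i j s \<omega>
    by simp
  have step_int: "integrable lborel (\<lambda>s. (\<Sum>i\<in>I. \<xi> i \<omega> * indicator {a i<..b i} s)\<^sup>2)" for \<omega>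
    unfolding sq e by (intro Bochner_Integration.integrable_sum integrable_mult_right overlap_integral(1))
  have step: "(LINT s|lborel. (\<Sum>i\<in>I. \<xi> i \<omega> * indicator {a i<..b i} s)\<^sup>2) =
      (\<Sum>i\<in>I. \<Sum>j\<in>I. \<xi> i \<omega> * \<xi> j \<omega> * ?r i j)" for \<omega>
    unfolding sq e
    by (simp add: Bochner_Integration.integral_sum Bochner_Integration.integrable_sum
         integrable_mult_right overlap_integral del: integrable_mult_right_iff)
  have inner: "(\<integral>\<^sup>+s. ennreal ((\<Sum>i\<in>I. \<xi> i \<omega> * indicator {a i<..b i} s)\<^sup>2) \<partial>lborel) =
     ennreal (\<Sum>i\<in>I. \<Sum>j\<in>I. \<xi> i \<omega> * \<xi> j \<omega> * ?r i j)" for \<omega>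
    using nn_integral_eq_integral[OF step_int] by (simp add: step)
  have nn: "(\<Sum>i\<in>I. \<Sum>j\<in>I. \<xi> i \<omega> * \<xi> j \<omega> * ?r i j) \<ge> 0" for \<omega>
    unfolding step[symmetric] by simp
  have "(\<integral>\<^sup>+\<omega>. ennreal ((\<Sum>i\<in>I. \<xi> i \<omega> * (B (b i) \<omega> - B (a i) \<omega>))\<^sup>2) \<partial>P x) =
     ennreal (LINT \<omega>|P x. (\<Sum>i\<in>I. \<xi> i \<omega> * (B (b i) \<omega> - B (a i) \<omega>))\<^sup>2)"
    using \<open>?int\<close> by (intro nn_integral_eq_integral) auto
  also have "(LINT \<omega>|P x. (\<Sum>i\<in>I. \<xi> i \<omega> * (B (b i) \<omega> - B (a i) \<omega>))\<^sup>2) =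
     (\<Sum>i\<in>I. \<Sum>j\<in>I. (LINT \<omega>|P x. \<xi> i \<omega> * \<xi> j \<omega>) * ?r i j)"
    unfolding sq using X
    by (simp add: Bochner_Integration.integral_sum Bochner_Integration.integrable_sum)
  also have "\<dots> = (LINT \<omega>|P x. (\<Sum>i\<in>I. \<Sum>j\<in>I. \<xi> i \<omega> * \<xi> j \<omega> * ?r i j))"
    using \<xi>\<xi> by (simp add: Bochner_Integration.integral_sum Bochner_Integration.integrable_sum
      del: integrable_mult_left_iff)
  also have "ennreal \<dots> = (\<integral>\<^sup>+\<omega>. ennreal (\<Sum>i\<in>I. \<Sum>j\<in>I. \<xi> i \<omega> * \<xi> j \<omega> * ?r i j) \<partial>P x)"
    using \<xi>\<xi> nn by (intro nn_integral_eq_integral[symmetric]) auto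
  finally show ?eq by (simp add: inner)
qed

end

section \<open>The martingale property of the Ito integral\<close>

text \<open>Nonnegativity of the variance plays the role of the Cauchy-Schwarz inequality: the
  squared mean of \<psi> X is at most C^2 E X^2. It moves expectations against a bounded test
  variable through L2 limits.\<close>

lemma (in prob_space) bounded_mult_L2_tendsto_0:
  fixes X :: "nat \<Rightarrow> 'a \<Rightarrow> real" and \<psi> :: "'a \<Rightarrow> real"
  assumes \<psi>: "\<psi> \<in> borel_measurable M" "\<And>\<omega>. \<omega> \<in> space M \<Longrightarrow> \<bar>\<psi> \<omega>\<bar> \<le> C"
    and X: "\<And>k. X k \<in> borel_measurable M" "\<And>k. integrable M (\<lambda>\<omega>. (X k \<omega>)\<^sup>2)"
    and lim: "(\<lambda>k. \<integral>\<^sup>+\<omega>. ennreal ((X k \<omega>)\<^sup>2) \<partial>M) \<longlonglongrightarrow> 0"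
  shows "integrable M (\<lambda>\<omega>. \<psi> \<omega> * X k \<omega>)"
    and "(\<lambda>k. expectation (\<lambda>\<omega>. \<psi> \<omega> * X k \<omega>)) \<longlonglongrightarrow> 0"
proof -
  have bound: "(\<psi> \<omega> * X k \<omega>)\<^sup>2 \<le> C\<^sup>2 * (X k \<omega>)\<^sup>2" if "\<omega> \<in> space M" for k \<omega>
    unfolding power_mult_distrib using \<psi>(2)[OF that]
    by (intro mult_right_mono) (auto simp: abs_le_square_iff[symmetric])
  have m: "(\<lambda>\<omega>. \<psi> \<omega> * X k \<omega>) \<in> borel_measurable M" for k
    using \<psi>(1) X(1) by simp
  have i2: "integrable M (\<lambda>\<omega>. (\<psi> \<omega> * X k \<omega>)\<^sup>2)" for k
    by (rule Bochner_Integration.integrable_bound[of _ "\<lambda>\<omega>. C\<^sup>2 * (X k \<omega>)\<^sup>2"])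
      (use X m bound in \<open>auto intro!: AE_I2\<close>)
  show i: "integrable M (\<lambda>\<omega>. \<psi> \<omega> * X k \<omega>)" for k
    by (rule square_integrable_imp_integrable[OF m i2])
  have "(\<lambda>k. ennreal (expectation (\<lambda>\<omega>. (X k \<omega>)\<^sup>2))) \<longlonglongrightarrow> ennreal 0"
    using lim by (simp add: nn_integral_eq_integral[OF X(2)])
  then have "(\<lambda>k. expectation (\<lambda>\<omega>. (X k \<omega>)\<^sup>2)) \<longlonglongrightarrow> 0"
    by (subst (asm) tendsto_ennreal_iff) auto
  from tendsto_mult_right_zero[OF this] have C: "(\<lambda>k. C\<^sup>2 * expectation (\<lambda>\<omega>. (X k \<omega>)\<^sup>2)) \<longlonglongrightarrow> 0" .
  have "(expectation (\<lambda>\<omega>. \<psi> \<omega> * X k \<omega>))\<^sup>2 \<le> C\<^sup>2 * expectation (\<lambda>\<omega>. (X k \<omega>)\<^sup>2)" for k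
  proof -
    have "(expectation (\<lambda>\<omega>. \<psi> \<omega> * X k \<omega>))\<^sup>2 \<le> expectation (\<lambda>\<omega>. (\<psi> \<omega> * X k \<omega>)\<^sup>2)"
      using variance_eq[OF i i2, of k] variance_positive[of "\<lambda>\<omega>. \<psi> \<omega> * X k \<omega>"] by linarith
    also have "\<dots> \<le> expectation (\<lambda>\<omega>. C\<^sup>2 * (X k \<omega>)\<^sup>2)"
      using i2 X(2) bound by (intro integral_mono) auto
    finally show ?thesis using X(2) by simp
  qed
  then have "(\<lambda>k. (expectation (\<lambda>\<omega>. \<psi> \<omega> * X k \<omega>))\<^sup>2) \<longlonglongrightarrow> 0"
    by (intro tendsto_sandwich[OF _ _ tendsto_const C]) auto
  then show "(\<lambda>k. expectation (\<lambda>\<omega>. \<psi> \<omega> * X k \<omega>)) \<longlonglongrightarrow> 0"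
    using tendsto_real_sqrt[of "\<lambda>k. (expectation (\<lambda>\<omega>. \<psi> \<omega> * X k \<omega>))\<^sup>2" 0]
    by (simp add: tendsto_rabs_zero_iff)
qed

section \<open>Simple integrals and their L2 limits\<close>

context brownian_family
begin

lemma simple_integrand_nonneg:
  assumes "simple_integrand F n p \<xi>"
  shows "i \<le> n \<Longrightarrow> 0 \<le> p i"
proof (induction i)
  case 0
  then show ?case using assms by (simp add: simple_integrand_def)
next
  case (Suc i)
  then have "0 \<le> p i" "p i \<le> p (Suc i)" using assms by (auto simp: simple_integrand_def)
  then show ?case by linarith
qed

lemma simple_integrandD:
  assumes S: "simple_integrand F n p \<xi>" and i: "i < n"
  shows "0 \<le> p i" "p i \<le> p (Suc i)" "\<xi> i \<in> borel_measurable (F (p i))"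
    "\<exists>C. \<forall>\<omega>\<in>space M. \<bar>\<xi> i \<omega>\<bar> \<le> C"
proof -
  show p: "0 \<le> p i" using simple_integrand_nonneg[OF S] i by simp
  show "p i \<le> p (Suc i)" "\<xi> i \<in> borel_measurable (F (p i))"
    using S i by (auto simp: simple_integrand_def)
  have "bounded (\<xi> i ` space M)"
    using S i p by (auto simp: simple_integrand_def space_F)
  then show "\<exists>C. \<forall>\<omega>\<in>space M. \<bar>\<xi> i \<omega>\<bar> \<le> C"
    by (auto simp: bounded_iff)
qed

text \<open>Heights after time \<open>s\<close> do not contribute to the integral up to time \<open>s\<close>; cutting them off makes
  the truncated partition adapted.\<close>

definition cut_height :: "real \<Rightarrow> (nat \<Rightarrow> real) \<Rightarrow> (nat \<Rightarrow> 'a \<Rightarrow> real) \<Rightarrow> nat \<Rightarrow> 'a \<Rightarrow> real" where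
  "cut_height s p \<xi> i \<omega> = (if p i < s then \<xi> i \<omega> else 0)"

lemma cut_height_props:
  assumes S: "simple_integrand F n p \<xi>" and i: "i < n" and s: "0 \<le> s"
  shows "cut_height s p \<xi> i \<in> borel_measurable (F (min (p i) s))"
    "\<exists>C. \<forall>\<omega>\<in>space M. \<bar>cut_height s p \<xi> i \<omega>\<bar> \<le> C"
proof -
  note D = simple_integrandD[OF S i]
  show "cut_height s p \<xi> i \<in> borel_measurable (F (min (p i) s))"
    using D(3) by (cases "p i < s") (simp_all add: cut_height_def[abs_def])
  show "\<exists>C. \<forall>\<omega>\<in>space M. \<bar>cut_height s p \<xi> i \<omega>\<bar> \<le> C"
    using D(4) by (cases "p i < s") (auto simp: cut_height_def[abs_def])
qed

lemma simple_ito_integral_eq: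
  assumes "simple_integrand F n p \<xi>"
  shows "simple_ito_integral B n p \<xi> s \<omega> =
    (\<Sum>i<n. cut_height s p \<xi> i \<omega> * (B (min (p (Suc i)) s) \<omega> - B (min (p i) s) \<omega>))"
  unfolding simple_ito_integral_def
proof (intro sum.cong[OF refl])
  fix i assume "i \<in> {..<n}"
  then have "p i \<le> p (Suc i)" using simple_integrandD(2)[OF assms] by simp
  then show "\<xi> i \<omega> * (B (min (p (Suc i)) s) \<omega> - B (min (p i) s) \<omega>) =
      cut_height s p \<xi> i \<omega> * (B (min (p (Suc i)) s) \<omega> - B (min (p i) s) \<omega>)"
    by (auto simp: cut_height_def min_def)
qed

text \<open>Companion of \<open>simple_ito_integral_eq\<close>: the family that represents the
  integral up to time s has as its step function the original process restricted to [0, s], which is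
  what the isometry measures.\<close>

lemma simple_process_cut:
  assumes "simple_integrand F n p \<xi>"
  shows "(\<Sum>i<n. cut_height s p \<xi> i \<omega> * indicator {min (p i) s<..min (p (Suc i)) s} r) =
    simple_process n p \<xi> r \<omega> * indicator {0..s} r"
  unfolding simple_process_def sum_distrib_right
  using simple_integrandD(1,2)[OF assms]
  by (intro sum.cong) (auto simp: cut_height_def indicator_def min_def; smt (verit))+

lemma simple_ito_integral_measurable:
  assumes S: "simple_integrand F n p \<xi>" and s: "0 \<le> s"
  shows "simple_ito_integral B n p \<xi> s \<in> borel_measurable (P x)"
  unfolding simple_ito_integral_def[abs_def]
  using simple_integrand_nonneg[OF S] s
  by (intro borel_measurable_sum borel_measurable_times borel_measurable_diff measurable_B_P)
    (auto intro: measurable_F_P[OF simple_integrandD(3)[OF S] simple_integrandD(1)[OF S]])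

lemma simple_ito_integral_square_integrable:
  assumes S: "simple_integrand F n p \<xi>" and s: "0 \<le> s"
  shows "integrable (P x) (\<lambda>\<omega>. (simple_ito_integral B n p \<xi> s \<omega>)\<^sup>2)"
  unfolding simple_ito_integral_eq[OF S]
  using simple_integrandD(1,2)[OF S] cut_height_props[OF S _ s] s
  by (intro isometry(1)) (auto intro: min.coboundedI1)

text \<open>Clamping the partition points into [s, t] turns the difference of the two integrals into
  one sum of increments, each starting at some \<open>a i\<close> \<ge> s where \<psi> and the
  height are both known. If \<open>a i\<close> lies before \<open>p i\<close>, then
  \<open>p i\<close> exceeds t and the height has been cut to 0, so adaptedness survives the
  clamping. Every summand then has mean zero.\<close>

lemma simple_ito_martingale:
  assumes S: "simple_integrand F n p \<xi>" and st: "0 \<le> s" "s \<le> t"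
    and \<psi>: "\<psi> \<in> borel_measurable (F s)" "\<And>\<omega>. \<omega> \<in> space M \<Longrightarrow> \<bar>\<psi> \<omega>\<bar> \<le> C"
  shows "(LINT \<omega>|P x. \<psi> \<omega> * (simple_ito_integral B n p \<xi> t \<omega> - simple_ito_integral B n p \<xi> s \<omega>)) = 0"
proof -
  define a where "a = (\<lambda>i. max s (min (p i) t))"
  have shift: "B (min u t) \<omega> - B (min u s) \<omega> = B (max s (min u t)) \<omega> - B s \<omega>" for u \<omega>
    using st by (auto simp: min_def max_def)
  have eq: "\<psi> \<omega> * (simple_ito_integral B n p \<xi> t \<omega> - simple_ito_integral B n p \<xi> s \<omega>) =
      (\<Sum>i<n. (\<psi> \<omega> * cut_height t p \<xi> i \<omega>) * (B (a (Suc i)) \<omega> - B (a i) \<omega>))" for \<omega>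
    unfolding simple_ito_integral_def sum_subtractf[symmetric] sum_distrib_left
  proof (rule sum.cong[OF refl])
    fix i assume i: "i \<in> {..<n}"
    have "\<xi> i \<omega> * (B (min (p (Suc i)) t) \<omega> - B (min (p i) t) \<omega>) -
        \<xi> i \<omega> * (B (min (p (Suc i)) s) \<omega> - B (min (p i) s) \<omega>) =
      \<xi> i \<omega> * (B (a (Suc i)) \<omega> - B (a i) \<omega>)"
    proof -
      have "B (min (p (Suc i)) t) \<omega> - B (min (p i) t) \<omega> - (B (min (p (Suc i)) s) \<omega> - B (min (p i) s) \<omega>) =
          B (a (Suc i)) \<omega> - B (a i) \<omega>"
        using shift[of "p (Suc i)" \<omega>] shift[of "p i" \<omega>] unfolding a_def by linarith
      then show ?thesis by (simp only: right_diff_distrib[symmetric])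
    qed
    also have "\<dots> = cut_height t p \<xi> i \<omega> * (B (a (Suc i)) \<omega> - B (a i) \<omega>)"
      using simple_integrandD(2)[OF S, of i] i by (auto simp: cut_height_def a_def)
    finally show "\<psi> \<omega> * (\<xi> i \<omega> * (B (min (p (Suc i)) t) \<omega> - B (min (p i) t) \<omega>) -
        \<xi> i \<omega> * (B (min (p (Suc i)) s) \<omega> - B (min (p i) s) \<omega>)) =
        \<psi> \<omega> * cut_height t p \<xi> i \<omega> * (B (a (Suc i)) \<omega> - B (a i) \<omega>)"
      by (simp only: mult.assoc)
  qed
  have summand: "integrable (P x) (\<lambda>\<omega>. (\<psi> \<omega> * cut_height t p \<xi> i \<omega>) * (B (a (Suc i)) \<omega> - B (a i) \<omega>)) \<and>
      (LINT \<omega>|P x. (\<psi> \<omega> * cut_height t p \<xi> i \<omega>) * (B (a (Suc i)) \<omega> - B (a i) \<omega>)) = 0"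
    if i: "i < n" for i
  proof -
    have a: "0 \<le> a i" "a i \<le> a (Suc i)" "s \<le> a i" "min (p i) t \<le> a i"
      using simple_integrandD(2)[OF S i] st by (auto simp: a_def)
    have c: "cut_height t p \<xi> i \<in> borel_measurable (F (a i))"
      using measurable_F_mono[OF cut_height_props(1)[OF S i, of t]] a st simple_integrandD(1)[OF S i]
      by simp
    obtain D where D: "\<And>\<omega>. \<omega> \<in> space M \<Longrightarrow> \<bar>cut_height t p \<xi> i \<omega>\<bar> \<le> D"
      using cut_height_props(2)[OF S i, of t] st by auto
    have m: "(\<lambda>\<omega>. \<psi> \<omega> * cut_height t p \<xi> i \<omega>) \<in> borel_measurable (F (a i))"
      using c measurable_F_mono[OF \<psi>(1) st(1) a(3)] by simp
    have b: "\<bar>\<psi> \<omega> * cut_height t p \<xi> i \<omega>\<bar> \<le> C * D" if "\<omega> \<in> space M" for \<omega>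
      unfolding abs_mult using \<psi>(2)[OF that] D[OF that] by (intro mult_mono) auto
    show ?thesis
      using past_mult_increment[OF m bounded_integrable[OF m a(1) b] a(1,2)] by auto
  qed
  then show ?thesis
    unfolding eq by (subst Bochner_Integration.integral_sum) auto
qed

text \<open>The approximations that define the integral up to t and up to s are chosen separately.
  Their difference at time s is a single sum indexed by the disjoint union of the two partitions, so
  the isometry applies to it, and the integrand H serves as midpoint in (u - v)^2 \<le> 2 (u - k)^2
  + 2 (v - k)^2.\<close>

lemma simple_ito_integral_distance:
  assumes S: "simple_integrand F n p \<xi>" and S': "simple_integrand F m q \<eta>"
    and s: "0 \<le> s" "s \<le> t"
    and H: "(\<lambda>(r, \<omega>). H r \<omega>) \<in> borel_measurable (restrict_space borel {0..s} \<Otimes>\<^sub>M F s)"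
  shows "(\<integral>\<^sup>+\<omega>. ennreal ((simple_ito_integral B n p \<xi> s \<omega> - simple_ito_integral B m q \<eta> s \<omega>)\<^sup>2) \<partial>P x) \<le>
    2 * (\<integral>\<^sup>+\<omega>. (\<integral>\<^sup>+r\<in>{0..t}. ennreal ((simple_process n p \<xi> r \<omega> - H r \<omega>)\<^sup>2) \<partial>lborel) \<partial>P x) +
    2 * (\<integral>\<^sup>+\<omega>. (\<integral>\<^sup>+r\<in>{0..s}. ennreal ((simple_process m q \<eta> r \<omega> - H r \<omega>)\<^sup>2) \<partial>lborel) \<partial>P x)"
proof -
  interpret prob_space "P x" by (rule prob_space_P)
  define I where "I = {..<n} <+> {..<m}"
  define a where "a = case_sum (\<lambda>i. min (p i) s) (\<lambda>j. min (q j) s)"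
  define b where "b = case_sum (\<lambda>i. min (p (Suc i)) s) (\<lambda>j. min (q (Suc j)) s)"
  define h where "h = case_sum (cut_height s p \<xi>) (\<lambda>j \<omega>. - cut_height s q \<eta> j \<omega>)"
  have J: "simple_ito_integral B n p \<xi> s \<omega> - simple_ito_integral B m q \<eta> s \<omega> =
      (\<Sum>i\<in>I. h i \<omega> * (B (b i) \<omega> - B (a i) \<omega>))" for \<omega>
    by (simp add: I_def a_def b_def h_def sum.Plus simple_ito_integral_eq[OF S] simple_ito_integral_eq[OF S']
        comp_def sum_negf)
  have process: "(\<Sum>i\<in>I. h i \<omega> * indicator {a i<..b i} r) =
      (simple_process n p \<xi> r \<omega> - simple_process m q \<eta> r \<omega>) * indicator {0..s} r" for \<omega> r
    using simple_process_cut[OF S, of s \<omega> r] simple_process_cut[OF S', of s \<omega> r]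
    by (simp only: I_def a_def b_def h_def sum.Plus finite_lessThan comp_def sum.case mult_minus_left sum_negf
        distrib_right diff_conv_add_uminus)
  have iso: "(\<integral>\<^sup>+\<omega>. ennreal ((\<Sum>i\<in>I. h i \<omega> * (B (b i) \<omega> - B (a i) \<omega>))\<^sup>2) \<partial>P x) =
      (\<integral>\<^sup>+\<omega>. (\<integral>\<^sup>+r. ennreal ((\<Sum>i\<in>I. h i \<omega> * indicator {a i<..b i} r)\<^sup>2) \<partial>lborel) \<partial>P x)"
  proof (rule isometry(2))
    show "finite I" by (simp add: I_def)
    fix i assume "i \<in> I"
    have le: "min (p j) s \<le> p (Suc j)" if "j < n" for j
      using simple_integrandD(2)[OF S that] by simp
    have le': "min (q j) s \<le> q (Suc j)" if "j < m" for j
      using simple_integrandD(2)[OF S' that] by simp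
    from \<open>i \<in> I\<close> show "0 \<le> a i \<and> a i \<le> b i" "h i \<in> borel_measurable (F (a i))" "\<exists>C. \<forall>\<omega>\<in>space M. \<bar>h i \<omega>\<bar> \<le> C"
      using simple_integrandD(1,2)[OF S] cut_height_props[OF S _ s(1)]
        simple_integrandD(1,2)[OF S'] cut_height_props[OF S' _ s(1)] s
      by (auto simp: I_def a_def b_def h_def intro: le le')
  qed
  \<comment> \<open>Measurability of H is known on [0, s] only; clamping the time argument yields a
    jointly measurable function on the whole line that agrees with H under the indicator of
    [0, s].\<close>
  define K where "K = (\<lambda>\<omega> r. H (max 0 (min s r)) \<omega>)"
  have K[measurable]: "(\<lambda>(\<omega>, r). K \<omega> r) \<in> borel_measurable (P x \<Otimes>\<^sub>M lborel)"
  proof -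
    have "(\<lambda>\<omega>. \<omega>) \<in> measurable (P x) (F s)"
      by (rule measurable_from_subalg[OF subalgebra_P[OF s(1)]]) simp
    then have 1: "(\<lambda>z. fst z) \<in> measurable (P x \<Otimes>\<^sub>M lborel) (F s)"
      by (rule measurable_compose[OF measurable_fst])
    have 2: "(\<lambda>z. max 0 (min s (snd z))) \<in> measurable (P x \<Otimes>\<^sub>M lborel) (restrict_space borel {0..s})"
      by (rule measurable_restrict_space2) (use s in auto)
    have "(\<lambda>z. (max 0 (min s (snd z)), fst z)) \<in> measurable (P x \<Otimes>\<^sub>M lborel) (restrict_space borel {0..s} \<Otimes>\<^sub>M F s)"
      using 1 2 by (rule measurable_Pair[rotated])
    from measurable_compose[OF this H] show ?thesis
      by (simp add: K_def case_prod_beta)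
  qed
  have meas: "(\<lambda>(\<omega>, r). simple_process n p \<xi> r \<omega>) \<in> borel_measurable (P x \<Otimes>\<^sub>M lborel)"
    if "simple_integrand F n p \<xi>" for n p \<xi>
  proof -
    have "\<xi> i \<in> borel_measurable (P x)" if "i < n" for i
      using simple_integrandD(1,3)[OF \<open>simple_integrand F n p \<xi>\<close> that] measurable_F_P by blast
    then have "(\<lambda>z. \<xi> i (fst z)) \<in> borel_measurable (P x \<Otimes>\<^sub>M lborel)" if "i < n" for i
      using that by (intro measurable_compose[OF measurable_fst]) auto
    then show ?thesis
      unfolding simple_process_def case_prod_beta
      by (intro borel_measurable_sum borel_measurable_times) auto
  qed
  note meas[OF S, measurable] meas[OF S', measurable]
  let ?f = "\<lambda>\<omega> r. ennreal ((simple_process n p \<xi> r \<omega> - K \<omega> r)\<^sup>2) * indicator {0..s} r"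
  let ?g = "\<lambda>\<omega> r. ennreal ((simple_process m q \<eta> r \<omega> - K \<omega> r)\<^sup>2) * indicator {0..s} r"
  have f[measurable]: "(\<lambda>(\<omega>, r). ?f \<omega> r) \<in> borel_measurable (P x \<Otimes>\<^sub>M lborel)" by measurable
  have g[measurable]: "(\<lambda>(\<omega>, r). ?g \<omega> r) \<in> borel_measurable (P x \<Otimes>\<^sub>M lborel)" by measurable
  have f1: "?f \<omega> \<in> borel_measurable lborel" "?g \<omega> \<in> borel_measurable lborel" if "\<omega> \<in> space (P x)" for \<omega>
    using measurable_Pair2[OF f that] measurable_Pair2[OF g that] by auto
  have f2: "(\<lambda>\<omega>. \<integral>\<^sup>+r. ?f \<omega> r \<partial>lborel) \<in> borel_measurable (P x)"
      "(\<lambda>\<omega>. \<integral>\<^sup>+r. ?g \<omega> r \<partial>lborel) \<in> borel_measurable (P x)"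
    by (rule sigma_finite_measure.borel_measurable_nn_integral, rule sigma_finite_lborel, measurable)+
  have "(\<integral>\<^sup>+\<omega>. (\<integral>\<^sup>+r. ennreal ((\<Sum>i\<in>I. h i \<omega> * indicator {a i<..b i} r)\<^sup>2) \<partial>lborel) \<partial>P x) \<le>
      (\<integral>\<^sup>+\<omega>. (\<integral>\<^sup>+r. 2 * ?f \<omega> r + 2 * ?g \<omega> r \<partial>lborel) \<partial>P x)"
  proof (intro nn_integral_mono)
    fix \<omega> r
    have "(u - v)\<^sup>2 \<le> 2 * (u - k)\<^sup>2 + 2 * (v - k)\<^sup>2" for u v k :: real
      using zero_le_power2[of "u + v - 2 * k"] by (simp add: power2_eq_square algebra_simps)
    then have "ennreal ((simple_process n p \<xi> r \<omega> - simple_process m q \<eta> r \<omega>)\<^sup>2) \<le>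
        ennreal (2 * (simple_process n p \<xi> r \<omega> - K \<omega> r)\<^sup>2 + 2 * (simple_process m q \<eta> r \<omega> - K \<omega> r)\<^sup>2)"
      by (rule ennreal_leI)
    then show "ennreal ((\<Sum>i\<in>I. h i \<omega> * indicator {a i<..b i} r)\<^sup>2) \<le> 2 * ?f \<omega> r + 2 * ?g \<omega> r"
      unfolding process by (cases "r \<in> {0..s}") (auto simp: ennreal_plus ennreal_mult)
  qed
  also have "\<dots> = (\<integral>\<^sup>+\<omega>. 2 * (\<integral>\<^sup>+r. ?f \<omega> r \<partial>lborel) + 2 * (\<integral>\<^sup>+r. ?g \<omega> r \<partial>lborel) \<partial>P x)"
  proof (rule nn_integral_cong)
    fix \<omega> assume "\<omega> \<in> space (P x)"
    note f1[OF this, measurable]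
    show "(\<integral>\<^sup>+r. 2 * ?f \<omega> r + 2 * ?g \<omega> r \<partial>lborel) =
        2 * (\<integral>\<^sup>+r. ?f \<omega> r \<partial>lborel) + 2 * (\<integral>\<^sup>+r. ?g \<omega> r \<partial>lborel)"
      by (subst nn_integral_add, measurable) (subst nn_integral_cmult, measurable)+
  qed
  also have "\<dots> = 2 * (\<integral>\<^sup>+\<omega>. \<integral>\<^sup>+r. ?f \<omega> r \<partial>lborel \<partial>P x) + 2 * (\<integral>\<^sup>+\<omega>. \<integral>\<^sup>+r. ?g \<omega> r \<partial>lborel \<partial>P x)"
    supply f2[measurable]
    by (subst nn_integral_add, measurable) (subst nn_integral_cmult, measurable)+
  also have "\<dots> \<le> 2 * (\<integral>\<^sup>+\<omega>. (\<integral>\<^sup>+r\<in>{0..t}. ennreal ((simple_process n p \<xi> r \<omega> - H r \<omega>)\<^sup>2) \<partial>lborel) \<partial>P x) +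
    2 * (\<integral>\<^sup>+\<omega>. (\<integral>\<^sup>+r\<in>{0..s}. ennreal ((simple_process m q \<eta> r \<omega> - H r \<omega>)\<^sup>2) \<partial>lborel) \<partial>P x)"
    using s by (intro add_mono mult_left_mono nn_integral_mono) (auto simp: K_def indicator_def)
  finally show ?thesis
    unfolding J iso .
qed

text \<open>One simple approximant at finite L2 distance suffices, since v^2 \<le> 2 u^2 + 2 (u -
  v)^2.\<close>

lemma ito_integral_square_integrable:
  assumes I: "has_ito_integral (P x) F B t H I" and t: "0 \<le> t"
  shows "integrable (P x) (\<lambda>\<omega>. (I \<omega>)\<^sup>2)"
proof -
  obtain n p \<xi> where S: "\<And>k. simple_integrand F (n k) (p k) (\<xi> k)"
    and lim: "(\<lambda>k. \<integral>\<^sup>+\<omega>. ennreal ((simple_ito_integral B (n k) (p k) (\<xi> k) t \<omega> - I \<omega>)\<^sup>2) \<partial>P x) \<longlonglongrightarrow> 0"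
    and Im[measurable]: "I \<in> borel_measurable (P x)"
    using I unfolding has_ito_integral_def by blast
  have "\<forall>\<^sub>F k in sequentially. (\<integral>\<^sup>+\<omega>. ennreal ((simple_ito_integral B (n k) (p k) (\<xi> k) t \<omega> - I \<omega>)\<^sup>2) \<partial>P x) < 1"
    using order_tendstoD(2)[OF lim, of 1] by simp
  then obtain k where k: "(\<integral>\<^sup>+\<omega>. ennreal ((simple_ito_integral B (n k) (p k) (\<xi> k) t \<omega> - I \<omega>)\<^sup>2) \<partial>P x) < 1"
    by (auto simp: eventually_sequentially)
  note [measurable] = simple_ito_integral_measurable[OF S t]
  have "integrable (P x) (\<lambda>\<omega>. (simple_ito_integral B (n k) (p k) (\<xi> k) t \<omega> - I \<omega>)\<^sup>2)"
    by (intro integrableI_nonneg) (use k in \<open>auto intro: less_trans\<close>)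
  then have "integrable (P x) (\<lambda>\<omega>. 2 * (simple_ito_integral B (n k) (p k) (\<xi> k) t \<omega>)\<^sup>2
      + 2 * (simple_ito_integral B (n k) (p k) (\<xi> k) t \<omega> - I \<omega>)\<^sup>2)"
    using simple_ito_integral_square_integrable[OF S t] by simp
  then show ?thesis
  proof (rule Bochner_Integration.integrable_bound)
    have "v\<^sup>2 \<le> 2 * u\<^sup>2 + 2 * (u - v)\<^sup>2" for u v :: real
      using zero_le_power2[of "2 * u - v"] by (simp add: power2_eq_square algebra_simps)
    then show "AE \<omega> in P x. norm ((I \<omega>)\<^sup>2) \<le> norm (2 * (simple_ito_integral B (n k) (p k) (\<xi> k) t \<omega>)\<^sup>2
      + 2 * (simple_ito_integral B (n k) (p k) (\<xi> k) t \<omega> - I \<omega>)\<^sup>2)"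
      by (intro AE_I2) (simp add: abs_of_nonneg)
  qed simp
qed

text \<open>Let X approximate I on [0, t] and Y approximate J on [0, s]. Then I - J splits into I -
  X_t, X_t - X_s, X_s - Y_s and Y_s - J. The second piece has mean zero against \<psi> for every
  index; the others vanish in L2, the third because both sequences approximate the same H on
  [0, s].\<close>

lemma ito_integral_martingale:
  assumes I: "has_ito_integral (P x) F B t H I" and J: "has_ito_integral (P x) F B s H J"
    and st: "0 \<le> s" "s \<le> t"
    and \<psi>: "\<psi> \<in> borel_measurable (F s)" "\<And>\<omega>. \<omega> \<in> space M \<Longrightarrow> \<bar>\<psi> \<omega>\<bar> \<le> C"
  shows "integrable (P x) (\<lambda>\<omega>. \<psi> \<omega> * (I \<omega> - J \<omega>))"
    and "(LINT \<omega>|P x. \<psi> \<omega> * (I \<omega> - J \<omega>)) = 0"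
proof -
  interpret prob_space "P x" by (rule prob_space_P)
  have t: "0 \<le> t" using st by simp
  obtain n p \<xi> where S: "\<And>k. simple_integrand F (n k) (p k) (\<xi> k)"
    and limH: "(\<lambda>k. \<integral>\<^sup>+\<omega>. (\<integral>\<^sup>+s\<in>{0..t}.
             ennreal ((simple_process (n k) (p k) (\<xi> k) s \<omega> - H s \<omega>)\<^sup>2) \<partial>lborel) \<partial>P x) \<longlonglongrightarrow> 0"
    and limI: "(\<lambda>k. \<integral>\<^sup>+\<omega>. ennreal ((simple_ito_integral B (n k) (p k) (\<xi> k) t \<omega> - I \<omega>)\<^sup>2) \<partial>P x) \<longlonglongrightarrow> 0"
    and Im[measurable]: "I \<in> borel_measurable (P x)"
    using I unfolding has_ito_integral_def by blast
  obtain m q \<eta> where S': "\<And>k. simple_integrand F (m k) (q k) (\<eta> k)"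
    and limH': "(\<lambda>k. \<integral>\<^sup>+\<omega>. (\<integral>\<^sup>+r\<in>{0..s}.
             ennreal ((simple_process (m k) (q k) (\<eta> k) r \<omega> - H r \<omega>)\<^sup>2) \<partial>lborel) \<partial>P x) \<longlonglongrightarrow> 0"
    and limJ: "(\<lambda>k. \<integral>\<^sup>+\<omega>. ennreal ((simple_ito_integral B (m k) (q k) (\<eta> k) s \<omega> - J \<omega>)\<^sup>2) \<partial>P x) \<longlonglongrightarrow> 0"
    and Jm[measurable]: "J \<in> borel_measurable (P x)"
    and H: "(\<lambda>(r, \<omega>). H r \<omega>) \<in> borel_measurable (restrict_space borel {0..s} \<Otimes>\<^sub>M F s)"
    using J st unfolding has_ito_integral_def by auto
  define X where "X = (\<lambda>k. simple_ito_integral B (n k) (p k) (\<xi> k))"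
  define Y where "Y = (\<lambda>k. simple_ito_integral B (m k) (q k) (\<eta> k))"
  have [measurable]: "X k u \<in> borel_measurable (P x)" "Y k u \<in> borel_measurable (P x)" if "0 \<le> u" for k u
    using simple_ito_integral_measurable[OF S that] simple_ito_integral_measurable[OF S' that]
    by (auto simp: X_def Y_def)
  note [measurable] = this[OF st(1)] this[OF t]
  have sq: "integrable (P x) (\<lambda>\<omega>. (X k u \<omega>)\<^sup>2)" "integrable (P x) (\<lambda>\<omega>. (Y k u \<omega>)\<^sup>2)" if "0 \<le> u" for k u
    using simple_ito_integral_square_integrable[OF S that] simple_ito_integral_square_integrable[OF S' that]
    by (auto simp: X_def Y_def)
  have diff: "integrable (P x) (\<lambda>\<omega>. (f \<omega> - g \<omega>)\<^sup>2)"
    if "integrable (P x) (\<lambda>\<omega>. (f \<omega>)\<^sup>2)" "integrable (P x) (\<lambda>\<omega>. (g \<omega>)\<^sup>2)"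
      and [measurable]: "f \<in> borel_measurable (P x)" "g \<in> borel_measurable (P x)" for f g :: "'a \<Rightarrow> real"
  proof (rule Bochner_Integration.integrable_bound)
    show "integrable (P x) (\<lambda>\<omega>. 2 * (f \<omega>)\<^sup>2 + 2 * (g \<omega>)\<^sup>2)" using that by simp
    have "(u - v)\<^sup>2 \<le> 2 * u\<^sup>2 + 2 * v\<^sup>2" for u v :: real
      using zero_le_power2[of "u + v"] by (simp add: power2_eq_square algebra_simps)
    then show "AE \<omega> in P x. norm ((f \<omega> - g \<omega>)\<^sup>2) \<le> norm (2 * (f \<omega>)\<^sup>2 + 2 * (g \<omega>)\<^sup>2)"
      by (intro AE_I2) (simp add: abs_of_nonneg)
  qed simp
  have limD: "(\<lambda>k. \<integral>\<^sup>+\<omega>. ennreal ((X k s \<omega> - Y k s \<omega>)\<^sup>2) \<partial>P x) \<longlonglongrightarrow> 0"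
  proof (rule tendsto_sandwich[OF _ _ tendsto_const])
    have "(\<lambda>k. 2 * (\<integral>\<^sup>+\<omega>. (\<integral>\<^sup>+r\<in>{0..t}. ennreal ((simple_process (n k) (p k) (\<xi> k) r \<omega> - H r \<omega>)\<^sup>2) \<partial>lborel) \<partial>P x) +
      2 * (\<integral>\<^sup>+\<omega>. (\<integral>\<^sup>+r\<in>{0..s}. ennreal ((simple_process (m k) (q k) (\<eta> k) r \<omega> - H r \<omega>)\<^sup>2) \<partial>lborel) \<partial>P x)) \<longlonglongrightarrow> 2 * 0 + 2 * 0"
      by (intro tendsto_add ennreal_tendsto_cmult limH limH') auto
    then show "(\<lambda>k. 2 * (\<integral>\<^sup>+\<omega>. (\<integral>\<^sup>+r\<in>{0..t}. ennreal ((simple_process (n k) (p k) (\<xi> k) r \<omega> - H r \<omega>)\<^sup>2) \<partial>lborel) \<partial>P x) +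
      2 * (\<integral>\<^sup>+\<omega>. (\<integral>\<^sup>+r\<in>{0..s}. ennreal ((simple_process (m k) (q k) (\<eta> k) r \<omega> - H r \<omega>)\<^sup>2) \<partial>lborel) \<partial>P x)) \<longlonglongrightarrow> 0"
      by simp
    show "\<forall>\<^sub>F k in sequentially. (\<integral>\<^sup>+\<omega>. ennreal ((X k s \<omega> - Y k s \<omega>)\<^sup>2) \<partial>P x) \<le>
      2 * (\<integral>\<^sup>+\<omega>. (\<integral>\<^sup>+r\<in>{0..t}. ennreal ((simple_process (n k) (p k) (\<xi> k) r \<omega> - H r \<omega>)\<^sup>2) \<partial>lborel) \<partial>P x) +
      2 * (\<integral>\<^sup>+\<omega>. (\<integral>\<^sup>+r\<in>{0..s}. ennreal ((simple_process (m k) (q k) (\<eta> k) r \<omega> - H r \<omega>)\<^sup>2) \<partial>lborel) \<partial>P x)"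
      unfolding X_def Y_def
      using simple_ito_integral_distance[OF S S' st H] by (intro always_eventually allI)
  qed auto
  have limI': "(\<lambda>k. \<integral>\<^sup>+\<omega>. ennreal ((X k t \<omega> - I \<omega>)\<^sup>2) \<partial>P x) \<longlonglongrightarrow> 0"
    and limJ': "(\<lambda>k. \<integral>\<^sup>+\<omega>. ennreal ((Y k s \<omega> - J \<omega>)\<^sup>2) \<partial>P x) \<longlonglongrightarrow> 0"
    using limI limJ by (simp_all add: X_def Y_def)
  have \<psi>P: "\<psi> \<in> borel_measurable (P x)" "\<And>\<omega>. \<omega> \<in> space (P x) \<Longrightarrow> \<bar>\<psi> \<omega>\<bar> \<le> C"
    using \<psi> measurable_F_P st by (auto simp: space_P)
  have A: "integrable (P x) (\<lambda>\<omega>. \<psi> \<omega> * (X k t \<omega> - I \<omega>))"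
    "(\<lambda>k. expectation (\<lambda>\<omega>. \<psi> \<omega> * (X k t \<omega> - I \<omega>))) \<longlonglongrightarrow> 0" for k
    using bounded_mult_L2_tendsto_0[OF \<psi>P, of "\<lambda>k \<omega>. X k t \<omega> - I \<omega>"] limI'
      diff[OF sq(1)[OF t] ito_integral_square_integrable[OF I t]] by auto
  have D: "integrable (P x) (\<lambda>\<omega>. \<psi> \<omega> * (X k s \<omega> - Y k s \<omega>))"
    "(\<lambda>k. expectation (\<lambda>\<omega>. \<psi> \<omega> * (X k s \<omega> - Y k s \<omega>))) \<longlonglongrightarrow> 0" for k
    using bounded_mult_L2_tendsto_0[OF \<psi>P, of "\<lambda>k \<omega>. X k s \<omega> - Y k s \<omega>"] limD
      diff[OF sq(1)[OF st(1)] sq(2)[OF st(1)]] by auto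
  have E: "integrable (P x) (\<lambda>\<omega>. \<psi> \<omega> * (Y k s \<omega> - J \<omega>))"
    "(\<lambda>k. expectation (\<lambda>\<omega>. \<psi> \<omega> * (Y k s \<omega> - J \<omega>))) \<longlonglongrightarrow> 0" for k
    using bounded_mult_L2_tendsto_0[OF \<psi>P, of "\<lambda>k \<omega>. Y k s \<omega> - J \<omega>"] limJ'
      diff[OF sq(2)[OF st(1)] ito_integral_square_integrable[OF J st(1)]] by auto
  have X_int: "integrable (P x) (\<lambda>\<omega>. \<psi> \<omega> * (X k t \<omega> - X k s \<omega>))" for k
  proof (rule square_integrable_imp_integrable)
    show "integrable (P x) (\<lambda>\<omega>. (\<psi> \<omega> * (X k t \<omega> - X k s \<omega>))\<^sup>2)"
    proof (rule Bochner_Integration.integrable_bound)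
      show "integrable (P x) (\<lambda>\<omega>. C\<^sup>2 * (X k t \<omega> - X k s \<omega>)\<^sup>2)"
        using diff[OF sq(1)[OF t] sq(1)[OF st(1)]] by simp
      show "AE \<omega> in P x. norm ((\<psi> \<omega> * (X k t \<omega> - X k s \<omega>))\<^sup>2) \<le> norm (C\<^sup>2 * (X k t \<omega> - X k s \<omega>)\<^sup>2)"
        using order_trans[OF \<psi>P(2) abs_ge_self]
        by (intro AE_I2) (auto simp: power_mult_distrib abs_mult intro!: mult_right_mono
          simp: abs_le_square_iff[symmetric])
    qed (use \<psi>P in simp)
  qed (use \<psi>P in simp)
  have X0: "expectation (\<lambda>\<omega>. \<psi> \<omega> * (X k t \<omega> - X k s \<omega>)) = 0" for k
    unfolding X_def by (rule simple_ito_martingale[OF S st \<psi>])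
  have eq: "\<psi> \<omega> * (I \<omega> - J \<omega>) = - (\<psi> \<omega> * (X k t \<omega> - I \<omega>)) + \<psi> \<omega> * (X k t \<omega> - X k s \<omega>)
      + \<psi> \<omega> * (X k s \<omega> - Y k s \<omega>) + \<psi> \<omega> * (Y k s \<omega> - J \<omega>)" for \<omega> k
    by (simp add: algebra_simps)
  show "integrable (P x) (\<lambda>\<omega>. \<psi> \<omega> * (I \<omega> - J \<omega>))"
    unfolding eq[of _ 0] using A D E X_int by auto
  have "expectation (\<lambda>\<omega>. \<psi> \<omega> * (I \<omega> - J \<omega>)) = - expectation (\<lambda>\<omega>. \<psi> \<omega> * (X k t \<omega> - I \<omega>))
      + expectation (\<lambda>\<omega>. \<psi> \<omega> * (X k s \<omega> - Y k s \<omega>)) + expectation (\<lambda>\<omega>. \<psi> \<omega> * (Y k s \<omega> - J \<omega>))" for k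
    unfolding eq[of _ k] using A(1)[of k] D(1)[of k] E(1)[of k] X_int[of k] X0[of k]
    by (simp del: integrable_mult_left_iff integrable_mult_right_iff)
  moreover have "(\<lambda>k. - expectation (\<lambda>\<omega>. \<psi> \<omega> * (X k t \<omega> - I \<omega>))
      + expectation (\<lambda>\<omega>. \<psi> \<omega> * (X k s \<omega> - Y k s \<omega>)) + expectation (\<lambda>\<omega>. \<psi> \<omega> * (Y k s \<omega> - J \<omega>)))
      \<longlonglongrightarrow> - 0 + 0 + 0"
    by (intro tendsto_add tendsto_minus A(2) D(2) E(2))
  ultimately have "(\<lambda>k::nat. expectation (\<lambda>\<omega>. \<psi> \<omega> * (I \<omega> - J \<omega>))) \<longlonglongrightarrow> 0"
    by simp
  then show "expectation (\<lambda>\<omega>. \<psi> \<omega> * (I \<omega> - J \<omega>)) = 0"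
    by (simp add: LIMSEQ_const_iff)
qed

end

section \<open>Optional stopping\<close>

context brownian_family
begin

text \<open>A discrete stochastic integral of a 0/1 strategy \<open>\<psi>\<close>, the form that a
  Brownian motion stopped on a grid takes. Adaptedness, integrability of all powers and the moments
  are proved in one induction because each step multiplies powers of the past by powers of a fresh
  increment.\<close>

lemma gated_increments_moments:
  fixes \<psi> :: "nat \<Rightarrow> 'a \<Rightarrow> real"
  assumes \<delta>: "0 \<le> \<delta>"
    and \<psi>: "\<And>k. \<psi> k \<in> borel_measurable (F (real k * \<delta>))" "\<And>k \<omega>. \<psi> k \<omega> = 0 \<or> \<psi> k \<omega> = 1"
  defines "X \<equiv> \<lambda>m \<omega>. \<Sum>k<m. \<psi> k \<omega> * (B (real (Suc k) * \<delta>) \<omega> - B (real k * \<delta>) \<omega>)"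
  shows "X m \<in> borel_measurable (F (real m * \<delta>)) \<and> (\<forall>j. integrable (P x) (\<lambda>\<omega>. X m \<omega> ^ j)) \<and>
    (LINT \<omega>|P x. X m \<omega>) = 0 \<and> (LINT \<omega>|P x. (X m \<omega>)\<^sup>2) = \<delta> * (\<Sum>k<m. LINT \<omega>|P x. \<psi> k \<omega>) \<and>
    (LINT \<omega>|P x. (X m \<omega>) ^ 4) \<le> 3 * (real m * \<delta>)\<^sup>2"
proof (induction m)
  case 0
  interpret prob_space "P x" by (rule prob_space_P)
  show ?case by (simp add: X_def power_0_left)
next
  case (Suc m)
  interpret prob_space "P x" by (rule prob_space_P)
  let ?s = "real m * \<delta>" and ?t = "real (Suc m) * \<delta>"
  define D where "D = (\<lambda>\<omega>. B ?t \<omega> - B ?s \<omega>)"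
  have st: "0 \<le> ?s" "?s \<le> ?t" using \<delta> by (auto simp: algebra_simps)
  have X: "X m \<in> borel_measurable (F ?s)" and Xi: "\<And>j. integrable (P x) (\<lambda>\<omega>. X m \<omega> ^ j)"
    and X1: "expectation (X m) = 0" and X2: "expectation (\<lambda>\<omega>. (X m \<omega>)\<^sup>2) = \<delta> * (\<Sum>k<m. expectation (\<psi> k))"
    and X4: "expectation (\<lambda>\<omega>. X m \<omega> ^ 4) \<le> 3 * (real m * \<delta>)\<^sup>2"
    using Suc by auto
  have XS: "X (Suc m) \<omega> = X m \<omega> + \<psi> m \<omega> * D \<omega>" for \<omega>
    by (simp add: X_def D_def)
  have meas: "X (Suc m) \<in> borel_measurable (F ?t)"
    unfolding XS[abs_def] D_def
    by (intro borel_measurable_add borel_measurable_times borel_measurable_diff measurable_B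
        measurable_F_mono[OF X st] measurable_F_mono[OF \<psi>(1) st]) (use st \<delta> in auto)
  have \<psi>_le: "\<bar>\<psi> k \<omega> ^ l\<bar> \<le> 1" for k l \<omega>
    using \<psi>(2)[of k \<omega>] by (auto simp: power_0_left)
  have \<psi>_int: "integrable (P x) (\<psi> k)" for k
    by (rule bounded_integrable[OF \<psi>(1), of _ 1]) (use \<psi>_le[of k _ 1] \<delta> in auto)
  have \<psi>_E: "expectation (\<psi> k) \<le> 1" for k
    using integral_mono[OF \<psi>_int[of k], of "\<lambda>_. 1"] \<psi>_le[of k _ 1] prob_space
    by (auto simp: abs_le_iff)
  have Z: "(\<lambda>\<omega>. X m \<omega> ^ i * \<psi> m \<omega> ^ l) \<in> borel_measurable (F ?s)" for i l
    using X \<psi>(1) by (intro borel_measurable_times borel_measurable_power)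
  have Zi: "integrable (P x) (\<lambda>\<omega>. X m \<omega> ^ i * \<psi> m \<omega> ^ l)" for i l
  proof (rule Bochner_Integration.integrable_bound[OF Xi[of i] measurable_F_P[OF Z st(1)]], rule AE_I2)
    fix \<omega>
    have "\<bar>X m \<omega> ^ i\<bar> * \<bar>\<psi> m \<omega> ^ l\<bar> \<le> \<bar>X m \<omega> ^ i\<bar> * 1"
      by (rule mult_left_mono[OF \<psi>_le]) simp
    then show "norm (X m \<omega> ^ i * \<psi> m \<omega> ^ l) \<le> norm (X m \<omega> ^ i)" by (simp only: real_norm_def abs_mult mult_1_right)
  qed
  have ZD: "integrable (P x) (\<lambda>\<omega>. X m \<omega> ^ i * \<psi> m \<omega> ^ l * D \<omega> ^ k)"
    "expectation (\<lambda>\<omega>. X m \<omega> ^ i * \<psi> m \<omega> ^ l * D \<omega> ^ k) =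
      expectation (\<lambda>\<omega>. X m \<omega> ^ i * \<psi> m \<omega> ^ l) * expectation (\<lambda>\<omega>. D \<omega> ^ k)" for i l k
    unfolding D_def by (rule past_mult_increment_power[OF Z Zi st])+
  have int: "integrable (P x) (\<lambda>\<omega>. X (Suc m) \<omega> ^ j)" for j
  proof -
    have "X (Suc m) \<omega> ^ j = (\<Sum>i\<le>j. real (j choose i) * (X m \<omega> ^ i * \<psi> m \<omega> ^ (j - i) * D \<omega> ^ (j - i)))" for \<omega>
      unfolding XS binomial_ring by (simp add: power_mult_distrib mult.assoc)
    then show ?thesis using ZD(1) by simp
  qed
  \<comment> \<open>The gate is 0 or 1, so its positive powers collapse to the gate itself. The
    mixed terms factorise, and those with an odd power of the increment have mean zero.\<close>
  define Q where "Q = (\<lambda>i k \<omega>. X m \<omega> ^ i * \<psi> m \<omega> * D \<omega> ^ k)"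
  have Qi: "integrable (P x) (Q i k)" for i k
    using ZD(1)[of i 1 k] by (simp add: Q_def)
  have QE: "expectation (Q i k) = expectation (\<lambda>\<omega>. X m \<omega> ^ i * \<psi> m \<omega>) * expectation (\<lambda>\<omega>. D \<omega> ^ k)" for i k
    using ZD(2)[of i 1 k] by (simp add: Q_def)
  have D: "expectation (\<lambda>\<omega>. D \<omega>) = 0" "expectation (\<lambda>\<omega>. (D \<omega>)\<^sup>2) = \<delta>"
      "expectation (\<lambda>\<omega>. D \<omega> ^ 3) = 0" "expectation (\<lambda>\<omega>. D \<omega> ^ 4) = 3 * \<delta>\<^sup>2"
    using increment_moments[OF st, of x] by (auto simp: D_def algebra_simps)
  have e1: "X (Suc m) \<omega> = X m \<omega> + Q 0 1 \<omega>" for \<omega>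
    by (simp add: XS Q_def)
  have e2: "(X (Suc m) \<omega>)\<^sup>2 = (X m \<omega>)\<^sup>2 + 2 * Q 1 1 \<omega> + Q 0 2 \<omega>" for \<omega>
    using \<psi>(2)[of m \<omega>] by (auto simp: XS Q_def power2_eq_square algebra_simps)
  have e4: "X (Suc m) \<omega> ^ 4 = X m \<omega> ^ 4 + 4 * Q 3 1 \<omega> + 6 * Q 2 2 \<omega> + 4 * Q 1 3 \<omega> + Q 0 4 \<omega>" for \<omega>
  proof -
    have "(a + d) ^ 4 = a ^ 4 + 4 * (a ^ 3 * d) + 6 * (a\<^sup>2 * d\<^sup>2) + 4 * (a * d ^ 3) + d ^ 4" for a d :: real
      by algebra
    then show ?thesis using \<psi>(2)[of m \<omega>] by (auto simp: XS Q_def)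
  qed
  have E1: "expectation (X (Suc m)) = 0"
    unfolding e1[abs_def] using X1 Xi[of 1] Qi QE D by simp
  have E2: "expectation (\<lambda>\<omega>. (X (Suc m) \<omega>)\<^sup>2) = \<delta> * (\<Sum>k<Suc m. expectation (\<psi> k))"
    unfolding e2 using X2 Xi Qi QE D by (simp add: algebra_simps)
  have E4: "expectation (\<lambda>\<omega>. X (Suc m) \<omega> ^ 4) \<le> 3 * ?t\<^sup>2"
  proof -
    have "expectation (\<lambda>\<omega>. X (Suc m) \<omega> ^ 4) = expectation (\<lambda>\<omega>. X m \<omega> ^ 4)
        + 4 * expectation (Q 3 1) + 6 * expectation (Q 2 2) + 4 * expectation (Q 1 3) + expectation (Q 0 4)"
      unfolding e4 using Xi Qi by simp
    also have "\<dots> = expectation (\<lambda>\<omega>. X m \<omega> ^ 4) + 6 * expectation (\<lambda>\<omega>. X m \<omega> ^ 2 * \<psi> m \<omega>) * \<delta>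
        + expectation (\<psi> m) * (3 * \<delta>\<^sup>2)"
      unfolding QE using D by simp
    \<comment> \<open>The bound reproduces itself: 3 m^2 + 6 m + 3 = 3 (m + 1)^2, the middle term
      coming from E (X m)^2 \<le> m \<delta> and the last from the fourth moment 3 \<delta>^2 of one
      increment.\<close>
    also have "\<dots> \<le> 3 * (real m * \<delta>)\<^sup>2 + 6 * (real m * \<delta>) * \<delta> + 1 * (3 * \<delta>\<^sup>2)"
    proof (intro add_mono X4 mult_right_mono mult_left_mono \<psi>_E \<delta>)
      have "expectation (\<lambda>\<omega>. X m \<omega> ^ 2 * \<psi> m \<omega>) \<le> expectation (\<lambda>\<omega>. X m \<omega> ^ 2)"
      proof (rule integral_mono)
        show "X m \<omega> ^ 2 * \<psi> m \<omega> \<le> X m \<omega> ^ 2" for \<omega>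
          using \<psi>(2)[of m \<omega>] by auto
      qed (use Xi[of 2] Zi[of 2 1] in auto)
      also have "\<dots> \<le> \<delta> * real m"
        unfolding X2 using sum_mono[of "{..<m}" "\<lambda>k. expectation (\<psi> k)" "\<lambda>_. 1"] \<psi>_E \<delta>
        by (intro mult_left_mono) auto
      finally show "expectation (\<lambda>\<omega>. X m \<omega> ^ 2 * \<psi> m \<omega>) \<le> real m * \<delta>" by (simp add: mult.commute)
    qed auto
    also have "\<dots> = 3 * ?t\<^sup>2" by (simp add: power2_eq_square algebra_simps)
    finally show ?thesis .
  qed
  show ?case using meas int E1 E2 E4 by auto
qed

end

text \<open>The stopping property is phrased through {s < \<tau>}, the complement of {\<tau> \<le>
  s}, since this is the event on which an increment after s is still collected.\<close>

locale bounded_stopping_time = brownian_family M P F B \<theta>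
  for M :: "'a measure" and P F and B :: "real \<Rightarrow> 'a \<Rightarrow> real" and \<theta> +
  fixes \<tau> :: "'a \<Rightarrow> real" and T :: real
  assumes T_pos: "0 < T"
    and \<tau>_range: "\<And>\<omega>. \<omega> \<in> space M \<Longrightarrow> 0 \<le> \<tau> \<omega> \<and> \<tau> \<omega> \<le> T"
    and \<tau>_stopping: "\<And>s. 0 \<le> s \<Longrightarrow> {\<omega> \<in> space M. s < \<tau> \<omega>} \<in> sets (F s)"
begin

section \<open>Rounding a stopping time up to a grid\<close>

definition mesh :: "nat \<Rightarrow> real" where "mesh n = T / real (Suc n)"

text \<open>Rounding upwards makes k < \<open>grid_index n\<close> equivalent to k mesh < \<tau>, an
  event known at time k mesh.\<close>

definition grid_index :: "nat \<Rightarrow> 'a \<Rightarrow> nat" where "grid_index n \<omega> = nat \<lceil>\<tau> \<omega> / mesh n\<rceil>"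

definition grid_time :: "nat \<Rightarrow> 'a \<Rightarrow> real" where "grid_time n \<omega> = real (grid_index n \<omega>) * mesh n"

definition alive :: "nat \<Rightarrow> nat \<Rightarrow> 'a \<Rightarrow> real" where
  "alive n k \<omega> = indicator {\<omega> \<in> space M. real k * mesh n < \<tau> \<omega>} \<omega>"

lemma mesh_pos: "mesh n > 0"
  using T_pos by (simp add: mesh_def)

lemma mesh_nonneg: "mesh n \<ge> 0"
  using mesh_pos[of n] by simp

lemma grid_index_le: "\<omega> \<in> space M \<Longrightarrow> grid_index n \<omega> \<le> Suc n"
proof -
  assume "\<omega> \<in> space M"
  then have "\<tau> \<omega> / mesh n \<le> T / mesh n"
    using \<tau>_range mesh_nonneg[of n] by (intro divide_right_mono) auto
  also have "\<dots> = real (Suc n)" using T_pos by (simp add: mesh_def)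
  finally have "\<lceil>\<tau> \<omega> / mesh n\<rceil> \<le> int (Suc n)" by (simp add: ceiling_le_iff)
  then show ?thesis unfolding grid_index_def by linarith
qed

lemma less_grid_index_iff: "k < grid_index n \<omega> \<longleftrightarrow> real k * mesh n < \<tau> \<omega>"
  using mesh_pos[of n] by (simp add: grid_index_def zless_nat_eq_int_zless less_ceiling_iff pos_less_divide_eq)

lemma grid_time_bounds:
  assumes "\<omega> \<in> space M"
  shows "\<tau> \<omega> \<le> grid_time n \<omega>" "grid_time n \<omega> \<le> T" "grid_time n \<omega> \<le> \<tau> \<omega> + mesh n" "0 \<le> grid_time n \<omega>"
proof -
  define y where "y = \<tau> \<omega> / mesh n"
  have y: "y \<ge> 0" "\<tau> \<omega> = y * mesh n"
    using \<tau>_range[OF assms] mesh_pos[of n] by (auto simp: y_def)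
  have r: "real (grid_index n \<omega>) = real_of_int \<lceil>y\<rceil>"
    using y(1) by (simp add: grid_index_def y_def[symmetric])
  have "y \<le> real (grid_index n \<omega>)" "real (grid_index n \<omega>) \<le> y + 1"
    unfolding r using ceiling_correct[of y] by linarith+
  then have "y * mesh n \<le> grid_time n \<omega>" "grid_time n \<omega> \<le> (y + 1) * mesh n"
    unfolding grid_time_def by (auto intro!: mult_right_mono mesh_nonneg)
  then show "\<tau> \<omega> \<le> grid_time n \<omega>" "grid_time n \<omega> \<le> \<tau> \<omega> + mesh n"
    using y(2) by (auto simp: algebra_simps)
  have "grid_time n \<omega> \<le> real (Suc n) * mesh n"
    unfolding grid_time_def using grid_index_le[OF assms, of n] mesh_nonneg[of n]
    by (intro mult_right_mono) auto
  then show "grid_time n \<omega> \<le> T" by (simp add: mesh_def)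
  show "0 \<le> grid_time n \<omega>" using mesh_nonneg[of n] by (simp add: grid_time_def)
qed

lemma grid_time_tendsto:
  assumes "\<omega> \<in> space M"
  shows "(\<lambda>n. grid_time n \<omega>) \<longlonglongrightarrow> \<tau> \<omega>"
proof (rule tendsto_sandwich[OF _ _ tendsto_const])
  have "mesh \<longlonglongrightarrow> 0"
    unfolding mesh_def[abs_def] using lim_const_over_n[of T, THEN LIMSEQ_Suc] by simp
  from tendsto_add[OF tendsto_const this] show "(\<lambda>n. \<tau> \<omega> + mesh n) \<longlonglongrightarrow> \<tau> \<omega>" by simp
qed (use grid_time_bounds[OF assms] in auto)

lemma alive_measurable: "alive n k \<in> borel_measurable (F (real k * mesh n))"
  unfolding alive_def[abs_def]
  by (rule borel_measurable_indicator[OF \<tau>_stopping]) (simp add: mesh_nonneg)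

lemma alive_measurable_P: "alive n k \<in> borel_measurable (P x)"
  by (rule measurable_F_P[OF alive_measurable]) (simp add: mesh_nonneg)

lemma alive_cases: "alive n k \<omega> = 0 \<or> alive n k \<omega> = 1"
  by (simp add: alive_def indicator_def)

text \<open>Any path, read off at the rounded time, is its initial value plus its gated grid
  increments. \<open>Suc n\<close> steps suffice because they reach T. It is applied to B, to the
  identity path and to the Tanaka martingale.\<close>

lemma grid_telescope:
  fixes Z :: "real \<Rightarrow> real"
  assumes "\<omega> \<in> space M"
  shows "Z (grid_time n \<omega>) - Z 0 =
    (\<Sum>k<Suc n. alive n k \<omega> * (Z (real (Suc k) * mesh n) - Z (real k * mesh n)))"
proof -
  have alive: "alive n k \<omega> = (if k < grid_index n \<omega> then 1 else 0)" for k
    by (simp add: alive_def less_grid_index_iff assms)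
  have "(\<Sum>k<Suc n. alive n k \<omega> * (Z (real (Suc k) * mesh n) - Z (real k * mesh n))) =
      (\<Sum>k<grid_index n \<omega>. alive n k \<omega> * (Z (real (Suc k) * mesh n) - Z (real k * mesh n)))"
    using grid_index_le[OF assms, of n]
    by (intro sum.mono_neutral_right) (auto simp: alive)
  also have "\<dots> = (\<Sum>k<grid_index n \<omega>. Z (real (Suc k) * mesh n) - Z (real k * mesh n))"
    by (intro sum.cong) (auto simp: alive)
  also have "\<dots> = Z (grid_time n \<omega>) - Z 0"
    using sum_lessThan_telescope[of "\<lambda>k. Z (real k * mesh n)" "grid_index n \<omega>"] by (simp add: grid_time_def)
  finally show ?thesis ..
qed

text \<open>The telescoping sum expresses evaluation at a random time through finitely many fixed
  times, so no joint measurability of Z enters.\<close>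

lemma grid_stopped_measurable:
  assumes "\<And>s. 0 \<le> s \<Longrightarrow> Z s \<in> borel_measurable (P x)"
  shows "(\<lambda>\<omega>. Z (grid_time n \<omega>) \<omega> :: real) \<in> borel_measurable (P x)"
proof -
  have "(\<lambda>\<omega>. Z 0 \<omega> + (\<Sum>k<Suc n. alive n k \<omega> * (Z (real (Suc k) * mesh n) \<omega> - Z (real k * mesh n) \<omega>)))
      \<in> borel_measurable (P x)"
    using mesh_nonneg[of n]
    by (intro borel_measurable_add borel_measurable_sum borel_measurable_times borel_measurable_diff assms
        alive_measurable_P) auto
  then show ?thesis
    by (rule measurable_cong[THEN iffD1, rotated])
      (use grid_telescope[of _ "\<lambda>s. Z s _"] in \<open>simp add: space_P algebra_simps\<close>)
qed

lemma grid_stopped_tendsto: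
  assumes "\<omega> \<in> space M" "continuous_on {0..} Z"
  shows "(\<lambda>n. Z (grid_time n \<omega>) :: real) \<longlonglongrightarrow> Z (\<tau> \<omega>)"
  by (rule continuous_on_tendsto_compose[OF assms(2) grid_time_tendsto[OF assms(1)]])
    (use \<tau>_range grid_time_bounds assms(1) in auto)

lemma stopped_measurable:
  assumes "\<And>s. 0 \<le> s \<Longrightarrow> Z s \<in> borel_measurable (P x)"
    and "\<And>\<omega>. \<omega> \<in> space M \<Longrightarrow> continuous_on {0..} (\<lambda>s. Z s \<omega>)"
  shows "(\<lambda>\<omega>. Z (\<tau> \<omega>) \<omega> :: real) \<in> borel_measurable (P x)"
  by (rule borel_measurable_LIMSEQ_real[where u="\<lambda>n \<omega>. Z (grid_time n \<omega>) \<omega>", OF _ grid_stopped_measurable[OF assms(1)]])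
    (use grid_stopped_tendsto assms(2) in \<open>auto simp: space_P\<close>)

lemma \<tau>_measurable: "\<tau> \<in> borel_measurable (P x)"
  using stopped_measurable[of "\<lambda>s \<omega>. s" x] by (simp add: continuous_intros)

lemma \<tau>_integrable: "integrable (P x) \<tau>"
proof -
  interpret prob_space "P x" by (rule prob_space_P)
  show ?thesis
    by (rule integrable_const_bound[where B=T]) (use \<tau>_range \<tau>_measurable in \<open>auto simp: space_P intro!: AE_I2\<close>)
qed

text \<open>The gates are those of \<open>gated_increments_moments\<close>; the second moment
  becomes the mean of the rounded time because telescoping the identity path gives
  \<open>grid_time\<close> as mesh times the sum of the gates.\<close>

lemma grid_B_moments:
  defines "X \<equiv> \<lambda>n \<omega>. B (grid_time n \<omega>) \<omega> - B 0 \<omega>"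
  shows "integrable (P x) (\<lambda>\<omega>. X n \<omega> ^ j)" "(LINT \<omega>|P x. X n \<omega>) = 0"
    "(LINT \<omega>|P x. (X n \<omega>)\<^sup>2) = (LINT \<omega>|P x. grid_time n \<omega>)" "(LINT \<omega>|P x. (X n \<omega>) ^ 4) \<le> 3 * T\<^sup>2"
proof -
  interpret prob_space "P x" by (rule prob_space_P)
  note m = gated_increments_moments[OF mesh_nonneg alive_measurable alive_cases, of n "Suc n" x]
  have X: "X n \<omega> = (\<Sum>k<Suc n. alive n k \<omega> * (B (real (Suc k) * mesh n) \<omega> - B (real k * mesh n) \<omega>))"
    if "\<omega> \<in> space (P x)" for \<omega>
    unfolding X_def using that by (intro grid_telescope) (simp add: space_P)
  have "integrable (P x) (\<lambda>\<omega>. (\<Sum>k<Suc n. alive n k \<omega> * (B (real (Suc k) * mesh n) \<omega> - B (real k * mesh n) \<omega>)) ^ j)"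
    using m by (simp only:)
  then show "integrable (P x) (\<lambda>\<omega>. X n \<omega> ^ j)"
    by (rule Bochner_Integration.integrable_cong[THEN iffD1, rotated -1]) (auto simp only: X)
  have c: "(LINT \<omega>|P x. (X n \<omega>) ^ j) =
      (LINT \<omega>|P x. (\<Sum>k<Suc n. alive n k \<omega> * (B (real (Suc k) * mesh n) \<omega> - B (real k * mesh n) \<omega>)) ^ j)" for j
    by (rule Bochner_Integration.integral_cong) (auto simp only: X)
  show "expectation (X n) = 0" using m c[of 1] by simp
  have ai: "integrable (P x) (alive n k)" for k
    by (rule integrable_const_bound[where B=1])
      (use alive_cases[of n k] alive_measurable_P in \<open>auto intro!: AE_I2 simp: alive_def indicator_def\<close>)
  have "expectation (\<lambda>\<omega>. grid_time n \<omega>) = expectation (\<lambda>\<omega>. \<Sum>k<Suc n. alive n k \<omega> * mesh n)"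
  proof (rule Bochner_Integration.integral_cong)
    fix \<omega> assume "\<omega> \<in> space (P x)"
    then show "grid_time n \<omega> = (\<Sum>k<Suc n. alive n k \<omega> * mesh n)"
      using grid_telescope[of \<omega> "\<lambda>s. s" n] by (simp add: space_P algebra_simps)
  qed simp
  also have "\<dots> = mesh n * (\<Sum>k<Suc n. expectation (alive n k))"
    using ai by (simp add: sum_distrib_left mult.commute distrib_left)
  finally show "expectation (\<lambda>\<omega>. (X n \<omega>)\<^sup>2) = expectation (\<lambda>\<omega>. grid_time n \<omega>)"
    unfolding c using m by simp
  have "real (Suc n) * mesh n = T" by (simp add: mesh_def)
  then show "expectation (\<lambda>\<omega>. (X n \<omega>) ^ 4) \<le> 3 * T\<^sup>2"
    unfolding c using m by (simp only:)
qed

lemma grid_time_measurable: "grid_time n \<in> borel_measurable (P x)"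
  using grid_stopped_measurable[of "\<lambda>s \<omega>. s" x n] by simp

lemma grid_B_measurable: "(\<lambda>\<omega>. B (grid_time n \<omega>) \<omega>) \<in> borel_measurable (P x)"
  by (rule grid_stopped_measurable[OF measurable_B_P])

lemma stopped_B_measurable: "(\<lambda>\<omega>. B (\<tau> \<omega>) \<omega>) \<in> borel_measurable (P x)"
  by (rule stopped_measurable[OF measurable_B_P continuous_B])

lemma expectation_grid_time:
  "(LINT \<omega>|P x. grid_time n \<omega>) \<le> T" "(\<lambda>n. LINT \<omega>|P x. grid_time n \<omega>) \<longlonglongrightarrow> (LINT \<omega>|P x. \<tau> \<omega>)"
proof -
  interpret prob_space "P x" by (rule prob_space_P)
  have bound: "norm (grid_time n \<omega>) \<le> T" if "\<omega> \<in> space (P x)" for n \<omega>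
    using that by (simp add: space_P grid_time_bounds(2,4) abs_of_nonneg)
  have int: "integrable (P x) (grid_time n)"
    by (rule integrable_const_bound[OF AE_I2[OF bound] grid_time_measurable])
  have "expectation (\<lambda>\<omega>. grid_time n \<omega>) \<le> expectation (\<lambda>_. T)"
    by (rule integral_mono[OF int]) (simp_all add: space_P grid_time_bounds(2))
  then show "expectation (\<lambda>\<omega>. grid_time n \<omega>) \<le> T"
    using prob_space by simp
  show "(\<lambda>n. expectation (\<lambda>\<omega>. grid_time n \<omega>)) \<longlonglongrightarrow> expectation (\<lambda>\<omega>. \<tau> \<omega>)"
  proof (rule integral_dominated_convergence[where w="\<lambda>_. T"])
    show "AE \<omega> in P x. (\<lambda>n. grid_time n \<omega>) \<longlonglongrightarrow> \<tau> \<omega>"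
      by (intro AE_I2 grid_time_tendsto) (simp add: space_P)
    show "AE \<omega> in P x. norm (grid_time n \<omega>) \<le> T" for n
      by (rule AE_I2[OF bound])
  qed (auto intro: grid_time_measurable \<tau>_measurable)
qed

text \<open>Limit along the grids. The uniform second moment carries the mean to the limit, and the
  uniform fourth moment, read as an L2 bound on the squares, carries the second moment and bounds
  the limiting fourth moment.\<close>

lemma stopped_B_moments:
  shows "integrable (P x) (\<lambda>\<omega>. (B (\<tau> \<omega>) \<omega> - B 0 \<omega>)\<^sup>2)" "integrable (P x) (\<lambda>\<omega>. (B (\<tau> \<omega>) \<omega> - B 0 \<omega>) ^ 4)"
    and "(LINT \<omega>|P x. B (\<tau> \<omega>) \<omega> - B 0 \<omega>) = 0"
    and "(LINT \<omega>|P x. (B (\<tau> \<omega>) \<omega> - B 0 \<omega>)\<^sup>2) = (LINT \<omega>|P x. \<tau> \<omega>)"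
    and "(LINT \<omega>|P x. (B (\<tau> \<omega>) \<omega> - B 0 \<omega>) ^ 4) \<le> 3 * T\<^sup>2"
proof -
  interpret prob_space "P x" by (rule prob_space_P)
  let ?X = "\<lambda>n \<omega>. B (grid_time n \<omega>) \<omega> - B 0 \<omega>"
  have lim: "(\<lambda>n. ?X n \<omega>) \<longlonglongrightarrow> B (\<tau> \<omega>) \<omega> - B 0 \<omega>" if "\<omega> \<in> space (P x)" for \<omega>
    using that
    by (intro tendsto_diff tendsto_const grid_stopped_tendsto[where Z="\<lambda>s. B s \<omega>"] continuous_B) (simp_all add: space_P)
  have m: "?X n \<in> borel_measurable (P x)" for n
    using grid_B_measurable measurable_B_P by auto
  have b2: "expectation (\<lambda>\<omega>. (?X n \<omega>)\<^sup>2) \<le> T" for n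
    unfolding grid_B_moments(3) by (rule expectation_grid_time)
  note A = L2_bounded_limit[where X="?X", OF m lim grid_B_moments(1) b2]
  have p4: "((?X n \<omega>)\<^sup>2)\<^sup>2 = ?X n \<omega> ^ 4" for n \<omega> by simp
  have b4: "expectation (\<lambda>\<omega>. ((?X n \<omega>)\<^sup>2)\<^sup>2) \<le> 3 * T\<^sup>2" for n
    unfolding p4 by (rule grid_B_moments)
  have i4: "integrable (P x) (\<lambda>\<omega>. ((?X n \<omega>)\<^sup>2)\<^sup>2)" for n
    unfolding p4 by (rule grid_B_moments)
  have m2: "(\<lambda>\<omega>. (?X n \<omega>)\<^sup>2) \<in> borel_measurable (P x)" for n
    using m by simp
  note A4 = L2_bounded_limit[where X="\<lambda>n \<omega>. (?X n \<omega>)\<^sup>2", OF m2 tendsto_power[OF lim] i4 b4]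
  have p: "((B (\<tau> \<omega>) \<omega> - B 0 \<omega>)\<^sup>2)\<^sup>2 = (B (\<tau> \<omega>) \<omega> - B 0 \<omega>) ^ 4" for \<omega> by simp
  show "integrable (P x) (\<lambda>\<omega>. (B (\<tau> \<omega>) \<omega> - B 0 \<omega>)\<^sup>2)" by (rule A(1))
  show "integrable (P x) (\<lambda>\<omega>. (B (\<tau> \<omega>) \<omega> - B 0 \<omega>) ^ 4)" by (rule A4(1)[unfolded p])
  show "expectation (\<lambda>\<omega>. (B (\<tau> \<omega>) \<omega> - B 0 \<omega>) ^ 4) \<le> 3 * T\<^sup>2" by (rule A4(2)[unfolded p])
  show "expectation (\<lambda>\<omega>. B (\<tau> \<omega>) \<omega> - B 0 \<omega>) = 0"
    using A(3) unfolding grid_B_moments(2) by (simp add: LIMSEQ_const_iff)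
  show "expectation (\<lambda>\<omega>. (B (\<tau> \<omega>) \<omega> - B 0 \<omega>)\<^sup>2) = expectation \<tau>"
    using A4(3) expectation_grid_time(2)[of x] unfolding grid_B_moments(3) by (rule LIMSEQ_unique)
qed

end

section \<open>The local time at a bounded stopping time\<close>

lemma (in brownian_local_time) L_bounds:
  "\<omega> \<in> space M \<Longrightarrow> 0 \<le> s \<Longrightarrow> s \<le> t \<Longrightarrow> 0 \<le> L s \<omega> \<and> L s \<omega> \<le> L t \<omega>"
  using mono_onD[OF mono_L, of \<omega> 0 s] mono_onD[OF mono_L, of \<omega> s t] start_L[of \<omega>] by simp

locale stopped_local_time =
  brownian_local_time M P F B \<theta> L + bounded_stopping_time M P F B \<theta> \<tau> T
  for M :: "'a measure" and P F and B :: "real \<Rightarrow> 'a \<Rightarrow> real" and \<theta> L \<tau> T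
begin

lemma measurable_L_P: "0 \<le> s \<Longrightarrow> L s \<in> borel_measurable (P x)"
  by (rule measurable_F_P[OF adapted_L])

lemma stopped_L_measurable: "(\<lambda>\<omega>. L (\<tau> \<omega>) \<omega>) \<in> borel_measurable (P x)"
  by (rule stopped_measurable[OF measurable_L_P continuous_L])

text \<open>By Tanaka's formula |B_t| - |B_0| - L_t is an Ito integral at each fixed t, hence its
  gated grid increments have mean zero. The two parts then pass to the limit separately: L by
  domination with \<open>L T\<close>, and |B| by its L2 bound.\<close>

lemma tanaka_stopped:
  shows "integrable (P x) (\<lambda>\<omega>. L (\<tau> \<omega>) \<omega>)"
    and "(LINT \<omega>|P x. L (\<tau> \<omega>) \<omega>) = (LINT \<omega>|P x. \<bar>B (\<tau> \<omega>) \<omega>\<bar> - \<bar>B 0 \<omega>\<bar>)"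
proof -
  interpret prob_space "P x" by (rule prob_space_P)
  have T: "0 \<le> T" using T_pos by simp
  have B0: "B 0 \<in> borel_measurable (P x)" and BT: "B T \<in> borel_measurable (P x)"
    using measurable_B_P T by auto
  \<comment> \<open>\<open>L T\<close> is the difference of two square integrable variables, the
    increment of |B| and the Ito integral.\<close>
  have LT: "integrable (P x) (L T)"
  proof -
    have "integrable (P x) (\<lambda>\<omega>. (B T \<omega> - B 0 \<omega>)\<^sup>2)"
      using increment_moments(1)[of 0 T x 2] T by simp
    then have "integrable (P x) (\<lambda>\<omega>. \<bar>B T \<omega>\<bar> - \<bar>B 0 \<omega>\<bar>)"
      by (rule square_integrable_imp_integrable[OF borel_measurable_diff[OF borel_measurable_abs[OF BT] borel_measurable_abs[OF B0]]
            abs_diff_square_integrable[OF _ BT B0]])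
    moreover have "integrable (P x) (\<lambda>\<omega>. \<bar>B T \<omega>\<bar> - \<bar>B 0 \<omega>\<bar> - L T \<omega>)"
      by (rule square_integrable_imp_integrable[OF borel_measurable_diff[OF borel_measurable_diff[OF
            borel_measurable_abs[OF BT] borel_measurable_abs[OF B0]] measurable_L_P[OF T]]
            ito_integral_square_integrable[OF tanaka[OF T] T]])
    ultimately have "integrable (P x) (\<lambda>\<omega>. (\<bar>B T \<omega>\<bar> - \<bar>B 0 \<omega>\<bar>) - (\<bar>B T \<omega>\<bar> - \<bar>B 0 \<omega>\<bar> - L T \<omega>))"
      by (rule Bochner_Integration.integrable_diff)
    then show ?thesis by simp
  qed
  have gL: "(\<lambda>\<omega>. L (grid_time n \<omega>) \<omega>) \<in> borel_measurable (P x)" for n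
    by (rule grid_stopped_measurable[OF measurable_L_P])
  have gL_bound: "\<bar>L (grid_time n \<omega>) \<omega>\<bar> \<le> \<bar>L T \<omega>\<bar>" if "\<omega> \<in> space (P x)" for n \<omega>
    using L_bounds[of \<omega> "grid_time n \<omega>" T] grid_time_bounds[of \<omega> n] that by (auto simp: space_P)
  have gLi: "integrable (P x) (\<lambda>\<omega>. L (grid_time n \<omega>) \<omega>)" for n
    by (rule Bochner_Integration.integrable_bound[OF LT gL]) (use gL_bound in \<open>auto intro!: AE_I2\<close>)
  have stopped_L_bound: "norm (L (\<tau> \<omega>) \<omega>) \<le> norm (L T \<omega>)" if "\<omega> \<in> space (P x)" for \<omega>
    using L_bounds[of \<omega> "\<tau> \<omega>" T] \<tau>_range[of \<omega>] that by (auto simp: space_P)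
  show "integrable (P x) (\<lambda>\<omega>. L (\<tau> \<omega>) \<omega>)"
    by (rule Bochner_Integration.integrable_bound[OF LT stopped_L_measurable AE_I2[OF stopped_L_bound]])
  have limL: "(\<lambda>n. expectation (\<lambda>\<omega>. L (grid_time n \<omega>) \<omega>)) \<longlonglongrightarrow> expectation (\<lambda>\<omega>. L (\<tau> \<omega>) \<omega>)"
  proof (rule integral_dominated_convergence[where w="\<lambda>\<omega>. \<bar>L T \<omega>\<bar>"])
    show "AE \<omega> in P x. (\<lambda>n. L (grid_time n \<omega>) \<omega>) \<longlonglongrightarrow> L (\<tau> \<omega>) \<omega>"
      by (intro AE_I2 grid_stopped_tendsto[where Z="\<lambda>s. L s _"] continuous_L) (simp_all add: space_P)
    show "AE \<omega> in P x. norm (L (grid_time n \<omega>) \<omega>) \<le> \<bar>L T \<omega>\<bar>" for n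
      using gL_bound by (intro AE_I2) simp
  qed (use gL LT stopped_L_measurable in simp_all)
  let ?A = "\<lambda>n \<omega>. \<bar>B (grid_time n \<omega>) \<omega>\<bar> - \<bar>B 0 \<omega>\<bar>"
  have Am: "?A n \<in> borel_measurable (P x)" for n
    by (rule borel_measurable_diff[OF borel_measurable_abs[OF grid_B_measurable] borel_measurable_abs[OF B0]])
  have A2: "integrable (P x) (\<lambda>\<omega>. (?A n \<omega>)\<^sup>2)" for n
    by (rule abs_diff_square_integrable[OF grid_B_moments(1) grid_B_measurable B0])
  have A2b: "expectation (\<lambda>\<omega>. (?A n \<omega>)\<^sup>2) \<le> T" for n
  proof -
    have "expectation (\<lambda>\<omega>. (?A n \<omega>)\<^sup>2) \<le> expectation (\<lambda>\<omega>. (B (grid_time n \<omega>) \<omega> - B 0 \<omega>)\<^sup>2)"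
      using A2 grid_B_moments(1)[of x n 2]
      by (intro integral_mono) (auto simp: abs_le_square_iff[symmetric])
    also have "\<dots> \<le> T" unfolding grid_B_moments(3) by (rule expectation_grid_time)
    finally show ?thesis .
  qed
  have limA: "(\<lambda>n. expectation (?A n)) \<longlonglongrightarrow> expectation (\<lambda>\<omega>. \<bar>B (\<tau> \<omega>) \<omega>\<bar> - \<bar>B 0 \<omega>\<bar>)"
  proof (rule L2_bounded_limit(3)[OF Am _ A2 A2b])
    fix \<omega> assume "\<omega> \<in> space (P x)"
    then have "(\<lambda>n. B (grid_time n \<omega>) \<omega>) \<longlonglongrightarrow> B (\<tau> \<omega>) \<omega>"
      by (intro grid_stopped_tendsto[where Z="\<lambda>s. B s \<omega>"] continuous_B) (simp_all add: space_P)
    then show "(\<lambda>n. ?A n \<omega>) \<longlonglongrightarrow> \<bar>B (\<tau> \<omega>) \<omega>\<bar> - \<bar>B 0 \<omega>\<bar>"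
      by (intro tendsto_intros)
  qed
  have "expectation (?A n) = expectation (\<lambda>\<omega>. L (grid_time n \<omega>) \<omega>)" for n
  proof -
    let ?W = "\<lambda>s \<omega>. \<bar>B s \<omega>\<bar> - \<bar>B 0 \<omega>\<bar> - L s \<omega>"
    have mart: "integrable (P x) (\<lambda>\<omega>. alive n k \<omega> * (?W (real (Suc k) * mesh n) \<omega> - ?W (real k * mesh n) \<omega>))"
      "expectation (\<lambda>\<omega>. alive n k \<omega> * (?W (real (Suc k) * mesh n) \<omega> - ?W (real k * mesh n) \<omega>)) = 0" for k
    proof -
      have st: "0 \<le> real k * mesh n" "real k * mesh n \<le> real (Suc k) * mesh n" "0 \<le> real (Suc k) * mesh n"
        using mesh_nonneg[of n] by (auto intro!: mult_right_mono)
      have "\<bar>alive n k \<omega>\<bar> \<le> 1" for \<omega> using alive_cases[of n k \<omega>] by auto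
      then show "integrable (P x) (\<lambda>\<omega>. alive n k \<omega> * (?W (real (Suc k) * mesh n) \<omega> - ?W (real k * mesh n) \<omega>))"
        "expectation (\<lambda>\<omega>. alive n k \<omega> * (?W (real (Suc k) * mesh n) \<omega> - ?W (real k * mesh n) \<omega>)) = 0"
        by (rule ito_integral_martingale[OF tanaka[OF st(3)] tanaka[OF st(1)] st(1,2) alive_measurable, of 1]; simp)+
    qed
    have "expectation (\<lambda>\<omega>. ?A n \<omega> - L (grid_time n \<omega>) \<omega>) =
      expectation (\<lambda>\<omega>. \<Sum>k<Suc n. alive n k \<omega> * (?W (real (Suc k) * mesh n) \<omega> - ?W (real k * mesh n) \<omega>))"
    proof (rule Bochner_Integration.integral_cong)
      fix \<omega> assume "\<omega> \<in> space (P x)"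
      then have "?A n \<omega> - L (grid_time n \<omega>) \<omega> = ?W (grid_time n \<omega>) \<omega> - ?W 0 \<omega>"
        using start_L[of \<omega>] by (simp add: space_P)
      also have "\<dots> = (\<Sum>k<Suc n. alive n k \<omega> * (?W (real (Suc k) * mesh n) \<omega> - ?W (real k * mesh n) \<omega>))"
        using \<open>\<omega> \<in> space (P x)\<close> by (intro grid_telescope) (simp add: space_P)
      finally show "?A n \<omega> - L (grid_time n \<omega>) \<omega> =
        (\<Sum>k<Suc n. alive n k \<omega> * (?W (real (Suc k) * mesh n) \<omega> - ?W (real k * mesh n) \<omega>))" .
    qed simp
    also have "\<dots> = 0"
      by (subst Bochner_Integration.integral_sum[OF mart(1)]) (simp only: mart(2) sum.neutral_const)
    finally show ?thesis
      using square_integrable_imp_integrable[OF Am A2] gLi by simp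
  qed
  then show "expectation (\<lambda>\<omega>. L (\<tau> \<omega>) \<omega>) = expectation (\<lambda>\<omega>. \<bar>B (\<tau> \<omega>) \<omega>\<bar> - \<bar>B 0 \<omega>\<bar>)"
    using LIMSEQ_unique[OF limL] limA by simp
qed

end

section \<open>The sticky clock and the semigroup\<close>

text \<open>From exp(-u) \<le> 1 / (1 + u) \<le> 1 - u + u^2 and exp(-u) \<ge> 1 - u; it holds for
  all u \<ge> 0, not just small ones.\<close>

lemma exp_minus_quadratic_bound:
  fixes u :: real
  assumes "0 \<le> u"
  shows "\<bar>exp (-u) - 1 + u\<bar> \<le> u\<^sup>2"
proof -
  have "exp (-u) * (1 + u) \<le> exp (-u) * exp u"
    using exp_ge_add_one_self[of u] by (intro mult_left_mono) auto
  also have "\<dots> = 1" by (simp add: exp_minus_inverse mult.commute)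
  also have "1 \<le> 1 + u ^ 3" using assms by simp
  also have "\<dots> = (1 - u + u\<^sup>2) * (1 + u)"
    by (simp add: power2_eq_square power3_eq_cube algebra_simps)
  finally have "exp (-u) \<le> 1 - u + u\<^sup>2"
    using assms by (simp add: mult_le_cancel_right)
  moreover have "exp (-u) \<ge> 1 - u" using exp_ge_add_one_self[of "-u"] by simp
  ultimately show ?thesis by linarith
qed

section \<open>The exponential killing law\<close>

lemma distributed_exponential_density_id:
  assumes "0 < \<beta>"
  shows "distributed (density lborel (exponential_density \<beta>)) lborel (\<lambda>s. s) (exponential_density \<beta>)"
  using assms by (simp add: distributed_def distr_id2 exponential_density_nonneg)

lemma measure_exponential_greaterThan:
  assumes "0 < \<beta>" "0 \<le> l"
  shows "measure (density lborel (exponential_density \<beta>)) {l<..} = exp (- \<beta> * l)"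
  using prob_space.exponential_distributedD_gt[OF prob_space_exponential_density[OF assms(1)]
      distributed_exponential_density_id[OF assms(1)] assms(2,1)]
  by (simp add: greaterThan_def mult.commute)

lemma prob_space_exponential_law:
  assumes "0 < \<beta>"
  shows "prob_space (exponential_law \<beta>)"
  unfolding exponential_law_def
proof (rule prob_space_restrict_space)
  interpret prob_space "density lborel (exponential_density \<beta>)"
    by (rule prob_space_exponential_density[OF assms])
  have "1 \<le> prob {0..}"
    using measure_exponential_greaterThan[OF assms, of 0] finite_measure_mono[of "{0<..}" "{0..}"]
    by (simp add: Ioi_le_Ico)
  then show "emeasure (density lborel (exponential_density \<beta>)) {0..} = 1"
    using prob_le_1[of "{0..}"] by (simp add: emeasure_eq_measure)
qed simp

lemma exponential_law_greaterThan:
  assumes "0 < \<beta>" "0 \<le> l"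
  shows "measure (exponential_law \<beta>) ({l<..} \<inter> space (exponential_law \<beta>)) = exp (- \<beta> * l)"
proof -
  have "{l<..} \<inter> space (exponential_law \<beta>) = {l<..}"
    using assms by (auto simp: exponential_law_def space_restrict_space)
  then show ?thesis
    using measure_exponential_greaterThan[OF assms] assms
    by (simp add: exponential_law_def measure_restrict_space subset_eq)
qed

lemma AE_exponential_law_neq: "AE s in exponential_law \<beta>. s \<noteq> l"
proof -
  have "AE s in lborel. s \<noteq> l" by (rule AE_lborel_singleton)
  then have "AE s in density lborel (exponential_density \<beta>). s \<noteq> l"
    by (auto simp: AE_density elim: eventually_mono)
  then show ?thesis
    unfolding exponential_law_def by (subst AE_restrict_space_iff) (auto elim: eventually_mono)
qed

section \<open>Pathwise properties of the clock and of the lifetime\<close>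

context brownian_local_time
begin

context
  fixes \<gamma> :: real
  assumes \<gamma>: "0 < \<gamma>"
begin

lemma sticky_clock_strict:
  assumes "\<omega> \<in> space M" "0 \<le> s" "s < u"
  shows "s + \<gamma> * L s \<omega> < u + \<gamma> * L u \<omega>"
proof -
  have "\<gamma> * L s \<omega> \<le> \<gamma> * L u \<omega>"
    using L_bounds[of \<omega> s u] assms \<gamma> by (intro mult_left_mono) auto
  then show ?thesis using assms by linarith
qed

text \<open>The intermediate value theorem on [0, t] shows that t is attained by s + \<gamma> L_s,
  so \<open>inv_into\<close> returns a true preimage. The two bounds follow because both summands
  are nonnegative.\<close>

lemma sticky_clock:
  assumes \<omega>: "\<omega> \<in> space M" and t: "0 \<le> t"
  shows "0 \<le> sticky_clock L \<gamma> t \<omega>" "sticky_clock L \<gamma> t \<omega> + \<gamma> * sticky_local_time L \<gamma> t \<omega> = t"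
    "0 \<le> sticky_local_time L \<gamma> t \<omega>" "sticky_clock L \<gamma> t \<omega> \<le> t" "sticky_local_time L \<gamma> t \<omega> \<le> t / \<gamma>"
proof -
  have "continuous_on {0..t} (\<lambda>s. s + \<gamma> * L s \<omega>)"
    by (intro continuous_intros continuous_on_subset[OF continuous_L[OF \<omega>]]) auto
  moreover have "0 \<le> L t \<omega>" using L_bounds[OF \<omega> t] by blast
  ultimately obtain s where "0 \<le> s" "s \<le> t" "s + \<gamma> * L s \<omega> = t"
    using IVT'[of "\<lambda>s. s + \<gamma> * L s \<omega>" 0 t t] start_L[OF \<omega>] t \<gamma> by auto
  then have "t \<in> (\<lambda>s. s + \<gamma> * L s \<omega>) ` {0..}" by (intro image_eqI[of _ _ s]) auto
  from inv_into_into[OF this] f_inv_into_f[OF this]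
  show 1: "0 \<le> sticky_clock L \<gamma> t \<omega>"
    and 2: "sticky_clock L \<gamma> t \<omega> + \<gamma> * sticky_local_time L \<gamma> t \<omega> = t"
    unfolding sticky_local_time_def sticky_clock_def by auto
  show 3: "0 \<le> sticky_local_time L \<gamma> t \<omega>"
    unfolding sticky_local_time_def using L_bounds[OF \<omega> 1] by blast
  then have "0 \<le> \<gamma> * sticky_local_time L \<gamma> t \<omega>" using \<gamma> by simp
  with 2 show "sticky_clock L \<gamma> t \<omega> \<le> t" by linarith
  have "\<gamma> * sticky_local_time L \<gamma> t \<omega> \<le> t" using 1 2 by linarith
  then show "sticky_local_time L \<gamma> t \<omega> \<le> t / \<gamma>"
    using \<gamma> by (simp add: field_simps)
qed

text \<open>Strict monotonicity of s + \<gamma> L_s. The right-hand side involves the local time at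
  s only, which makes the clock a stopping time.\<close>

lemma less_sticky_clock_iff:
  assumes \<omega>: "\<omega> \<in> space M" and t: "0 \<le> t" and s: "0 \<le> s"
  shows "s < sticky_clock L \<gamma> t \<omega> \<longleftrightarrow> s + \<gamma> * L s \<omega> < t"
proof -
  note c = sticky_clock(1,2)[OF \<omega> t, unfolded sticky_local_time_def]
  consider "s < sticky_clock L \<gamma> t \<omega>" | "s = sticky_clock L \<gamma> t \<omega>" | "sticky_clock L \<gamma> t \<omega> < s" by linarith
  then show ?thesis
    using sticky_clock_strict[OF \<omega> s, of "sticky_clock L \<gamma> t \<omega>"]
      sticky_clock_strict[OF \<omega> c(1), of s] c by cases auto
qed

lemma sticky_clock_mono:
  assumes \<omega>: "\<omega> \<in> space M" and "0 \<le> t" "t \<le> u"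
  shows "sticky_clock L \<gamma> t \<omega> \<le> sticky_clock L \<gamma> u \<omega>"
  using less_sticky_clock_iff[OF \<omega> assms(2), of "sticky_clock L \<gamma> u \<omega>"] sticky_clock(1,2)[OF \<omega>, of u] assms
  by (force simp: sticky_local_time_def not_less[symmetric])

lemma sticky_local_time_mono:
  assumes \<omega>: "\<omega> \<in> space M" and "0 \<le> t" "t \<le> u"
  shows "sticky_local_time L \<gamma> t \<omega> \<le> sticky_local_time L \<gamma> u \<omega>"
  unfolding sticky_local_time_def
  using L_bounds[OF \<omega> sticky_clock(1)[OF \<omega> assms(2)] sticky_clock_mono[OF assms]] by blast

text \<open>The clock and \<gamma> times the local time are both nondecreasing and add up to t, so
  neither can grow faster than t.\<close>

lemma sticky_local_time_lipschitz:
  assumes \<omega>: "\<omega> \<in> space M" and "0 \<le> t" "t \<le> u"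
  shows "\<gamma> * (sticky_local_time L \<gamma> u \<omega> - sticky_local_time L \<gamma> t \<omega>) \<le> u - t"
  using sticky_clock(2)[OF \<omega> assms(2)] sticky_clock(2)[OF \<omega>, of u] sticky_clock_mono[OF assms] assms
  by (simp add: algebra_simps)

lemma less_killing_time_imp:
  assumes "ereal t < killing_time L \<gamma> (\<omega>, s)" "0 \<le> t"
  shows "sticky_local_time L \<gamma> t \<omega> \<le> s"
proof (rule ccontr)
  assume "\<not> ?thesis"
  then have "killing_time L \<gamma> (\<omega>, s) \<le> ereal t"
    unfolding killing_time_def using assms(2) by (auto intro!: Inf_lower)
  with assms(1) show False by simp
qed

lemma less_killing_timeI:
  assumes \<omega>: "\<omega> \<in> space M" and "0 \<le> t" "t < q" "sticky_local_time L \<gamma> q \<omega> \<le> s"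
  shows "ereal t < killing_time L \<gamma> (\<omega>, s)"
proof -
  have "ereal q \<le> killing_time L \<gamma> (\<omega>, s)"
    unfolding killing_time_def case_prod_conv
  proof (rule Inf_greatest, elim imageE)
    fix y u assume u: "y = ereal u" "u \<in> {t. 0 \<le> t \<and> s < sticky_local_time L \<gamma> t \<omega>}"
    then have "\<not> u \<le> q" using sticky_local_time_mono[OF \<omega>, of u q] assms(4) by auto
    then show "ereal q \<le> y" using u by simp
  qed
  with assms(3) show ?thesis using less_le_trans[of "ereal t" "ereal q"] by simp
qed

lemma less_killing_time_if_less:
  assumes \<omega>: "\<omega> \<in> space M" and t: "0 \<le> t" and less: "sticky_local_time L \<gamma> t \<omega> < s"
  shows "ereal t < killing_time L \<gamma> (\<omega>, s)"
proof (rule less_killing_timeI[OF \<omega> t])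
  \<comment> \<open>To climb from its present value to s, the local time needs at least a time
    \<gamma> times the gap, by the Lipschitz bound; hence it has not exceeded s at
    \<open>?q\<close>.\<close>
  let ?q = "t + \<gamma> * (s - sticky_local_time L \<gamma> t \<omega>)"
  show q: "t < ?q" using less \<gamma> by simp
  have "\<gamma> * (sticky_local_time L \<gamma> ?q \<omega> - sticky_local_time L \<gamma> t \<omega>) \<le> \<gamma> * (s - sticky_local_time L \<gamma> t \<omega>)"
    using sticky_local_time_lipschitz[OF \<omega> t, of ?q] q by simp
  then show "sticky_local_time L \<gamma> ?q \<omega> \<le> s" using \<gamma> by (simp add: mult_le_cancel_left_pos)
qed

text \<open>Writes survival beyond t as a countable union of events at fixed times, which gives its
  joint measurability in the path and the exponential variable.\<close>

lemma less_killing_time_iff_rat: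
  assumes \<omega>: "\<omega> \<in> space M" and t: "0 \<le> t"
  shows "ereal t < killing_time L \<gamma> (\<omega>, s) \<longleftrightarrow> (\<exists>q\<in>{q\<in>\<rat>. t < q}. sticky_local_time L \<gamma> q \<omega> \<le> s)"
proof
  assume "ereal t < killing_time L \<gamma> (\<omega>, s)"
  then obtain r :: rat where r: "ereal t < ereal (real_of_rat r)" "ereal (real_of_rat r) < killing_time L \<gamma> (\<omega>, s)"
    using ereal_dense3 by blast
  then show "\<exists>q\<in>{q\<in>\<rat>. t < q}. sticky_local_time L \<gamma> q \<omega> \<le> s"
  proof (intro bexI[of _ "real_of_rat r"])
    have "t < real_of_rat r" using r(1) by simp
    then have "0 \<le> real_of_rat r" using t by linarith
    then show "sticky_local_time L \<gamma> (real_of_rat r) \<omega> \<le> s"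
      by (rule less_killing_time_imp[OF r(2)])
  qed (use r(1) in auto)
qed (use less_killing_timeI[OF \<omega> t] in auto)

lemma stopped_local_time_sticky_clock:
  assumes t: "0 < t"
  shows "stopped_local_time M P F B \<theta> L (sticky_clock L \<gamma> t) t"
proof unfold_locales
  show "0 < t" by fact
  show "0 \<le> sticky_clock L \<gamma> t \<omega> \<and> sticky_clock L \<gamma> t \<omega> \<le> t" if "\<omega> \<in> space M" for \<omega>
    using sticky_clock(1,4)[OF that, of t] t by simp
  show "{\<omega> \<in> space M. s < sticky_clock L \<gamma> t \<omega>} \<in> sets (F s)" if s: "0 \<le> s" for s
  proof -
    have "{\<omega> \<in> space M. s < sticky_clock L \<gamma> t \<omega>} = {\<omega> \<in> space (F s). s + \<gamma> * L s \<omega> < t}"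
      using less_sticky_clock_iff[OF _ less_imp_le[OF t] s] space_F[OF s] by blast
    also have "\<dots> \<in> sets (F s)"
      using adapted_L[OF s] by measurable
    finally show ?thesis .
  qed
qed

section \<open>Measurability and moments of the time-changed process\<close>

lemma sticky_local_time_measurable: "0 < t \<Longrightarrow> sticky_local_time L \<gamma> t \<in> borel_measurable (P x)"
  using stopped_local_time.stopped_L_measurable[OF stopped_local_time_sticky_clock]
  unfolding sticky_local_time_def by blast

lemma sticky_bm_measurable: "0 < t \<Longrightarrow> sticky_bm B L \<gamma> t \<in> borel_measurable (P x)"
  unfolding sticky_bm_def[abs_def]
  by (rule borel_measurable_abs[OF bounded_stopping_time.stopped_B_measurable[OF
      stopped_local_time.axioms(2)[OF stopped_local_time_sticky_clock]]])

lemma sticky_moments: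
  assumes x: "0 \<le> x" and t: "0 < t"
  defines "Y \<equiv> sticky_bm B L \<gamma> t" and "l \<equiv> LINT \<omega>|P x. sticky_local_time L \<gamma> t \<omega>"
  shows "integrable (P x) (\<lambda>\<omega>. Y \<omega> - x)" "(LINT \<omega>|P x. Y \<omega> - x) = l"
    and "integrable (P x) (\<lambda>\<omega>. (Y \<omega> - x)\<^sup>2)" "(LINT \<omega>|P x. (Y \<omega> - x)\<^sup>2) = t - \<gamma> * l - 2 * x * l"
    and "integrable (P x) (\<lambda>\<omega>. (Y \<omega> - x) ^ 4)" "(LINT \<omega>|P x. (Y \<omega> - x) ^ 4) \<le> 3 * t\<^sup>2"
    and "integrable (P x) (sticky_local_time L \<gamma> t)" "0 \<le> l" "l \<le> t / \<gamma>" "x ^ 3 * l \<le> 6 * t\<^sup>2"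
proof -
  interpret stopped_local_time M P F B \<theta> L "sticky_clock L \<gamma> t" t
    by (rule stopped_local_time_sticky_clock[OF t])
  interpret prob_space "P x" by (rule prob_space_P)
  define b where "b = (\<lambda>\<omega>. B (sticky_clock L \<gamma> t \<omega>) \<omega> - x)"
  have bm: "b \<in> borel_measurable (P x)"
    unfolding b_def using stopped_B_measurable by simp
  have Ym: "Y \<in> borel_measurable (P x)" unfolding Y_def by (rule sticky_bm_measurable[OF t])
  have Y: "Y \<omega> = \<bar>b \<omega> + x\<bar>" for \<omega> by (simp add: Y_def b_def sticky_bm_def)
  \<comment> \<open>Optional stopping speaks of the displacement from \<open>B 0\<close>, which
    equals x almost surely only; \<open>b\<close> replaces it by the displacement from x.\<close>
  have ae: "AE \<omega> in P x. B (sticky_clock L \<gamma> t \<omega>) \<omega> - B 0 \<omega> = b \<omega>"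
    using AE_start by eventually_elim (simp add: b_def)
  have B0m: "B 0 \<in> borel_measurable (P x)" by (rule measurable_B_P) simp
  note Dm = borel_measurable_diff[OF stopped_B_measurable B0m]
  have b2i: "integrable (P x) (\<lambda>\<omega>. (b \<omega>)\<^sup>2)"
    by (rule integrable_cong_AE_imp[OF stopped_B_moments(1)[of x]])
      (use bm ae in \<open>auto elim!: eventually_mono\<close>)
  have b4i: "integrable (P x) (\<lambda>\<omega>. b \<omega> ^ 4)"
    by (rule integrable_cong_AE_imp[OF stopped_B_moments(2)[of x]])
      (use bm ae in \<open>auto elim!: eventually_mono\<close>)
  have bi: "integrable (P x) b"
    by (rule square_integrable_imp_integrable[OF bm b2i])
  have b1: "expectation b = 0"
  proof -
    have "expectation b = expectation (\<lambda>\<omega>. B (sticky_clock L \<gamma> t \<omega>) \<omega> - B 0 \<omega>)"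
      by (rule integral_cong_AE) (use bm Dm ae in \<open>auto elim!: eventually_mono\<close>)
    then show ?thesis using stopped_B_moments(3)[of x] by simp
  qed
  have b2: "expectation (\<lambda>\<omega>. (b \<omega>)\<^sup>2) = expectation (sticky_clock L \<gamma> t)"
    unfolding stopped_B_moments(4)[of x, symmetric]
    by (rule integral_cong_AE) (use bm Dm ae in \<open>auto elim!: eventually_mono\<close>)
  have b4: "expectation (\<lambda>\<omega>. b \<omega> ^ 4) \<le> 3 * t\<^sup>2"
  proof -
    have "expectation (\<lambda>\<omega>. b \<omega> ^ 4) = expectation (\<lambda>\<omega>. (B (sticky_clock L \<gamma> t \<omega>) \<omega> - B 0 \<omega>) ^ 4)"
      by (rule integral_cong_AE) (use bm Dm ae in \<open>auto elim!: eventually_mono\<close>)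
    then show ?thesis using stopped_B_moments(5)[of x] by simp
  qed
  show li: "integrable (P x) (sticky_local_time L \<gamma> t)"
    using tanaka_stopped(1) unfolding sticky_local_time_def .
  have "AE \<omega> in P x. norm (Y \<omega> - x) \<le> norm (b \<omega>)"
    using x by (intro AE_I2) (auto simp: Y)
  then show Yi: "integrable (P x) (\<lambda>\<omega>. Y \<omega> - x)"
    using Ym by (intro Bochner_Integration.integrable_bound[OF bi]) auto
  have "l = expectation (\<lambda>\<omega>. \<bar>B (sticky_clock L \<gamma> t \<omega>) \<omega>\<bar> - \<bar>B 0 \<omega>\<bar>)"
    unfolding l_def sticky_local_time_def by (rule tanaka_stopped)
  also have "\<dots> = expectation (\<lambda>\<omega>. Y \<omega> - x)"
    by (rule integral_cong_AE)
      (use AE_start[of x] x Ym stopped_B_measurable B0m in \<open>auto elim!: eventually_mono simp: Y_def sticky_bm_def\<close>)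
  finally show Y1: "expectation (\<lambda>\<omega>. Y \<omega> - x) = l" ..
  \<comment> \<open>Reflection leaves the square of the position unchanged, which expresses the
    quadratic displacement of Y through b and the linear displacement of Y. Taking means produces
    the term -2 x l.\<close>
  have sq: "(Y \<omega> - x)\<^sup>2 = (b \<omega>)\<^sup>2 + 2 * x * b \<omega> - 2 * x * (Y \<omega> - x)" for \<omega>
  proof -
    have "(Y \<omega>)\<^sup>2 = (b \<omega> + x)\<^sup>2" by (simp add: Y)
    then show ?thesis by (simp add: power2_eq_square algebra_simps)
  qed
  show "integrable (P x) (\<lambda>\<omega>. (Y \<omega> - x)\<^sup>2)"
    unfolding sq using b2i integrable_mult_right[OF bi] integrable_mult_right[OF Yi]
    by (intro Bochner_Integration.integrable_diff Bochner_Integration.integrable_add)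
  have clock: "expectation (sticky_clock L \<gamma> t) = t - \<gamma> * l"
  proof -
    have "expectation (sticky_clock L \<gamma> t) = expectation (\<lambda>\<omega>. t - \<gamma> * sticky_local_time L \<gamma> t \<omega>)"
    proof (rule Bochner_Integration.integral_cong)
      fix \<omega> assume "\<omega> \<in> space (P x)"
      then show "sticky_clock L \<gamma> t \<omega> = t - \<gamma> * sticky_local_time L \<gamma> t \<omega>"
        using sticky_clock(2)[of \<omega> t] t by (simp add: space_P)
    qed simp
    also have "\<dots> = t - \<gamma> * l" using li prob_space by (simp add: l_def)
    finally show ?thesis .
  qed
  have "expectation (\<lambda>\<omega>. (Y \<omega> - x)\<^sup>2) =
      expectation (\<lambda>\<omega>. (b \<omega>)\<^sup>2) + 2 * x * expectation b - 2 * x * expectation (\<lambda>\<omega>. Y \<omega> - x)"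
  proof -
    have i: "integrable (P x) (\<lambda>\<omega>. 2 * x * b \<omega>)" "integrable (P x) (\<lambda>\<omega>. 2 * x * (Y \<omega> - x))"
      using bi Yi by (auto intro: integrable_mult_right)
    show ?thesis
      unfolding sq Bochner_Integration.integral_diff[OF Bochner_Integration.integrable_add[OF b2i i(1)] i(2)]
        Bochner_Integration.integral_add[OF b2i i(1)]
      by (simp only: integral_mult_right_zero)
  qed
  then show "expectation (\<lambda>\<omega>. (Y \<omega> - x)\<^sup>2) = t - \<gamma> * l - 2 * x * l"
    unfolding Y1 b1 b2 clock by simp
  have p4: "(Y \<omega> - x) ^ 4 \<le> b \<omega> ^ 4" for \<omega>
  proof -
    have "\<bar>Y \<omega> - x\<bar> ^ 4 \<le> \<bar>b \<omega>\<bar> ^ 4" using x by (intro power_mono) (auto simp: Y)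
    then show ?thesis by simp
  qed
  show Y4i: "integrable (P x) (\<lambda>\<omega>. (Y \<omega> - x) ^ 4)"
    by (rule Bochner_Integration.integrable_bound[OF b4i]) (use Ym p4 in \<open>auto intro!: AE_I2\<close>)
  have "expectation (\<lambda>\<omega>. (Y \<omega> - x) ^ 4) \<le> expectation (\<lambda>\<omega>. b \<omega> ^ 4)"
    by (rule integral_mono[OF Y4i b4i p4])
  with b4 show "expectation (\<lambda>\<omega>. (Y \<omega> - x) ^ 4) \<le> 3 * t\<^sup>2" by linarith
  have lb: "0 \<le> sticky_local_time L \<gamma> t \<omega>" "sticky_local_time L \<gamma> t \<omega> \<le> t / \<gamma>" if "\<omega> \<in> space (P x)" for \<omega>
    using sticky_clock(3,5)[of \<omega> t] that t by (simp_all add: space_P)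
  show "0 \<le> l" unfolding l_def by (rule integral_nonneg_AE) (intro AE_I2 lb)
  have "l \<le> expectation (\<lambda>_. t / \<gamma>)"
    unfolding l_def by (rule integral_mono[OF li _ lb(2)]) auto
  then show "l \<le> t / \<gamma>" using prob_space by simp
  \<comment> \<open>Y - x - b is twice the negative part of the stopped Brownian motion. It is
    nonzero only if -b > x, and then x^3 can be traded for (-b)^3. Together with the fourth moment 3
    t^2 this yields the constant 6.\<close>
  have p3: "x ^ 3 * (Y \<omega> - x - b \<omega>) \<le> 2 * b \<omega> ^ 4" for \<omega>
  proof (cases "b \<omega> + x \<ge> 0")
    case False
    then have xb: "x \<le> - b \<omega>" "- b \<omega> - x \<le> - b \<omega>" using x by auto
    have "x ^ 3 * (- b \<omega> - x) \<le> (- b \<omega>) ^ 3 * (- b \<omega>)"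
      using x False by (intro mult_mono power_mono xb) auto
    also have "\<dots> = b \<omega> ^ 4" by (simp add: power3_eq_cube power4_eq_xxxx)
    finally show ?thesis using False by (simp add: Y algebra_simps)
  qed (simp add: Y)
  have "x ^ 3 * l = expectation (\<lambda>\<omega>. x ^ 3 * (Y \<omega> - x - b \<omega>))"
    using Yi bi Y1 b1 by (simp add: Bochner_Integration.integral_diff[OF Yi bi])
  also have "\<dots> \<le> expectation (\<lambda>\<omega>. 2 * b \<omega> ^ 4)"
    by (rule integral_mono[OF integrable_mult_right[OF Bochner_Integration.integrable_diff[OF Yi bi]]
          integrable_mult_right[OF b4i] p3])
  also have "\<dots> \<le> 2 * (3 * t\<^sup>2)" using b4 by simp
  finally show "x ^ 3 * l \<le> 6 * t\<^sup>2" by simp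
qed

text \<open>Integrating out the exponential variable: the event \<open>t < \<zeta>\<close> differs from \<open>L\<^sup>s\<^sub>t < S\<close> only on the
  null event \<open>L\<^sup>s\<^sub>t = S\<close>.\<close>

lemma general_bm_semigroup_eq:
  assumes \<beta>: "0 < \<beta>" and t: "0 < t" and x: "0 \<le> x" and f: "f \<in> C0"
  shows "general_bm_semigroup P B L \<beta> \<gamma> t f x =
    (LINT \<omega>|P x. f (sticky_bm B L \<gamma> t \<omega>) * exp (- \<beta> * sticky_local_time L \<gamma> t \<omega>))"
proof -
  interpret prob_space "P x" by (rule prob_space_P)
  define E where "E = exponential_law \<beta>"
  interpret E: prob_space E unfolding E_def by (rule prob_space_exponential_law[OF \<beta>])
  interpret PE: pair_prob_space "P x" E ..
  have E_borel: "(\<lambda>s. s) \<in> borel_measurable E"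
    unfolding E_def exponential_law_def by (rule measurable_restrict_space1) simp
  have snd_meas[measurable]: "snd \<in> borel_measurable (P x \<Otimes>\<^sub>M E)"
    by (rule measurable_compose[OF measurable_snd E_borel])
  define Y where "Y = sticky_bm B L \<gamma> t"
  define l where "l = sticky_local_time L \<gamma> t"
  have Ym: "Y \<in> borel_measurable (P x)" unfolding Y_def by (rule sticky_bm_measurable[OF t])
  have lm: "l \<in> borel_measurable (P x)" unfolding l_def by (rule sticky_local_time_measurable[OF t])
  have Y0: "0 \<le> Y \<omega>" for \<omega> by (simp add: Y_def sticky_bm_def)
  \<comment> \<open>Elements of \<open>C0\<close> are \<open>undefined\<close> off [0, \<infinity>),
    so Borel measurability is obtained for the extension by the constant f 0, which agrees with f on
    the values of Y.\<close>
  have "(\<lambda>y. f (max 0 y)) \<in> borel_measurable borel"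
    using f by (intro borel_measurable_continuous_onI continuous_on_extend_constant) (simp add: C0_iff)
  from measurable_compose[OF Ym this] have fY: "(\<lambda>\<omega>. f (Y \<omega>)) \<in> borel_measurable (P x)"
    using Y0 by (simp add: max_absorb2)
  obtain K where K: "K > 0" "\<And>y. y \<ge> 0 \<Longrightarrow> \<bar>f y\<bar> \<le> K" using C0_bounded[OF f] by blast
  define A where "A = {w \<in> space (P x \<Otimes>\<^sub>M E). ereal t < killing_time L \<gamma> w}"
  have A: "A \<in> sets (P x \<Otimes>\<^sub>M E)"
  proof -
    have "A = (\<Union>q\<in>{q\<in>\<rat>. t < q}. {w \<in> space (P x \<Otimes>\<^sub>M E). sticky_local_time L \<gamma> q (fst w) \<le> snd w})"
      unfolding A_def using less_killing_time_iff_rat[of _ t] t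
      by (auto simp: space_pair_measure space_P)
    also have "\<dots> \<in> sets (P x \<Otimes>\<^sub>M E)"
    proof (rule sets.countable_UN')
      show "countable {q \<in> \<rat>. t < q}"
        by (rule countable_subset[OF _ countable_rat]) auto
      show "(\<lambda>q. {w \<in> space (P x \<Otimes>\<^sub>M E). sticky_local_time L \<gamma> q (fst w) \<le> snd w}) ` {q \<in> \<rat>. t < q}
          \<subseteq> sets (P x \<Otimes>\<^sub>M E)"
      proof (rule image_subsetI)
        fix q assume "q \<in> {q \<in> \<rat>. t < q}"
        then have "sticky_local_time L \<gamma> q \<in> borel_measurable (P x)"
          using t by (intro sticky_local_time_measurable) simp
        from measurable_compose[OF measurable_fst this]
        show "{w \<in> space (P x \<Otimes>\<^sub>M E). sticky_local_time L \<gamma> q (fst w) \<le> snd w} \<in> sets (P x \<Otimes>\<^sub>M E)"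
          using snd_meas by (rule borel_measurable_le)
      qed
    qed
    finally show ?thesis .
  qed
  let ?g = "\<lambda>w. f (Y (fst w)) * indicator A w :: real"
  have g_eq: "cemetery_extend f (general_bm B L \<gamma> t w) = ?g w" if "w \<in> space (P x \<Otimes>\<^sub>M E)" for w
    using that by (simp add: cemetery_extend_def general_bm_def A_def Y_def)
  have g_int: "integrable (P x \<Otimes>\<^sub>M E) ?g"
  proof (rule PE.integrable_const_bound[where B=K])
    show "AE w in P x \<Otimes>\<^sub>M E. norm (?g w) \<le> K"
      using K Y0 by (intro AE_I2) (auto simp: indicator_def less_imp_le)
    show "?g \<in> borel_measurable (P x \<Otimes>\<^sub>M E)"
      by (rule borel_measurable_times[OF measurable_compose[OF measurable_fst fY] borel_measurable_indicator[OF A]])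
  qed
  have inner: "(LINT s|E. ?g (\<omega>, s)) = f (Y \<omega>) * exp (- \<beta> * l \<omega>)" if \<omega>: "\<omega> \<in> space (P x)" for \<omega>
  proof -
    have \<omega>M: "\<omega> \<in> space M" using \<omega> by (simp add: space_P)
    have "(LINT s|E. indicator A (\<omega>, s) :: real) = (LINT s|E. indicator {l \<omega><..} s)"
    proof (rule integral_cong_AE)
      show "(\<lambda>s. indicator A (\<omega>, s) :: real) \<in> borel_measurable E"
        using measurable_compose[OF measurable_Pair1'[OF \<omega>] borel_measurable_indicator[OF A]] .
      show "(\<lambda>s. indicator {l \<omega><..} s :: real) \<in> borel_measurable E"
        using measurable_compose[OF E_borel borel_measurable_indicator[of "{l \<omega><..}" borel]] by simp
      have "AE s in E. s \<noteq> l \<omega>" unfolding E_def by (rule AE_exponential_law_neq)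
      then show "AE s in E. indicator A (\<omega>, s) = (indicator {l \<omega><..} s :: real)"
      proof (rule AE_mp[OF _ AE_I2], intro impI)
        fix s assume s: "s \<in> space E" "s \<noteq> l \<omega>"
        have "ereal t < killing_time L \<gamma> (\<omega>, s) \<longleftrightarrow> l \<omega> < s"
          using less_killing_time_imp[of t \<omega> s] less_killing_time_if_less[OF \<omega>M, of t s] t s(2)
          by (auto simp: l_def)
        then show "indicator A (\<omega>, s) = (indicator {l \<omega><..} s :: real)"
          using \<omega> s(1) by (simp add: A_def indicator_def space_pair_measure)
      qed
    qed
    also have "\<dots> = measure E ({l \<omega><..} \<inter> space E)"
      by (simp add: integral_indicator)
    also have "\<dots> = exp (- \<beta> * l \<omega>)"
      unfolding E_def using sticky_clock(3)[OF \<omega>M, of t] t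
      by (intro exponential_law_greaterThan[OF \<beta>]) (simp add: l_def)
    finally show ?thesis by simp
  qed
  have "general_bm_semigroup P B L \<beta> \<gamma> t f x = (LINT w|(P x \<Otimes>\<^sub>M E). ?g w)"
    unfolding general_bm_semigroup_def E_def[symmetric] using x
    by (simp add: g_eq cong: Bochner_Integration.integral_cong)
  also have "\<dots> = (LINT \<omega>|P x. LINT s|E. ?g (\<omega>, s))"
    using PE.integral_fst'[OF g_int] by simp
  also have "\<dots> = (LINT \<omega>|P x. f (Y \<omega>) * exp (- \<beta> * l \<omega>))"
    by (rule Bochner_Integration.integral_cong[OF refl inner])
  finally show ?thesis by (simp add: Y_def l_def)
qed

section \<open>Contraction, small-time expansion and identification of the generator\<close>

lemma discounted_integrable:
  assumes \<beta>: "0 < \<beta>" and t: "0 < t" and f: "f \<in> C0"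
  shows "integrable (P x) (\<lambda>\<omega>. f (sticky_bm B L \<gamma> t \<omega>) * exp (- \<beta> * sticky_local_time L \<gamma> t \<omega>))"
proof -
  interpret prob_space "P x" by (rule prob_space_P)
  obtain K where K: "K > 0" "\<And>y. y \<ge> 0 \<Longrightarrow> \<bar>f y\<bar> \<le> K" using C0_bounded[OF f] by blast
  have "(\<lambda>y. f (max 0 y)) \<in> borel_measurable borel"
    using f by (intro borel_measurable_continuous_onI continuous_on_extend_constant) (simp add: C0_iff)
  from measurable_compose[OF sticky_bm_measurable[OF t] this]
  have fY: "(\<lambda>\<omega>. f (sticky_bm B L \<gamma> t \<omega>)) \<in> borel_measurable (P x)"
    by (simp add: sticky_bm_def max_absorb2)
  have em: "(\<lambda>\<omega>. exp (- \<beta> * sticky_local_time L \<gamma> t \<omega>)) \<in> borel_measurable (P x)"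
    using sticky_local_time_measurable[OF t, of x] by simp
  show ?thesis
  proof (rule integrable_const_bound[where B=K])
    show "AE \<omega> in P x. norm (f (sticky_bm B L \<gamma> t \<omega>) * exp (- \<beta> * sticky_local_time L \<gamma> t \<omega>)) \<le> K"
    proof (rule AE_I2)
      fix \<omega> assume "\<omega> \<in> space (P x)"
      then have "0 \<le> \<beta> * sticky_local_time L \<gamma> t \<omega>"
        using sticky_clock(3)[of \<omega> t] t \<beta> by (simp add: space_P)
      then have "\<bar>f (sticky_bm B L \<gamma> t \<omega>)\<bar> * exp (- \<beta> * sticky_local_time L \<gamma> t \<omega>) \<le> K * 1"
        using K by (intro mult_mono) (auto simp: sticky_bm_def)
      then show "norm (f (sticky_bm B L \<gamma> t \<omega>) * exp (- \<beta> * sticky_local_time L \<gamma> t \<omega>)) \<le> K"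
        by (simp add: abs_mult)
    qed
  qed (rule borel_measurable_times[OF fY em])
qed

text \<open>The discount factor lies in [0, 1]. Stating the estimate for a pair of functions avoids
  rebuilding their difference as an extensional element of \<open>C0\<close>.\<close>

lemma general_bm_semigroup_contraction:
  assumes \<beta>: "0 < \<beta>" and t: "0 < t" and x: "0 \<le> x" and f: "f \<in> C0" "f' \<in> C0"
    and S: "\<And>y. 0 \<le> y \<Longrightarrow> \<bar>f y - f' y\<bar> \<le> S"
  shows "\<bar>general_bm_semigroup P B L \<beta> \<gamma> t f x - general_bm_semigroup P B L \<beta> \<gamma> t f' x\<bar> \<le> S"
proof -
  interpret prob_space "P x" by (rule prob_space_P)
  let ?e = "\<lambda>f \<omega>. f (sticky_bm B L \<gamma> t \<omega>) * exp (- \<beta> * sticky_local_time L \<gamma> t \<omega>)"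
  have i: "integrable (P x) (?e f)" "integrable (P x) (?e f')"
    using discounted_integrable[OF \<beta> t] f by auto
  have eq: "general_bm_semigroup P B L \<beta> \<gamma> t f x - general_bm_semigroup P B L \<beta> \<gamma> t f' x =
      expectation (\<lambda>\<omega>. ?e f \<omega> - ?e f' \<omega>)"
    unfolding general_bm_semigroup_eq[OF \<beta> t x f(1)] general_bm_semigroup_eq[OF \<beta> t x f(2)]
    by (rule Bochner_Integration.integral_diff[OF i, symmetric])
  have "\<bar>expectation (\<lambda>\<omega>. ?e f \<omega> - ?e f' \<omega>)\<bar> \<le> expectation (\<lambda>\<omega>. \<bar>?e f \<omega> - ?e f' \<omega>\<bar>)"
    by (rule integral_abs_bound)
  also have "\<dots> \<le> expectation (\<lambda>_. S)"
  proof (rule integral_mono)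
    fix \<omega> assume "\<omega> \<in> space (P x)"
    then have "0 \<le> \<beta> * sticky_local_time L \<gamma> t \<omega>"
      using sticky_clock(3)[of \<omega> t] t \<beta> by (simp add: space_P)
    then have "\<bar>f (sticky_bm B L \<gamma> t \<omega>) - f' (sticky_bm B L \<gamma> t \<omega>)\<bar> * exp (- \<beta> * sticky_local_time L \<gamma> t \<omega>) \<le> S * 1"
      using order_trans[OF abs_ge_zero S[OF order_refl]] by (intro mult_mono S) (auto simp: sticky_bm_def)
    then show "\<bar>?e f \<omega> - ?e f' \<omega>\<bar> \<le> S"
      by (simp only: left_diff_distrib[symmetric] abs_mult abs_exp_cancel mult_1_right)
  qed (use i in \<open>auto intro!: integrable_abs Bochner_Integration.integrable_diff\<close>)
  finally show ?thesis unfolding eq using prob_space by simp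
qed

text \<open>Near 0 the factor b is small and the mean local time is at most t/\<gamma>. For x \<ge>
  d the growth of b costs one power of x, since 1 + x \<le> (1 + 1/d) x, and the remaining two
  powers in x^3 E l \<le> 6 t^2 are bounded below by d^2.\<close>

lemma local_time_term_bound:
  assumes x: "0 \<le> x" and t: "0 < t" and d: "0 < d"
    and small: "x < d \<Longrightarrow> \<bar>b\<bar> \<le> e" and large: "\<bar>b\<bar> \<le> C * (1 + x)" and e: "0 \<le> e" and C: "0 \<le> C"
  shows "\<bar>b\<bar> * (LINT \<omega>|P x. sticky_local_time L \<gamma> t \<omega>) \<le> e * (t / \<gamma>) + 6 * C * (1 + 1 / d) / d\<^sup>2 * t\<^sup>2"
proof -
  define l where "l = (LINT \<omega>|P x. sticky_local_time L \<gamma> t \<omega>)"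
  have l: "0 \<le> l" "l \<le> t / \<gamma>" "x ^ 3 * l \<le> 6 * t\<^sup>2"
    unfolding l_def by (rule sticky_moments[OF x t])+
  show ?thesis
  proof (cases "x < d")
    case True
    then have "\<bar>b\<bar> * l \<le> e * (t / \<gamma>)" using small l e by (intro mult_mono) auto
    moreover have "0 \<le> 6 * C * (1 + 1 / d) / d\<^sup>2 * t\<^sup>2" using C d by simp
    ultimately show ?thesis unfolding l_def by linarith
  next
    case False
    then have xd: "d \<le> x" "0 < x" using d by auto
    have "1 \<le> x / d" using xd d by simp
    then have "1 + x \<le> (1 + 1 / d) * x" using xd by (simp add: field_simps)
    then have "C * (1 + x) \<le> C * ((1 + 1 / d) * x)" using C by (rule mult_left_mono)
    with large have "\<bar>b\<bar> \<le> C * ((1 + 1 / d) * x)" by linarith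
    then have "\<bar>b\<bar> * l \<le> C * ((1 + 1 / d) * x) * l" using l(1) by (rule mult_right_mono)
    moreover have "x * l \<le> 6 * t\<^sup>2 / d\<^sup>2"
    proof -
      have "d\<^sup>2 * (x * l) \<le> x\<^sup>2 * (x * l)" using xd d l by (intro mult_right_mono power_mono) auto
      also have "\<dots> = x ^ 3 * l" by (simp add: power2_eq_square power3_eq_cube)
      finally show ?thesis using l(3) d by (simp add: field_simps)
    qed
    then have "C * (1 + 1 / d) * (x * l) \<le> C * (1 + 1 / d) * (6 * t\<^sup>2 / d\<^sup>2)"
      using C d by (intro mult_left_mono) auto
    moreover have "C * ((1 + 1 / d) * x) * l = C * (1 + 1 / d) * (x * l)" by simp
    moreover have "C * (1 + 1 / d) * (6 * t\<^sup>2 / d\<^sup>2) = 6 * C * (1 + 1 / d) / d\<^sup>2 * t\<^sup>2" by simp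
    moreover have "0 \<le> e * (t / \<gamma>)" using e t \<gamma> by simp
    ultimately show ?thesis unfolding l_def by linarith
  qed
qed

text \<open>Second-order expansion of \<open>f\<close> along \<open>B\<^sup>s\<close>. All terms of order \<open>E L\<^sup>s\<^sub>t\<close> are collected in a factor
  that vanishes at \<open>x = 0\<close> by the boundary condition, while \<open>E L\<^sup>s\<^sub>t = O(t\<^sup>2)\<close> away from 0.\<close>

lemma semigroup_expansion:
  assumes \<beta>: "0 < \<beta>" and f: "f \<in> C0" and g: "g \<in> C0" and E: "C2_extension f F0 F1 g"
    and bc: "\<beta> * f 0 - F1 0 + \<gamma> / 2 * g 0 = 0" and e: "0 < e"
  obtains C where "\<And>t x. 0 < t \<Longrightarrow> 0 \<le> x \<Longrightarrow>
    \<bar>general_bm_semigroup P B L \<beta> \<gamma> t f x - f x - t * (g x / 2)\<bar> \<le> e * (1 / 2 + \<beta> / \<gamma> + 1 / \<gamma>) * t + C * t\<^sup>2"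
proof -
  obtain Kf where Kf: "Kf > 0" "\<And>x. x \<ge> 0 \<Longrightarrow> \<bar>f x\<bar> \<le> Kf" using C0_bounded[OF f] by blast
  obtain Kg where Kg: "Kg > 0" "\<And>x. x \<ge> 0 \<Longrightarrow> \<bar>g x\<bar> \<le> Kg" using C0_bounded[OF g] by blast
  obtain d where d: "d > 0" "\<And>x y. x \<ge> 0 \<Longrightarrow> y \<ge> 0 \<Longrightarrow> \<bar>y - x\<bar> < d \<Longrightarrow> \<bar>g y - g x\<bar> < e"
    using C0_modulus[OF g e] by blast
  obtain d' where d': "d' > 0" "\<And>x y. x \<ge> 0 \<Longrightarrow> y \<ge> 0 \<Longrightarrow> \<bar>y - x\<bar> < d' \<Longrightarrow> \<bar>f y - f x\<bar> < e"
    using C0_modulus[OF f e] by blast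
  \<comment> \<open>The coefficient of the mean local time m1 once the moments are inserted: F1 x
    from the first moment, g x / 2 times -(\<gamma> + 2 x) from the second, and -\<beta> f x from
    the killing.\<close>
  define b where "b = (\<lambda>x. F1 x - \<gamma> / 2 * g x - x * g x - \<beta> * f x)"
  have b0: "b 0 = 0" using bc by (simp add: b_def)
  have F1: "(F1 has_real_derivative g x) (at x)" if "x \<ge> 0" for x
    using E that by (simp add: C2_extension_def)
  have contF1: "continuous_on {0..} F1"
    using F1 by (meson DERIV_isCont continuous_at_imp_continuous_on atLeast_iff)
  have contb: "continuous_on {0..} b"
    unfolding b_def using f g contF1 by (intro continuous_intros) (auto simp: C0_iff)
  obtain \<delta> where \<delta>: "\<delta> > 0" "\<And>x. x \<in> {0..} \<Longrightarrow> dist x 0 < \<delta> \<Longrightarrow> dist (b x) (b 0) < e"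
    using contb[unfolded continuous_on_iff, rule_format, of 0 e] e by auto
  \<comment> \<open>A bounded second derivative lets f' grow at most linearly, which is the growth
    that \<open>local_time_term_bound\<close> tolerates in b.\<close>
  have F1_bound: "\<bar>F1 x\<bar> \<le> \<bar>F1 0\<bar> + Kg * x" if x: "x \<ge> 0" for x
  proof (cases "x = 0")
    case False
    then obtain z where z: "0 < z" "z < x" "F1 x - F1 0 = (x - 0) * g z"
      using MVT2[of 0 x F1 g] F1 x by auto
    have "\<bar>x * g z\<bar> \<le> x * Kg" using Kg(2)[of z] z x by (simp add: abs_mult mult_left_mono)
    then show ?thesis using z(3) by (simp add: mult.commute)
  qed simp
  define C where "C = \<bar>F1 0\<bar> + 2 * Kg + \<gamma> / 2 * Kg + \<beta> * Kf"
  have C0: "C \<ge> 0" using Kg(1) Kf(1) \<beta> \<gamma> by (simp add: C_def add_nonneg_nonneg)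
  have b_bound: "\<bar>b x\<bar> \<le> C * (1 + x)" if x: "x \<ge> 0" for x
  proof -
    have 1: "\<bar>\<gamma> / 2 * g x\<bar> \<le> \<gamma> / 2 * Kg" "\<bar>x * g x\<bar> \<le> x * Kg" "\<bar>\<beta> * f x\<bar> \<le> \<beta> * Kf"
      using Kg(2)[OF x] Kf(2)[OF x] \<gamma> \<beta> x by (auto simp: abs_mult intro!: mult_left_mono)
    have "\<bar>b x\<bar> \<le> \<bar>F1 x\<bar> + \<bar>\<gamma> / 2 * g x\<bar> + \<bar>x * g x\<bar> + \<bar>\<beta> * f x\<bar>"
      unfolding b_def by linarith
    also have "\<dots> \<le> (\<bar>F1 0\<bar> + Kg * x) + \<gamma> / 2 * Kg + x * Kg + \<beta> * Kf"
      using F1_bound[OF x] 1 by linarith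
    also have "\<dots> \<le> C + 2 * Kg * x"
      using Kg(1) by (simp add: C_def algebra_simps)
    also have "2 * Kg * x \<le> C * x"
      using Kg(1) Kf(1) \<beta> \<gamma> x by (intro mult_right_mono) (simp_all add: C_def)
    finally show ?thesis by (simp add: algebra_simps)
  qed
  \<comment> \<open>The sources of the quadratic error in t: the fourth moment in the Taylor
    remainder, the product of the killing exponent with the oscillation of f, the quadratic
    remainder of the exponential, and the local time away from 0.\<close>
  define A1 where "A1 = 3 * Kg / d\<^sup>2"
  define A2 where "A2 = 2 * \<beta> * Kf / (\<gamma> * d'\<^sup>2)"
  define A3 where "A3 = Kf * \<beta>\<^sup>2 / \<gamma>\<^sup>2"
  define A4 where "A4 = 6 * C * (1 + 1 / \<delta>) / \<delta>\<^sup>2"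
  show ?thesis
  proof (rule that[of "A1 + A2 + A3 + A4"])
    fix t x :: real assume t: "0 < t" and x: "0 \<le> x"
    interpret prob_space "P x" by (rule prob_space_P)
    define Y where "Y = sticky_bm B L \<gamma> t"
    define l where "l = sticky_local_time L \<gamma> t"
    note m = sticky_moments[OF x t, folded Y_def l_def]
    define m1 where "m1 = expectation l"
    \<comment> \<open>The terms with explicit expectation: the Taylor polynomial of f at x and the
      first-order killing, with f frozen at x.\<close>
    define main where "main = (\<lambda>\<omega>. F1 x * (Y \<omega> - x) + g x / 2 * (Y \<omega> - x)\<^sup>2 - \<beta> * f x * l \<omega>)"
    define err where "err = (\<lambda>\<omega>. (e / 2 * (Y \<omega> - x)\<^sup>2 + Kg / d\<^sup>2 * (Y \<omega> - x) ^ 4)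
      + \<beta> * (t / \<gamma>) * (e + 2 * Kf / d'\<^sup>2 * (Y \<omega> - x)\<^sup>2) + Kf * (\<beta> * (t / \<gamma>))\<^sup>2)"
    let ?e = "\<lambda>\<omega>. f (Y \<omega>) * exp (- \<beta> * l \<omega>)"
    have ei: "integrable (P x) ?e"
      unfolding Y_def l_def by (rule discounted_integrable[OF \<beta> t f])
    have maini: "integrable (P x) main"
      unfolding main_def
      using integrable_mult_right[OF m(1), of "F1 x"] integrable_mult_right[OF m(3), of "g x / 2"]
        integrable_mult_right[OF m(7), of "\<beta> * f x"]
      by (intro Bochner_Integration.integrable_diff Bochner_Integration.integrable_add)
    have erri: "integrable (P x) err"
      unfolding err_def using m(3,5)
      by (intro Bochner_Integration.integrable_add integrable_mult_right) auto
    have pointwise: "\<bar>?e \<omega> - f x - main \<omega>\<bar> \<le> err \<omega>" if \<omega>: "\<omega> \<in> space (P x)" for \<omega>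
    proof -
      have Y0: "0 \<le> Y \<omega>" by (simp add: Y_def sticky_bm_def)
      have l0: "0 \<le> l \<omega>" "l \<omega> \<le> t / \<gamma>"
        using sticky_clock(3,5)[of \<omega> t] \<omega> t by (simp_all add: space_P l_def)
      have bl: "0 \<le> \<beta> * l \<omega>" "\<beta> * l \<omega> \<le> \<beta> * (t / \<gamma>)"
        using l0 \<beta> by (auto intro!: mult_left_mono simp del: times_divide_eq_right)
      have r1: "\<bar>f (Y \<omega>) - f x - F1 x * (Y \<omega> - x) - g x / 2 * (Y \<omega> - x)\<^sup>2\<bar>
          \<le> e / 2 * (Y \<omega> - x)\<^sup>2 + Kg / d\<^sup>2 * (Y \<omega> - x) ^ 4"
        by (rule C2_extension_taylor[OF E d Kg(2) x Y0])
      have fd: "\<bar>f (Y \<omega>) - f x\<bar> \<le> e + 2 * Kf / d'\<^sup>2 * (Y \<omega> - x)\<^sup>2"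
      proof (cases "\<bar>Y \<omega> - x\<bar> < d'")
        case True
        then have "\<bar>f (Y \<omega>) - f x\<bar> < e" using d'(2)[OF x Y0] by blast
        moreover have "0 \<le> 2 * Kf / d'\<^sup>2 * (Y \<omega> - x)\<^sup>2" using Kf(1) by simp
        ultimately show ?thesis by linarith
      next
        case False
        have "\<bar>f (Y \<omega>) - f x\<bar> \<le> 2 * Kf" using Kf(2)[OF Y0] Kf(2)[OF x] by linarith
        also have "\<dots> = 2 * Kf / d'\<^sup>2 * d'\<^sup>2" using d'(1) by simp
        also have "\<dots> \<le> 2 * Kf / d'\<^sup>2 * (Y \<omega> - x)\<^sup>2"
          using False d'(1) Kf(1) by (intro mult_left_mono) (auto simp: abs_le_square_iff[symmetric])
        finally show ?thesis using e by linarith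
      qed
      have r2: "\<bar>\<beta> * l \<omega> * (f (Y \<omega>) - f x)\<bar> \<le> \<beta> * (t / \<gamma>) * (e + 2 * Kf / d'\<^sup>2 * (Y \<omega> - x)\<^sup>2)"
        unfolding abs_mult[of "\<beta> * l \<omega>"] abs_of_nonneg[OF bl(1)]
        by (rule mult_mono[OF bl(2) fd order_trans[OF bl] abs_ge_zero])
      have "\<bar>f (Y \<omega>) * (exp (- (\<beta> * l \<omega>)) - 1 + \<beta> * l \<omega>)\<bar> \<le> Kf * (\<beta> * l \<omega>)\<^sup>2"
        unfolding abs_mult using Kf(2)[OF Y0] exp_minus_quadratic_bound[OF bl(1)] by (intro mult_mono) auto
      also have "\<dots> \<le> Kf * (\<beta> * (t / \<gamma>))\<^sup>2"
        by (rule mult_left_mono[OF power_mono[OF bl(2,1)] less_imp_le[OF Kf(1)]])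
      finally have r3: "\<bar>f (Y \<omega>) * (exp (- (\<beta> * l \<omega>)) - 1 + \<beta> * l \<omega>)\<bar> \<le> Kf * (\<beta> * (t / \<gamma>))\<^sup>2" .
      \<comment> \<open>Three remainders: Taylor's, the error from freezing f at x in the killing
        term, and that of the exponential. They match the three summands of
        \<open>err\<close>.\<close>
      have "?e \<omega> - f x - main \<omega> = (f (Y \<omega>) - f x - F1 x * (Y \<omega> - x) - g x / 2 * (Y \<omega> - x)\<^sup>2)
        - \<beta> * l \<omega> * (f (Y \<omega>) - f x) + f (Y \<omega>) * (exp (- (\<beta> * l \<omega>)) - 1 + \<beta> * l \<omega>)"
        by (simp add: main_def algebra_simps)
      then show ?thesis using r1 r2 r3 unfolding err_def by linarith
    qed
    have Emain: "expectation main = t * (g x / 2) + b x * m1"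
    proof -
      have "expectation main = F1 x * expectation (\<lambda>\<omega>. Y \<omega> - x) + g x / 2 * expectation (\<lambda>\<omega>. (Y \<omega> - x)\<^sup>2) - \<beta> * f x * m1"
        unfolding main_def m1_def
        using integrable_mult_right[OF m(1), of "F1 x"] integrable_mult_right[OF m(3), of "g x / 2"]
          integrable_mult_right[OF m(7), of "\<beta> * f x"]
        by (simp only: Bochner_Integration.integral_diff Bochner_Integration.integral_add
            Bochner_Integration.integrable_add integral_mult_right_zero)
      then show ?thesis
        unfolding m(2) m(4) m1_def[symmetric] b_def by (simp add: field_simps)
    qed
    have m1: "0 \<le> m1" "m1 \<le> t / \<gamma>" unfolding m1_def by (rule m)+
    have sq: "expectation (\<lambda>\<omega>. (Y \<omega> - x)\<^sup>2) \<le> t"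
    proof -
      have "0 \<le> \<gamma> * m1" "0 \<le> 2 * x * m1" using m1 \<gamma> x by auto
      then show ?thesis using m(4) by (simp add: m1_def)
    qed
    have "expectation err = (e / 2 * expectation (\<lambda>\<omega>. (Y \<omega> - x)\<^sup>2) + Kg / d\<^sup>2 * expectation (\<lambda>\<omega>. (Y \<omega> - x) ^ 4))
      + \<beta> * (t / \<gamma>) * (e + 2 * Kf / d'\<^sup>2 * expectation (\<lambda>\<omega>. (Y \<omega> - x)\<^sup>2)) + Kf * (\<beta> * (t / \<gamma>))\<^sup>2"
    proof -
      have i: "integrable (P x) (\<lambda>\<omega>. c * (Y \<omega> - x)\<^sup>2)" "integrable (P x) (\<lambda>\<omega>. c * (Y \<omega> - x) ^ 4)" for c
        using m(3,5) by (auto intro: integrable_mult_right)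
      have c: "expectation (\<lambda>\<omega>. c) = c" for c :: real using prob_space by simp
      show ?thesis
        unfolding err_def using i
        by (simp only: Bochner_Integration.integral_add Bochner_Integration.integrable_add integrable_mult_right
            integral_mult_right_zero integrable_const c)
    qed
    also have "\<dots> \<le> (e / 2 * t + Kg / d\<^sup>2 * (3 * t\<^sup>2)) + \<beta> * (t / \<gamma>) * (e + 2 * Kf / d'\<^sup>2 * t) + Kf * (\<beta> * (t / \<gamma>))\<^sup>2"
      using e Kg(1) Kf(1) \<beta> \<gamma> t by (intro add_mono mult_left_mono sq m(6) order_refl) auto
    finally have Eerr: "expectation err \<le> \<dots>" .
    have U: "general_bm_semigroup P B L \<beta> \<gamma> t f x = expectation ?e"
      unfolding Y_def l_def by (rule general_bm_semigroup_eq[OF \<beta> t x f])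
    have "\<bar>expectation ?e - f x - expectation main\<bar> = \<bar>expectation (\<lambda>\<omega>. ?e \<omega> - f x - main \<omega>)\<bar>"
      using ei maini prob_space by simp
    also have "\<dots> \<le> expectation (\<lambda>\<omega>. \<bar>?e \<omega> - f x - main \<omega>\<bar>)"
      by (rule integral_abs_bound)
    also have "\<dots> \<le> expectation err"
      by (rule integral_mono[OF _ erri pointwise]) (use ei maini in auto)
    finally have 1: "\<bar>expectation ?e - f x - expectation main\<bar> \<le> expectation err" .
    have 2: "\<bar>b x\<bar> * m1 \<le> e * (t / \<gamma>) + 6 * C * (1 + 1 / \<delta>) / \<delta>\<^sup>2 * t\<^sup>2"
      unfolding m1_def l_def
    proof (rule local_time_term_bound[OF x t \<delta>(1) _ b_bound[OF x] _ C0])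
      assume "x < \<delta>"
      then show "\<bar>b x\<bar> \<le> e" using \<delta>(2)[of x] x b0 by (simp add: dist_real_def)
    qed (use e in simp)
    have "\<bar>expectation ?e - f x - t * (g x / 2)\<bar> \<le> \<bar>expectation ?e - f x - expectation main\<bar> + \<bar>b x * m1\<bar>"
      unfolding Emain by linarith
    moreover have "\<bar>b x * m1\<bar> = \<bar>b x\<bar> * m1" using m1 by (simp add: abs_mult)
    ultimately have "\<bar>expectation ?e - f x - t * (g x / 2)\<bar> \<le>
      ((e / 2 * t + Kg / d\<^sup>2 * (3 * t\<^sup>2)) + \<beta> * (t / \<gamma>) * (e + 2 * Kf / d'\<^sup>2 * t) + Kf * (\<beta> * (t / \<gamma>))\<^sup>2)
      + (e * (t / \<gamma>) + 6 * C * (1 + 1 / \<delta>) / \<delta>\<^sup>2 * t\<^sup>2)"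
      using 1 2 Eerr by linarith
    \<comment> \<open>In the factor of e, 1/2 comes from the Taylor remainder, \<beta>/\<gamma> from
      the oscillation of f in the killing term, and 1/\<gamma> from the smallness of b near
      0.\<close>
    also have "\<dots> = e * (1 / 2 + \<beta> / \<gamma> + 1 / \<gamma>) * t + (A1 + A2 + A3 + A4) * t\<^sup>2"
    proof -
      have h1: "Kg / d\<^sup>2 * (3 * t\<^sup>2) = A1 * t\<^sup>2"
        by (simp add: A1_def)
      have h2: "\<beta> * (t / \<gamma>) * (e + 2 * Kf / d'\<^sup>2 * t) = e * (\<beta> / \<gamma>) * t + A2 * t\<^sup>2"
        by (simp add: A2_def distrib_left power2_eq_square ac_simps)
      have h3: "Kf * (\<beta> * (t / \<gamma>))\<^sup>2 = A3 * t\<^sup>2"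
        by (simp add: A3_def power_mult_distrib power_divide)
      show ?thesis
        unfolding h1 h2 h3 A4_def[symmetric] by (simp add: distrib_left distrib_right)
    qed
    finally show "\<bar>general_bm_semigroup P B L \<beta> \<gamma> t f x - f x - t * (g x / 2)\<bar> \<le>
        e * (1 / 2 + \<beta> / \<gamma> + 1 / \<gamma>) * t + (A1 + A2 + A3 + A4) * t\<^sup>2"
      unfolding U .
  qed
qed

lemma generator_contains:
  assumes \<beta>: "0 < \<beta>" and f: "f \<in> C0" and g: "g \<in> C0" and E: "C2_extension f F0 F1 g"
    and bc: "\<beta> * f 0 - F1 0 + \<gamma> / 2 * g 0 = 0"
  shows "(f, \<lambda>x\<in>{0..}. g x / 2) \<in> generator (general_bm_semigroup P B L \<beta> \<gamma>)"
proof -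
  have "(g \<longlongrightarrow> 0) at_top" using g by (simp add: C0_iff)
  from tendsto_divide[OF this tendsto_const[of 2]] have "((\<lambda>x. g x / 2) \<longlongrightarrow> 0) at_top" by simp
  then have "((\<lambda>x\<in>{0..}. g x / 2) \<longlongrightarrow> 0) at_top"
  proof (rule Lim_transform_eventually)
    show "\<forall>\<^sub>F x in at_top. g x / 2 = (\<lambda>x\<in>{0..}. g x / 2) x"
      using eventually_ge_at_top[of 0] by eventually_elim simp
  qed
  moreover have "continuous_on {0..} (\<lambda>x. g x / 2)"
    using g by (intro continuous_intros) (simp_all add: C0_iff)
  then have "continuous_on {0..} (\<lambda>x\<in>{0..}. g x / 2)"
    by (rule continuous_on_eq) simp
  ultimately have h: "(\<lambda>x\<in>{0..}. g x / 2) \<in> C0" by (simp add: C0_iff)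
  have "uniform_limit {0..} (\<lambda>t x. (general_bm_semigroup P B L \<beta> \<gamma> t f x - f x) / t)
      (\<lambda>x\<in>{0..}. g x / 2) (at_right 0)"
  proof (rule uniform_limitI)
    fix \<epsilon> :: real assume \<epsilon>: "0 < \<epsilon>"
    define A where "A = 1 / 2 + \<beta> / \<gamma> + 1 / \<gamma>"
    have A: "A > 0" using \<beta> \<gamma> by (simp add: A_def add_pos_pos)
    \<comment> \<open>Half of \<epsilon> is reserved for the linear error, as e A =
      \<epsilon>/2.\<close>
    define e where "e = \<epsilon> / (2 * A)"
    have e: "e > 0" using \<epsilon> A by (simp add: e_def)
    obtain C where C: "\<And>t x. 0 < t \<Longrightarrow> 0 \<le> x \<Longrightarrow>
      \<bar>general_bm_semigroup P B L \<beta> \<gamma> t f x - f x - t * (g x / 2)\<bar> \<le> e * A * t + C * t\<^sup>2"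
      using semigroup_expansion[OF \<beta> f g E bc e] unfolding A_def by blast
    \<comment> \<open>The other half covers C t for t < r; the denominator |C| + 1 stays positive
      for every real C.\<close>
    define r where "r = \<epsilon> / (2 * (\<bar>C\<bar> + 1))"
    have r: "r > 0" using \<epsilon> by (simp add: r_def)
    have "dist ((general_bm_semigroup P B L \<beta> \<gamma> t f x - f x) / t) ((\<lambda>x\<in>{0..}. g x / 2) x) < \<epsilon>"
      if t: "0 < t" "t < r" and x: "x \<in> {0..}" for t x
    proof -
      have "(general_bm_semigroup P B L \<beta> \<gamma> t f x - f x) / t - g x / 2 =
          (general_bm_semigroup P B L \<beta> \<gamma> t f x - f x - t * (g x / 2)) / t"
        using t by (simp add: field_simps)
      then have "\<bar>(general_bm_semigroup P B L \<beta> \<gamma> t f x - f x) / t - g x / 2\<bar> \<le> (e * A * t + C * t\<^sup>2) / t"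
        using C[of t x] t x by (simp add: divide_right_mono)
      also have "\<dots> = e * A + C * t" using t by (simp add: power2_eq_square field_simps)
      also have "\<dots> < \<epsilon>"
      proof -
        have "C * t \<le> (\<bar>C\<bar> + 1) * t" using t by (intro mult_right_mono) auto
        also have "\<dots> < (\<bar>C\<bar> + 1) * r" using t by (intro mult_strict_left_mono) auto
        also have "\<dots> = \<epsilon> / 2"
        proof -
          have c: "c * (\<epsilon> / (2 * c)) = \<epsilon> / 2" if "c > 0" for c using that by simp
          show ?thesis unfolding r_def by (rule c) simp
        qed
        finally show ?thesis using A by (simp add: e_def)
      qed
      finally show ?thesis using x by (simp add: dist_real_def)
    qed
    then show "\<forall>\<^sub>F t in at_right 0. \<forall>x\<in>{0..}.
        dist ((general_bm_semigroup P B L \<beta> \<gamma> t f x - f x) / t) ((\<lambda>x\<in>{0..}. g x / 2) x) < \<epsilon>"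
      using r unfolding eventually_at_right_field by (intro exI[of _ r]) auto
  qed
  with f h show ?thesis by (simp add: generator_def)
qed

text \<open>Dissipativity at one small time: if D = f - f', then h - h' = D/2, so the difference of
  the semigroup images of f and f' is close to (1 + t/2) D, while contraction keeps it at most S =
  sup |D|. This is contradictory unless S = 0.\<close>

lemma generator_resolvent_inj:
  assumes \<beta>: "0 < \<beta>"
    and fh: "(f, h) \<in> generator (general_bm_semigroup P B L \<beta> \<gamma>)"
    and fh': "(f', h') \<in> generator (general_bm_semigroup P B L \<beta> \<gamma>)"
    and eq: "\<And>x. 0 \<le> x \<Longrightarrow> f x / 2 - h x = f' x / 2 - h' x"
  shows "f = f'"
proof -
  let ?U = "general_bm_semigroup P B L \<beta> \<gamma>"
  have f: "f \<in> C0" "f' \<in> C0"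
    and lim: "uniform_limit {0..} (\<lambda>t x. (?U t f x - f x) / t) h (at_right 0)"
    "uniform_limit {0..} (\<lambda>t x. (?U t f' x - f' x) / t) h' (at_right 0)"
    using fh fh' by (auto simp: generator_def)
  define S where "S = (SUP x\<in>{0..}. \<bar>f x - f' x\<bar>)"
  obtain K where K: "\<And>x. x \<ge> 0 \<Longrightarrow> \<bar>f x\<bar> \<le> K" using C0_bounded[OF f(1)] by blast
  obtain K' where K': "\<And>x. x \<ge> 0 \<Longrightarrow> \<bar>f' x\<bar> \<le> K'" using C0_bounded[OF f(2)] by blast
  have bdd: "bdd_above ((\<lambda>x. \<bar>f x - f' x\<bar>) ` {0..})"
  proof (rule bdd_aboveI2)
    fix x :: real assume "x \<in> {0..}"
    then have "\<bar>f x\<bar> \<le> K" "\<bar>f' x\<bar> \<le> K'" using K K' by auto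
    then show "\<bar>f x - f' x\<bar> \<le> K + K'" by linarith
  qed
  have S: "\<bar>f x - f' x\<bar> \<le> S" if "0 \<le> x" for x
    unfolding S_def using that by (intro cSUP_upper[OF _ bdd]) simp
  have S0: "0 \<le> S" using S[of 0] by simp
  have "S = 0"
  proof (rule ccontr)
    assume "S \<noteq> 0"
    \<comment> \<open>Two approximation errors of S/8 cost t S/4 in total, less than the gain t S/2
      from the factor 1 + t/2.\<close>
    with S0 have e: "0 < S / 8" by simp
    have "\<forall>\<^sub>F t in at_right (0::real). 0 < t \<and> (\<forall>x\<in>{0..}. dist ((?U t f x - f x) / t) (h x) < S / 8) \<and>
        (\<forall>x\<in>{0..}. dist ((?U t f' x - f' x) / t) (h' x) < S / 8)"
      using uniform_limitD[OF lim(1) e] uniform_limitD[OF lim(2) e] eventually_at_right_less[of 0]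
      by eventually_elim simp
    then obtain t :: real where t: "0 < t"
      and d: "\<And>x. x \<ge> 0 \<Longrightarrow> \<bar>(?U t f x - f x) / t - h x\<bar> < S / 8"
      and d': "\<And>x. x \<ge> 0 \<Longrightarrow> \<bar>(?U t f' x - f' x) / t - h' x\<bar> < S / 8"
      using eventually_happens'[OF trivial_limit_at_right_real] unfolding dist_real_def atLeast_iff by blast
    have "\<bar>f x - f' x\<bar> \<le> (S + t * (S / 4)) / (1 + t / 2)" if x: "x \<in> {0..}" for x
    proof -
      have x0: "0 \<le> x" using x by simp
      have "\<bar>(?U t f x - f x) - t * h x\<bar> \<le> t * (S / 8)" "\<bar>(?U t f' x - f' x) - t * h' x\<bar> \<le> t * (S / 8)"
        using d[OF x0] d'[OF x0] t by (auto simp: abs_le_iff abs_less_iff field_simps)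
      moreover have "\<bar>?U t f x - ?U t f' x\<bar> \<le> S"
        by (rule general_bm_semigroup_contraction[OF \<beta> t x0 f S])
      moreover have "t * h x - t * h' x = t / 2 * (f x - f' x)"
      proof -
        have "h x - h' x = (f x - f' x) / 2" using eq[OF x0] by (simp add: field_simps)
        then have "t * (h x - h' x) = t / 2 * (f x - f' x)" by simp
        then show ?thesis by (simp only: right_diff_distrib)
      qed
      ultimately have "\<bar>(f x - f' x) + t / 2 * (f x - f' x)\<bar> \<le> S + t * (S / 4)" by linarith
      moreover have "(f x - f' x) + t / 2 * (f x - f' x) = (1 + t / 2) * (f x - f' x)" by (simp add: distrib_right)
      ultimately have "(1 + t / 2) * \<bar>f x - f' x\<bar> \<le> S + t * (S / 4)" using t by (simp add: abs_mult)
      then show ?thesis using t by (simp add: field_simps)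
    qed
    then have "S \<le> (S + t * (S / 4)) / (1 + t / 2)"
      unfolding S_def[symmetric] by (subst (1) S_def) (intro cSUP_least; simp)
    then have "S * t \<le> 0" using t by (simp add: field_simps)
    with \<open>S \<noteq> 0\<close> S0 t show False by (simp add: mult_le_0_iff)
  qed
  then have "f x = f' x" if "x \<in> {0..}" for x using S[of x] that by simp
  then show ?thesis
    using f by (intro extensionalityI[of f "{0..}" f']) (auto simp: C0_iff)
qed

end

end

theorem theorem4p3:
  fixes \<beta> \<gamma> :: real
    and M :: "'a measure"
    and P :: "real \<Rightarrow> 'a measure"
    and F :: "real \<Rightarrow> 'a measure"
    and B :: "real \<Rightarrow> 'a \<Rightarrow> real"
    and \<theta> :: "real \<Rightarrow> 'a \<Rightarrow> 'a"
    and L :: "real \<Rightarrow> 'a \<Rightarrow> real"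
  assumes "\<beta> > 0" and "\<gamma> > 0"
    and "brownian_local_time M P F B \<theta> L"
  shows "Domain (generator (general_bm_semigroup P B L \<beta> \<gamma>)) =
    {f \<in> C02. \<beta> * f 0 - Lim (at_right 0) (deriv f)
       + \<gamma> / 2 * Lim (at_right 0) (deriv (deriv f)) = 0}"
proof -
  interpret brownian_local_time M P F B \<theta> L by fact
  let ?U = "general_bm_semigroup P B L \<beta> \<gamma>"
  show ?thesis
  proof (intro equalityI subsetI)
    fix f assume "f \<in> {f \<in> C02. \<beta> * f 0 - Lim (at_right 0) (deriv f)
       + \<gamma> / 2 * Lim (at_right 0) (deriv (deriv f)) = 0}"
    then have f: "f \<in> C02" and bc: "\<beta> * f 0 - Lim (at_right 0) (deriv f)
       + \<gamma> / 2 * Lim (at_right 0) (deriv (deriv f)) = 0" by auto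
    obtain F0 F1 g where g: "g \<in> C0" "C2_extension f F0 F1 g"
      using C02_imp_C2_extension[OF f] by blast
    have "\<beta> * f 0 - F1 0 + \<gamma> / 2 * g 0 = 0"
      using bc C2_extension_Lim[OF g(2)] g(1) by (simp add: C0_iff)
    moreover have "f \<in> C0" using f by (simp add: C02_def)
    ultimately show "f \<in> Domain (generator ?U)"
      using generator_contains[OF assms(2,1) _ g] by blast
  next
    fix f assume "f \<in> Domain (generator ?U)"
    then obtain h where fh: "(f, h) \<in> generator ?U" by blast
    then have C0: "f \<in> C0" "h \<in> C0" by (auto simp: generator_def)
    define k where "k = (\<lambda>x\<in>{0..}. f x / 2 - h x)"
    have k: "k \<in> C0"
    proof -
      have "((\<lambda>x. f x / 2 - h x) \<longlongrightarrow> 0 / 2 - 0) at_top"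
        using C0 by (intro tendsto_intros) (simp_all add: C0_iff)
      moreover have "\<forall>\<^sub>F x in at_top. f x / 2 - h x = k x"
        using eventually_ge_at_top[of 0] by eventually_elim (simp add: k_def)
      ultimately have "(k \<longlongrightarrow> 0 / 2 - 0) at_top" by (rule Lim_transform_eventually)
      moreover have "continuous_on {0..} (\<lambda>x. f x / 2 - h x)"
        using C0 by (intro continuous_intros) (simp_all add: C0_iff)
      then have "continuous_on {0..} k" by (rule continuous_on_eq) (simp add: k_def)
      ultimately show ?thesis by (simp add: C0_iff k_def)
    qed
    obtain f' F0 F1 g where f': "f' \<in> C0" "g \<in> C0" "C2_extension f' F0 F1 g"
      and res: "\<And>x. x \<ge> 0 \<Longrightarrow> f' x / 2 - g x / 2 = k x"
      and bc: "\<beta> * f' 0 - F1 0 + \<gamma> / 2 * g 0 = 0"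
      by (rule resolvent_equation_solvable[OF assms(1,2) k]) (rule that)
    \<comment> \<open>\<open>generator_contains\<close> supplies the pair of f' and g/2, whose image
      f'/2 - g/2 is the same k as that of the pair (f, h), so injectivity applies.\<close>
    have "f = f'"
      by (rule generator_resolvent_inj[OF assms(2,1) fh generator_contains[OF assms(2,1) f' bc]])
        (simp add: res k_def)
    moreover have "f' \<in> C02" by (rule C2_extension_imp_C02[OF f'(3,1,2)])
    moreover have "\<beta> * f' 0 - Lim (at_right 0) (deriv f') + \<gamma> / 2 * Lim (at_right 0) (deriv (deriv f')) = 0"
      using bc C2_extension_Lim[OF f'(3)] f'(2) by (simp add: C0_iff)
    ultimately show "f \<in> {f \<in> C02. \<beta> * f 0 - Lim (at_right 0) (deriv f)
       + \<gamma> / 2 * Lim (at_right 0) (deriv (deriv f)) = 0}" by simp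
  qed
qed

end
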